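(* Let $N=J+1$ and consider $Y_{jt}^N=M_{jt}+u_{jt}$ for $1\le j\le N$, $1\le t\le T$, where $M\in\mathbb R^{N\times T}$ is an unknown (possibly random) matrix with $\|M\|_*\le K$ and $E(u\mid M)=0$. Let $$\hat M\in\arg\min_{A\in\mathbb R^{N\times T}}\sum_{t=1}^T\sum_{j=1}^N(Y_{jt}^N-A_{jt})^2\quad\text{s.t. }\|A\|_*\le K.$$ Assume: (1) $\{u_j\}_{j=1}^N$ is independent across $j$ conditional on $M$, where $u_j=(u_{j1},\dots,u_{jT})'$; (2) $\max_{1\le j\le N}T^{-1}\sum_{t=1}^TE(|u_{jt}|^{2\kappa_1}\mid M)=O_P(1)$ for some constant $\kappa_1>1$; (3) $\|N^{-1}\sum_{j=1}^NE(u_ju_j'\mid M)\|=O_P(1)$; (4) there is a sequence $\ell_T>0$ such that $\ell_T(NT)^{-1}K\sqrt{N\vee(N^{1/\kappa_1}T\log N)}=o(1)$ and, with probability $1-o(1)$, $$T^{-1}\sum_{t=1}^T(\hat M_{1t}-M_{1t})^2\le\ell_T(NT)^{-1}\sum_{t=1}^T\sum_{j=1}^N(\hat M_{jt}-M_{jt})^2$$ and $(\hat M_{1t}-M_{1t})^2\le\ell_T(NT)^{-1}\sum_{s=1}^T\sum_{j=1}^N(\hat M_{js}-M_{js})^2$ for $T_0+1\le t\le T$. Let $P_t^N=M_{1t}$ and $\hat P_t^N=\hat M_{1t}$. Then, for any $T_0+1\le t\le T$, $$\hat P_t^N-P_t^N=o_P(1)\quad\text{and}\quad\frac1T\sum_{t=1}^T(\hat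 P_t^N-P_t^N)^2=o_P(1).$$
   Context: $\|\cdot\|_*$ is the nuclear norm (sum of singular values), $\|\cdot\|$ the spectral norm, $a\vee b=\max\{a,b\}$. $u\in\mathbb R^{N\times T}$ has entries $u_{jt}$. $K=K_{N,T}>0$ may vary with the sample size. Asymptotics are as $T_0\to\infty$ (with $T=T_0+T_*$) and $J\to\infty$. All $Y_{jt}^N$ are available because the null hypothesis is imposed. *)

theory Defs
  imports
    "HOL-Probability.Probability"
    "Jordan_Normal_Form.Char_Poly"
begin

text \<open>
  Matrices are those of \<^theory>\<open>Jordan_Normal_Form.Matrix\<close>, whose dimensions are terms and may
  therefore grow with the sample size. Indices start at 0.
\<close>

subsection \<open>Singular values and matrix norms\<close>

text \<open>
  All complex roots of the characteristic polynomial of the positive semidefinite matrix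
  \<open>A\<^sup>T A\<close> are real and nonnegative, so taking its real roots loses nothing. For an \<open>m \<times> n\<close>
  matrix the multiset has \<open>n\<close> elements, so it may contain more zeros than the usual list of
  \<open>min m n\<close> singular values; this affects neither norm.
\<close>

definition singular_values :: "real mat \<Rightarrow> real multiset" where
  "singular_values A = image_mset sqrt (proots (char_poly (transpose_mat A * A)))"

definition nuclear_norm :: "real mat \<Rightarrow> real" where
  "nuclear_norm A = sum_mset (singular_values A)"

text \<open>The extra 0 only matters for matrices without columns.\<close>

definition spectral_norm :: "real mat \<Rightarrow> real" where
  "spectral_norm A = Max (insert 0 (set_mset (singular_values A)))"

definition sq_loss :: "nat \<Rightarrow> nat \<Rightarrow> real mat \<Rightarrow> real mat \<Rightarrow> real" where
  "sq_loss N T Y A = (\<Sum>t<T. \<Sum>j<N. (Y $$ (j, t) - A $$ (j, t))\<^sup>2)"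

definition nuclear_ls_estimate :: "nat \<Rightarrow> nat \<Rightarrow> real \<Rightarrow> real mat \<Rightarrow> real mat \<Rightarrow> bool" where
  "nuclear_ls_estimate N T K Y B \<longleftrightarrow>
     is_arg_min (sq_loss N T Y) (\<lambda>A. A \<in> carrier_mat N T \<and> nuclear_norm A \<le> K) B"

subsection \<open>Random matrices and conditioning\<close>

definition random_matrix :: "'a measure \<Rightarrow> nat \<Rightarrow> nat \<Rightarrow> ('a \<Rightarrow> real mat) \<Rightarrow> bool" where
  "random_matrix P N T X \<longleftrightarrow>
     (\<forall>\<omega>\<in>space P. X \<omega> \<in> carrier_mat N T) \<and>
     (\<forall>j<N. \<forall>t<T. (\<lambda>\<omega>. X \<omega> $$ (j, t)) \<in> borel_measurable P)"

definition matrix_sigma :: "'a measure \<Rightarrow> nat \<Rightarrow> nat \<Rightarrow> ('a \<Rightarrow> real mat) \<Rightarrow> 'a measure" where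
  "matrix_sigma P N T X =
     vimage_algebra (space P) (\<lambda>\<omega>. \<lambda>i\<in>{..<N} \<times> {..<T}. X \<omega> $$ i)
       (\<Pi>\<^sub>M i\<in>{..<N} \<times> {..<T}. borel)"

definition matrix_row :: "nat \<Rightarrow> ('a \<Rightarrow> real mat) \<Rightarrow> nat \<Rightarrow> 'a \<Rightarrow> nat \<Rightarrow> real" where
  "matrix_row T X j \<omega> = (\<lambda>t\<in>{..<T}. X \<omega> $$ (j, t))"

text \<open>
  \<^const>\<open>real_cond_exp\<close> returns 0 where the conditional expectations of the positive and the negative
  part are both infinite; finiteness of the conditional absolute moment rules this out.
\<close>

definition cond_mean_zero :: "'a measure \<Rightarrow> 'a measure \<Rightarrow> ('a \<Rightarrow> real) \<Rightarrow> bool" where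
  "cond_mean_zero P F X \<longleftrightarrow>
     (AE \<omega> in P. nn_cond_exp P F (\<lambda>\<omega>. ennreal \<bar>X \<omega>\<bar>) \<omega> < \<infinity>) \<and>
     (AE \<omega> in P. real_cond_exp P F X \<omega> = 0)"

definition cond_indep_vars ::
  "'a measure \<Rightarrow> 'a measure \<Rightarrow> ('i \<Rightarrow> 'b measure) \<Rightarrow> ('i \<Rightarrow> 'a \<Rightarrow> 'b) \<Rightarrow> 'i set \<Rightarrow> bool" where
  "cond_indep_vars P F M X I \<longleftrightarrow>
     (\<forall>i\<in>I. X i \<in> P \<rightarrow>\<^sub>M M i) \<and>
     (\<forall>J A. J \<subseteq> I \<and> finite J \<and> (\<forall>i\<in>J. A i \<in> sets (M i)) \<longrightarrow>
       (AE \<omega> in P. real_cond_exp P F (indicator {\<omega> \<in> space P. \<forall>i\<in>J. X i \<omega> \<in> A i}) \<omega>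
          = (\<Prod>i\<in>J. real_cond_exp P F (indicator {\<omega> \<in> space P. X i \<omega> \<in> A i}) \<omega>)))"

text \<open>
  \<open>max\<^sub>j T\<^sup>-\<^sup>1 \<Sum>\<^sub>t E(\<bar>u\<^sub>j\<^sub>t\<bar>\<^sup>p | F)\<close>, with values in the extended nonnegative reals, so that
  infinite conditional moments are represented as such.
\<close>

definition max_cond_moment ::
  "'a measure \<Rightarrow> 'a measure \<Rightarrow> nat \<Rightarrow> nat \<Rightarrow> real \<Rightarrow> ('a \<Rightarrow> real mat) \<Rightarrow> 'a \<Rightarrow> ennreal" where
  "max_cond_moment P F N T p u \<omega> =
     (MAX j\<in>{..<N}. (\<Sum>t<T. nn_cond_exp P F (\<lambda>\<omega>. ennreal (\<bar>u \<omega> $$ (j, t)\<bar> powr p)) \<omega>)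
                      / of_nat T)"

text \<open>\<open>N\<^sup>-\<^sup>1 \<Sum>\<^sub>j E(u\<^sub>j u\<^sub>j' | F)\<close>, a \<open>T \<times> T\<close> matrix. Where some conditional second
  moment is infinite, \<^const>\<open>real_cond_exp\<close> gives arbitrary values; a finite conditional moment of
  order above 2 excludes this, so boundedness in probability is not affected.\<close>

definition avg_cond_second_moment ::
  "'a measure \<Rightarrow> 'a measure \<Rightarrow> nat \<Rightarrow> nat \<Rightarrow> ('a \<Rightarrow> real mat) \<Rightarrow> 'a \<Rightarrow> real mat" where
  "avg_cond_second_moment P F N T u \<omega> =
     Matrix.mat T T (\<lambda>(s, t). (\<Sum>j<N. real_cond_exp P F (\<lambda>\<omega>. u \<omega> $$ (j, s) * u \<omega> $$ (j, t)) \<omega>)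
                              / real N)"

subsection \<open>Stochastic order symbols\<close>

text \<open>
  The probability space may change with the sample index \<open>n\<close>. Measurability is part of the
  definitions because \<^const>\<open>measure\<close> vanishes on non-measurable sets.
\<close>

definition bigO_P_1 :: "(nat \<Rightarrow> 'a measure) \<Rightarrow> (nat \<Rightarrow> 'a \<Rightarrow> ennreal) \<Rightarrow> bool" where
  "bigO_P_1 P X \<longleftrightarrow>
     (\<forall>n. X n \<in> borel_measurable (P n)) \<and>
     (\<forall>\<epsilon>>0. \<exists>C::real. \<forall>\<^sub>F n in sequentially.
        measure (P n) {\<omega> \<in> space (P n). X n \<omega> > ennreal C} \<le> \<epsilon>)"

definition smallo_P_1 :: "(nat \<Rightarrow> 'a measure) \<Rightarrow> (nat \<Rightarrow> 'a \<Rightarrow> real) \<Rightarrow> bool" where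
  "smallo_P_1 P X \<longleftrightarrow>
     (\<forall>n. X n \<in> borel_measurable (P n)) \<and>
     (\<forall>\<epsilon>>0. (\<lambda>n. measure (P n) {\<omega> \<in> space (P n). \<bar>X n \<omega>\<bar> > \<epsilon>}) \<longlonglongrightarrow> 0)"

end

theory Submission
  imports
    Defs
    "Jordan_Normal_Form.Schur_Decomposition"
    "Jordan_Normal_Form.Spectral_Radius"
begin

text \<open>
  Comparing the estimate with the feasible point \<open>M\<close> and using trace duality gives
  \<open>\<parallel>Mhat - M\<parallel>\<^sub>F\<^sup>2 \<le> 2 \<langle>u, Mhat - M\<rangle> \<le> 4 K \<parallel>u\<parallel>\<close>, so it suffices to show that
  \<open>\<parallel>u\<parallel>\<^sup>2\<close> is of stochastic order \<open>max N (N\<^bsup>1/\<kappa>\<^esup> T ln N)\<close>.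

  The moment condition allows us to truncate the rows at squared length \<open>L = c T N\<^bsup>1/\<kappa>\<^esup>\<close>. The truncated
  and normalized rows \<open>v\<^sub>j\<close> have length at most 1 and are conditionally independent. With
  \<open>B\<^sub>j = E(v\<^sub>j v\<^sub>j' | M)\<close> and \<open>p\<close> of order \<open>ln N\<close>, the expectation of \<open>tr (p I + \<Sum>v\<^sub>j v\<^sub>j')\<^sup>p\<close> is bounded
  by that of \<open>tr (p I + e \<Sum>B\<^sub>j)\<^sup>p\<close>: the rows are exchanged one by one. If \<open>W \<ge> p I\<close>, then
  \<open>tr (W + v v')\<^sup>p \<le> tr W\<^sup>p + p e v' W\<^bsup>p-1\<^esup> v\<close>, whose conditional expectation
  \<open>tr W\<^sup>p + p e tr (B W\<^bsup>p-1\<^esup>)\<close> is at most \<open>tr (W + e B)\<^sup>p\<close> by convexity. Subtracting the constant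
  \<open>tr (p I)\<^sup>p\<close> on both sides makes the bound depend on \<open>tr \<Sum>B\<^sub>j \<le> N\<close> rather than on the dimension \<open>T\<close>.
\<close>

subsection \<open>Diagonalization of real symmetric matrices\<close>

text \<open>Markov's inequality turns the bound on the expected trace into a bound of order gamma +
  p for the largest eigenvalue of the sum of the v_j v_j', where gamma = N C2 / L bounds the sum of
  the B_j. Multiplied by L this is of order N + p L, which produces the two entries of the maximum.
  The level L is just large enough for a union bound over the N rows. A factor N remains in front of
  the trace bound; a power of order ln N is high enough to absorb it. The shift by p serves the
  scalar inequality (1 + 1/x)^k <= e for x >= k: adding a vector of length at most 1 then costs no
  more than a linear term with factor e. Two probabilistic obstacles shape the rest. Conditional
  expectations are fixed only up to null sets, so the pathwise inequalities are confined to an event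
  of the conditioning sigma-algebra on which the chosen versions B_j behave well at every point. The
  rows are independent only given M, so it has to be shown that adjoining the earlier rows to the
  conditioning does not change the conditional expectation of a bounded function of the next
  row.\<close>

unbundle no inner_syntax
unbundle no vec_syntax
hide_const (open) Finite_Cartesian_Product.vec Finite_Cartesian_Product.mat
  Determinants.det

lemma scalar_prod_eq_sum:
  "w \<in> carrier_vec n \<Longrightarrow> v \<bullet> w = (\<Sum>s<n. v $ s * w $ s)"
  by (simp add: scalar_prod_def lessThan_atLeast0)

text \<open>Over the complex numbers an eigenvector \<open>v\<close> always exists. Symmetry moves
  the matrix across the product of \<open>v\<close> with its conjugate, which forces
  \<open>e = cnj e\<close>; a real root of the complexified characteristic polynomial is a root of
  the real one.\<close>

lemma symmetric_real_eigenvalue: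
  fixes A :: "real mat"
  assumes A: "A \<in> carrier_mat n n" and sym: "transpose_mat A = A" and n: "n > 0"
  shows "\<exists>e. eigenvalue A e"
proof -
  let ?C = "of_real_hom.mat_hom A :: complex mat"
  have C: "?C \<in> carrier_mat n n" using A by simp
  obtain e where "eigenvalue ?C e" using spectrum_non_empty[OF C n] by (auto simp: spectrum_def)
  then obtain v where v: "v \<in> carrier_vec n" "v \<noteq> 0\<^sub>v n" "?C *\<^sub>v v = e \<cdot>\<^sub>v v"
    using C unfolding eigenvalue_def eigenvector_def by auto
  have Ct: "transpose_mat ?C = ?C" using A sym by (metis map_mat_transpose)
  have cv: "conjugate v \<in> carrier_vec n" using v by simp
  have conjC: "?C *\<^sub>v conjugate v = conjugate (?C *\<^sub>v v)"
  proof (rule eq_vecI)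
    fix i assume i: "i < dim_vec (conjugate (?C *\<^sub>v v))"
    then have i: "i < n" using A by simp
    have "(?C *\<^sub>v conjugate v) $ i = (\<Sum>s<n. complex_of_real (A $$ (i,s)) * cnj (v $ s))"
      using i A v by (simp add: scalar_prod_eq_sum[OF cv])
    also have "\<dots> = cnj (\<Sum>s<n. complex_of_real (A $$ (i,s)) * v $ s)" by simp
    also have "(\<Sum>s<n. complex_of_real (A $$ (i,s)) * v $ s) = (?C *\<^sub>v v) $ i"
      using i A v(1) by (simp add: scalar_prod_eq_sum[OF v(1)])
    finally show "(?C *\<^sub>v conjugate v) $ i = conjugate (?C *\<^sub>v v) $ i" using i A by simp
  qed (use A in auto)
  have "e * (v \<bullet> conjugate v) = (?C *\<^sub>v v) \<bullet> conjugate v" using v cv by simp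
  also have "\<dots> = v \<bullet> (?C *\<^sub>v conjugate v)"
    using transpose_vec_mult_scalar[OF C cv v(1)] Ct by simp
  also have "\<dots> = v \<bullet> (cnj e \<cdot>\<^sub>v conjugate v)"
    unfolding conjC v(3) by (simp add: conjugate_smult_vec)
  also have "\<dots> = cnj e * (v \<bullet> conjugate v)" using v cv by simp
  finally have "e = cnj e" using conjugate_square_eq_0_vec[OF v(1)] v(2) by simp
  then have er: "e = complex_of_real (Re e)" by (simp add: complex_eq_iff)
  have "poly (char_poly ?C) e = 0" using \<open>eigenvalue ?C e\<close> eigenvalue_root_char_poly[OF C] by simp
  then have "poly (char_poly ?C) (complex_of_real (Re e)) = 0" using er by simp
  then have "poly (char_poly A) (Re e) = 0"
    unfolding of_real_hom.char_poly_hom[OF A] of_real_hom.poly_map_poly by simp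
  then show ?thesis using eigenvalue_root_char_poly[OF A] by blast
qed

text \<open>Gram-Schmidt keeps the head of the list, so a basis that starts with \<open>v\<close>
  becomes an orthogonal one that starts with \<open>v\<close>. Normalizing gives the columns of
  \<open>W\<close> and leaves column 0 a multiple of \<open>v\<close>.\<close>

lemma orthogonal_completion:
  fixes v :: "real vec"
  assumes v: "v \<in> carrier_vec n" "v \<noteq> 0\<^sub>v n" and n: "n > 0"
  obtains W c where "W \<in> carrier_mat n n" "transpose_mat W * W = 1\<^sub>m n" "W * transpose_mat W = 1\<^sub>m n"
    "col W 0 = c \<cdot>\<^sub>v v"
proof -
  interpret cof_vec_space n "TYPE(real)" .
  define b where "b = basis_completion v"
  define ws where "ws = gram_schmidt n b"
  from basis_completion[OF v, folded b_def]
  have dist_b: "distinct b" and indep: "\<not> lin_dep (set b)" and b: "set b \<subseteq> carrier_vec n" 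
    and hdb: "hd b = v" and len_b: "length b = n" by auto
  from hdb len_b n obtain vs where bv: "b = v # vs" by (cases b, auto)
  from gram_schmidt_result[OF b dist_b indep refl, folded ws_def]
  have ws: "set ws \<subseteq> carrier_vec n" "corthogonal ws" "length ws = n" by (auto simp: len_b)
  have hdws: "hd ws = v" using gram_schmidt_hd[OF v(1), of vs, folded bv] unfolding ws_def .
  then have ws0: "ws ! 0 = v" using ws(3) n by (metis hd_conv_nth list.size(3) less_irrefl)
  have wsc: "ws ! i \<in> carrier_vec n" if "i < n" for i using ws that by auto
  have orth: "(ws ! i \<bullet> ws ! j = 0) = (i \<noteq> j)" if "i < n" "j < n" for i j
    using corthogonalD[OF ws(2), of i j] that ws(3) by simp
  have pos: "ws ! i \<bullet> ws ! i > 0" if "i < n" for i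
    using orth[OF that that] scalar_prod_eq_sum[OF wsc[OF that]]
    by (metis (no_types, lifting) less_eq_real_def sum_nonneg zero_le_square)
  define d where "d i = 1 / sqrt (ws ! i \<bullet> ws ! i)" for i
  define W where "W = mat n n (\<lambda>(s,i). d i * (ws ! i) $ s)"
  have W: "W \<in> carrier_mat n n" by (simp add: W_def)
  have colW: "col W i = d i \<cdot>\<^sub>v ws ! i" if "i < n" for i
    using that wsc[OF that] by (intro eq_vecI) (auto simp: W_def)
  have WtW: "transpose_mat W * W = 1\<^sub>m n"
  proof (rule eq_matI)
    fix i j assume ij: "i < dim_row (1\<^sub>m n)" "j < dim_col (1\<^sub>m n)"
    then have i: "i < n" and j: "j < n" by auto
    have "(transpose_mat W * W) $$ (i,j) = col W i \<bullet> col W j" using i j W by simp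
    also have "\<dots> = d i * d j * (ws ! i \<bullet> ws ! j)"
      using wsc[OF i] wsc[OF j] by (simp add: colW[OF i] colW[OF j])
    also have "\<dots> = 1\<^sub>m n $$ (i,j)"
    proof (cases "i = j")
      case True
      then show ?thesis using pos[OF i] i by (simp add: d_def)
    next
      case False
      then show ?thesis using orth[OF i j] i j by simp
    qed
    finally show "(transpose_mat W * W) $$ (i,j) = 1\<^sub>m n $$ (i,j)" .
  qed (use W in auto)
  have Wt: "transpose_mat W \<in> carrier_mat n n" using W by simp
  show ?thesis
    using that[OF W WtW mat_mult_left_right_inverse[OF Wt W WtW]] colW[OF n] ws0 by metis
qed

text \<open>Deflation: in an orthonormal basis that starts with an eigenvector, column 0 and by
  symmetry row 0 vanish off the diagonal, and the induction hypothesis applies to the remaining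
  block.\<close>

lemma symmetric_diagonalization:
  fixes A :: "real mat"
  assumes "A \<in> carrier_mat n n" and "transpose_mat A = A"
  shows "\<exists>Q l. Q \<in> carrier_mat n n \<and> transpose_mat Q * Q = 1\<^sub>m n \<and> Q * transpose_mat Q = 1\<^sub>m n \<and>
    A = Q * mat_diag n l * transpose_mat Q"
  using assms
proof (induction n arbitrary: A)
  case 0
  then have "A = 1\<^sub>m 0" by auto
  then show ?case by (intro exI[of _ "1\<^sub>m 0"] exI[of _ "\<lambda>_. 0"]) (auto simp: mat_diag_def)
next
  case (Suc m A)
  note A = Suc.prems(1) and sym = Suc.prems(2)
  have assoc: "X * Y * Z = X * (Y * Z)" if "X \<in> carrier_mat (Suc m) (Suc m)"
    "Y \<in> carrier_mat (Suc m) (Suc m)" "Z \<in> carrier_mat (Suc m) (Suc m)" for X Y Z :: "real mat"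
    using assoc_mult_mat[OF that] .
  have tr: "transpose_mat (X * Y) = transpose_mat Y * transpose_mat X" if "X \<in> carrier_mat (Suc m) (Suc m)"
    "Y \<in> carrier_mat (Suc m) (Suc m)" for X Y :: "real mat"
    using transpose_mult[OF that] .
  obtain e v where v: "v \<in> carrier_vec (Suc m)" "v \<noteq> 0\<^sub>v (Suc m)" "A *\<^sub>v v = e \<cdot>\<^sub>v v"
    using symmetric_real_eigenvalue[OF A sym] A unfolding eigenvalue_def eigenvector_def by auto
  obtain W c where W: "W \<in> carrier_mat (Suc m) (Suc m)"
    and WtW: "transpose_mat W * W = 1\<^sub>m (Suc m)" and WWt: "W * transpose_mat W = 1\<^sub>m (Suc m)"
    and col0: "col W 0 = c \<cdot>\<^sub>v v"
    using orthogonal_completion[OF v(1,2)] by auto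
  have Wt[simp]: "transpose_mat W \<in> carrier_mat (Suc m) (Suc m)" using W by simp
  define A' where "A' = transpose_mat W * A * W"
  have A': "A' \<in> carrier_mat (Suc m) (Suc m)" using A W by (simp add: A'_def)
  have symA': "transpose_mat A' = A'"
    using A W sym by (simp add: A'_def tr assoc)
  \<comment> \<open>Column 0 of \<open>A * W\<close> is \<open>e\<close> times column 0 of
    \<open>W\<close>, so column 0 of \<open>A'\<close> is \<open>e\<close> times that of
    \<open>transpose_mat W * W\<close>.\<close>
  have A'0: "A' $$ (i, 0) = (if i = 0 then e else 0)" if i: "i < Suc m" for i
  proof -
    have "col (A * W) 0 = e \<cdot>\<^sub>v col W 0"
      using A W v mult_mat_vec[OF A v(1), of c] col_mult2[OF A W, of 0]
      by (simp add: col0 smult_smult_assoc mult.commute)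
    then have "A' $$ (i, 0) = col W i \<bullet> (e \<cdot>\<^sub>v col W 0)"
      using A W i by (simp add: A'_def assoc)
    also have "\<dots> = e * (transpose_mat W * W) $$ (i,0)" using W i by simp
    finally show ?thesis using i unfolding WtW by simp
  qed
  define A3 where "A3 = mat m m (\<lambda>(i,j). A' $$ (Suc i, Suc j))"
  have A3: "A3 \<in> carrier_mat m m" by (simp add: A3_def)
  have entry_sym: "A' $$ (i,j) = A' $$ (j,i)" if "i < Suc m" "j < Suc m" for i j
    using that A' symA' by (metis carrier_matD index_transpose_mat(1))
  have "transpose_mat A3 = A3" by (rule eq_matI) (auto simp: A3_def entry_sym)
  from Suc.IH[OF A3 this] obtain Q l where Q: "Q \<in> carrier_mat m m"
    and QtQ: "transpose_mat Q * Q = 1\<^sub>m m" and QQt: "Q * transpose_mat Q = 1\<^sub>m m"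
    and A3Q: "A3 = Q * mat_diag m l * transpose_mat Q" by auto
  define l' where "l' = case_nat e l"
  define R where "R = four_block_mat (1\<^sub>m 1) (0\<^sub>m 1 m) (0\<^sub>m m 1) Q"
  have R: "R \<in> carrier_mat (Suc m) (Suc m)"
    using four_block_carrier_mat[OF one_carrier_mat[of 1] Q] by (simp add: R_def)
  have Rt: "transpose_mat R = four_block_mat (1\<^sub>m 1) (0\<^sub>m 1 m) (0\<^sub>m m 1) (transpose_mat Q)"
    unfolding R_def by (subst transpose_four_block_mat[of _ 1 1 _ m _ m]) (use Q in auto)
  have Rt': "transpose_mat R \<in> carrier_mat (Suc m) (Suc m)" using R by simp
  have one: "four_block_mat (1\<^sub>m 1) (0\<^sub>m 1 m) (0\<^sub>m m 1) (1\<^sub>m m) = 1\<^sub>m (Suc m)"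
    by (rule eq_matI) auto
  have RtR: "transpose_mat R * R = 1\<^sub>m (Suc m)"
    unfolding Rt unfolding R_def
    by (subst mult_four_block_mat[of _ 1 1 _ m _ m _ _ 1 _ m]) (use Q QtQ one in auto)
  have RRt: "R * transpose_mat R = 1\<^sub>m (Suc m)"
    unfolding Rt unfolding R_def
    by (subst mult_four_block_mat[of _ 1 1 _ m _ m _ _ 1 _ m]) (use Q QQt one in auto)
  have D: "mat_diag (Suc m) l' = four_block_mat (mat_diag 1 (\<lambda>_. e)) (0\<^sub>m 1 m) (0\<^sub>m m 1) (mat_diag m l)"
    by (rule eq_matI) (auto simp: mat_diag_def l'_def split: nat.split)
  have A'0': "A' $$ (0, i) = (if i = 0 then e else 0)" if "i < Suc m" for i
    using A'0[OF that] entry_sym[of 0 i] that by simp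
  have A'b: "A' = four_block_mat (mat_diag 1 (\<lambda>_. e)) (0\<^sub>m 1 m) (0\<^sub>m m 1) A3"
  proof (rule eq_matI, goal_cases)
    case (1 i j)
    then show ?case using A'0 A'0'
      by (cases i; cases j) (auto simp: mat_diag_def A3_def)
  qed (use A' A3 in \<open>auto simp: mat_diag_def\<close>)
  have A'R: "A' = R * mat_diag (Suc m) l' * transpose_mat R"
  proof -
    have "R * mat_diag (Suc m) l' = four_block_mat (mat_diag 1 (\<lambda>_. e)) (0\<^sub>m 1 m) (0\<^sub>m m 1) (Q * mat_diag m l)"
      unfolding D R_def
      by (subst mult_four_block_mat[of _ 1 1 _ m _ m _ _ 1 _ m])
        (use Q mat_diag_dim[of 1 "\<lambda>_. e"] mat_diag_dim[of m l] in
          \<open>auto simp del: mat_diag_dim simp: left_mult_one_mat[of _ 1 1] left_mult_zero_mat[of _ 1 1]\<close>)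
    moreover have "\<dots> * transpose_mat R = A'"
      unfolding A'b Rt
      by (subst mult_four_block_mat[of _ 1 1 _ m _ m _ _ 1 _ m])
        (use Q A3Q mat_diag_dim[of 1 "\<lambda>_. e"] mat_diag_dim[of m l] in
          \<open>auto simp del: mat_diag_dim simp: right_mult_one_mat[of _ 1 1] right_mult_zero_mat[of _ 1 1]
            right_mult_zero_mat[of _ m m]\<close>)
    ultimately show ?thesis by simp
  qed
  have "W * A' * transpose_mat W = (W * transpose_mat W) * A * (W * transpose_mat W)"
    using W A unfolding A'_def by (simp add: assoc)
  then have AW: "A = W * A' * transpose_mat W" using A by (simp add: WWt)
  have WR: "W * R \<in> carrier_mat (Suc m) (Suc m)" using W R by simp
  have "transpose_mat (W * R) * (W * R) = transpose_mat R * (transpose_mat W * W) * R"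
    using W R by (simp add: tr assoc)
  then have 1: "transpose_mat (W * R) * (W * R) = 1\<^sub>m (Suc m)" using R RtR by (simp add: WtW)
  have 2: "(W * R) * transpose_mat (W * R) = 1\<^sub>m (Suc m)"
    by (rule mat_mult_left_right_inverse[OF _ WR 1]) (use WR in simp)
  have 3: "A = (W * R) * mat_diag (Suc m) l' * transpose_mat (W * R)"
  proof -
    define D where "D = mat_diag (Suc m) l'"
    have "D \<in> carrier_mat (Suc m) (Suc m)" by (simp add: D_def)
    then show ?thesis
      using W R Rt' by (subst AW) (simp add: A'R D_def[symmetric] tr assoc)
  qed
  show ?case using WR 1 2 3 by blast
qed

subsection \<open>Orthonormal eigenbases in coordinates\<close>

text \<open>
  Square matrices whose entries are random variables are represented by functions of two indices,
  of which only those below the dimension \<open>n\<close> matter.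
\<close>

definition inner_on :: "nat \<Rightarrow> (nat \<Rightarrow> real) \<Rightarrow> (nat \<Rightarrow> real) \<Rightarrow> real" where
  "inner_on n x y = (\<Sum>s<n. x s * y s)"

definition bilin :: "nat \<Rightarrow> (nat \<Rightarrow> nat \<Rightarrow> real) \<Rightarrow> (nat \<Rightarrow> real) \<Rightarrow> (nat \<Rightarrow> real) \<Rightarrow> real" where
  "bilin n A x y = (\<Sum>s<n. \<Sum>t<n. x s * A s t * y t)"

text \<open>Powers are built from entries, not from eigenvalues: as polynomials in the entries they
  inherit measurability and boundedness. Eigenvectors are chosen without regard to measurability and
  serve only in pointwise inequalities.\<close>

fun matpow :: "nat \<Rightarrow> (nat \<Rightarrow> nat \<Rightarrow> real) \<Rightarrow> nat \<Rightarrow> nat \<Rightarrow> nat \<Rightarrow> real" where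
  "matpow n A 0 s t = (if s = t then 1 else 0)"
| "matpow n A (Suc k) s t = (\<Sum>r<n. A s r * matpow n A k r t)"

definition trace_pow :: "nat \<Rightarrow> (nat \<Rightarrow> nat \<Rightarrow> real) \<Rightarrow> nat \<Rightarrow> real" where
  "trace_pow n A k = (\<Sum>s<n. matpow n A k s s)"

definition symm_on :: "nat \<Rightarrow> (nat \<Rightarrow> nat \<Rightarrow> real) \<Rightarrow> bool" where
  "symm_on n A \<longleftrightarrow> (\<forall>s<n. \<forall>t<n. A s t = A t s)"

text \<open>\<open>q i\<close> is the \<open>i\<close>-th eigenvector and \<open>l i\<close> its
  eigenvalue. The clauses are orthonormality, resolution of the identity and spectral decomposition,
  written in entries so that they can rewrite finite sums.\<close>

definition eigenbasis :: "nat \<Rightarrow> (nat \<Rightarrow> nat \<Rightarrow> real) \<Rightarrow> (nat \<Rightarrow> nat \<Rightarrow> real) \<Rightarrow> (nat \<Rightarrow> real) \<Rightarrow> bool" where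
  "eigenbasis n A q l \<longleftrightarrow>
     (\<forall>i<n. \<forall>j<n. inner_on n (q i) (q j) = (if i = j then 1 else 0)) \<and>
     (\<forall>s<n. \<forall>t<n. (\<Sum>i<n. q i s * q i t) = (if s = t then 1 else 0)) \<and>
     (\<forall>s<n. \<forall>t<n. A s t = (\<Sum>i<n. l i * q i s * q i t))"

lemma inner_on_commute: "inner_on n x y = inner_on n y x"
  by (simp add: inner_on_def mult.commute)

text \<open>The characteristic polynomial is recorded together with the basis because singular
  values are defined through its roots.\<close>

lemma eigenbasis_mat:
  fixes A :: "real mat"
  assumes A: "A \<in> carrier_mat n n" and sym: "transpose_mat A = A"
  obtains q l where "eigenbasis n (\<lambda>s t. A $$ (s,t)) q l" "char_poly A = (\<Prod>i<n. [:- l i, 1:])"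
proof -
  obtain Q l where Q: "Q \<in> carrier_mat n n" and QtQ: "transpose_mat Q * Q = 1\<^sub>m n"
    and QQt: "Q * transpose_mat Q = 1\<^sub>m n" and AQ: "A = Q * mat_diag n l * transpose_mat Q"
    using symmetric_diagonalization[OF assms] by auto
  define q where "q i s = Q $$ (s,i)" for i s
  have QD: "Q * mat_diag n l = mat n n (\<lambda>(i,j). Q $$ (i,j) * l j)"
    by (rule mat_diag_mult_right[OF Q])
  have 1: "inner_on n (q i) (q j) = (if i = j then 1 else 0)" if "i < n" "j < n" for i j
  proof -
    have "inner_on n (q i) (q j) = (transpose_mat Q * Q) $$ (i,j)"
      using that Q by (simp add: scalar_prod_def inner_on_def q_def lessThan_atLeast0)
    then show ?thesis using that by (simp add: QtQ)
  qed
  have 2: "(\<Sum>i<n. q i s * q i t) = (if s = t then 1 else 0)" if "s < n" "t < n" for s t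
  proof -
    have "(\<Sum>i<n. q i s * q i t) = (Q * transpose_mat Q) $$ (s,t)"
      using that Q by (simp add: scalar_prod_def q_def lessThan_atLeast0)
    then show ?thesis using that by (simp add: QQt)
  qed
  have 3: "A $$ (s,t) = (\<Sum>i<n. l i * q i s * q i t)" if "s < n" "t < n" for s t
    using that Q unfolding AQ QD by (simp add: scalar_prod_def q_def lessThan_atLeast0 mult_ac)
  have "similar_mat A (mat_diag n l)"
    by (rule similar_matI[of _ _ Q "transpose_mat Q"]) (use A Q QtQ QQt AQ in auto)
  then have "char_poly A = char_poly (mat_diag n l)" by (rule char_poly_similar)
  also have "\<dots> = (\<Prod>a\<leftarrow>diag_mat (mat_diag n l). [:- a, 1:])"
    by (rule char_poly_upper_triangular[of _ n]) (auto simp: mat_diag_def)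
  also have "\<dots> = (\<Prod>i<n. [:- l i, 1:])"
    by (simp add: diag_mat_def mat_diag_def prod.list_conv_set_nth lessThan_atLeast0)
  finally show ?thesis using that[of q l] 1 2 3 unfolding eigenbasis_def by blast
qed

lemma eigenbasis_exists:
  assumes "symm_on n A"
  obtains q l where "eigenbasis n A q l"
proof -
  let ?A = "mat n n (\<lambda>(s,t). A s t)"
  have "transpose_mat ?A = ?A" using assms by (intro eq_matI) (auto simp: symm_on_def)
  then obtain q l where "eigenbasis n (\<lambda>s t. ?A $$ (s,t)) q l" by (rule eigenbasis_mat[rotated]) auto
  then show ?thesis using that[of q l] unfolding eigenbasis_def by simp
qed

context
  fixes n A q l
  assumes eb: "eigenbasis n A q l"
begin

lemma eigenbasis_orthonormal: "i < n \<Longrightarrow> j < n \<Longrightarrow> inner_on n (q i) (q j) = (if i = j then 1 else 0)"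
  using eb by (simp add: eigenbasis_def)

lemma eigenbasis_complete: "s < n \<Longrightarrow> t < n \<Longrightarrow> (\<Sum>i<n. q i s * q i t) = (if s = t then 1 else 0)"
  using eb by (simp add: eigenbasis_def)

lemma eigenbasis_entry: "s < n \<Longrightarrow> t < n \<Longrightarrow> A s t = (\<Sum>i<n. l i * q i s * q i t)"
  using eb by (simp add: eigenbasis_def)

lemma eigenbasis_symm: "symm_on n A"
  by (simp add: symm_on_def eigenbasis_entry mult_ac)

lemma eigenbasis_bilin: "bilin n A x y = (\<Sum>i<n. l i * inner_on n (q i) x * inner_on n (q i) y)"
proof -
  have "bilin n A x y = (\<Sum>s<n. \<Sum>t<n. \<Sum>i<n. x s * (l i * q i s * q i t) * y t)"
    unfolding bilin_def by (simp add: eigenbasis_entry sum_distrib_left sum_distrib_right)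
  also have "\<dots> = (\<Sum>i<n. \<Sum>s<n. \<Sum>t<n. x s * (l i * q i s * q i t) * y t)"
    by (subst (2) sum.swap, subst sum.swap) simp
  also have "\<dots> = (\<Sum>i<n. l i * inner_on n (q i) x * inner_on n (q i) y)"
    unfolding inner_on_def by (simp add: sum_product sum_distrib_left sum_distrib_right mult_ac)
  finally show ?thesis .
qed

lemma eigenbasis_parseval: "(\<Sum>i<n. inner_on n (q i) x * inner_on n (q i) y) = inner_on n x y"
proof -
  have "(\<Sum>i<n. inner_on n (q i) x * inner_on n (q i) y) = (\<Sum>i<n. \<Sum>s<n. \<Sum>t<n. x s * (q i s * q i t) * y t)"
    unfolding inner_on_def by (simp add: sum_product mult_ac)
  also have "\<dots> = (\<Sum>s<n. \<Sum>t<n. x s * (\<Sum>i<n. q i s * q i t) * y t)"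
    unfolding sum_distrib_left sum_distrib_right
    by (subst sum.swap, rule sum.cong[OF refl], rule sum.swap)
  also have "\<dots> = (\<Sum>s<n. \<Sum>t<n. if s = t then x s * y t else 0)"
    by (intro sum.cong refl) (auto simp: eigenbasis_complete)
  also have "\<dots> = inner_on n x y" by (simp add: inner_on_def sum.delta)
  finally show ?thesis .
qed

lemma eigenbasis_eigenvector: 
  assumes "s < n" "i < n"
  shows "(\<Sum>t<n. A s t * q i t) = l i * q i s"
proof -
  have "(\<Sum>t<n. A s t * q i t) = (\<Sum>t<n. \<Sum>j<n. l j * q j s * (q j t * q i t))"
    using assms by (intro sum.cong refl) (simp add: eigenbasis_entry sum_distrib_right mult.assoc)
  also have "\<dots> = (\<Sum>j<n. l j * q j s * inner_on n (q j) (q i))"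
    by (subst sum.swap) (simp add: inner_on_def sum_distrib_left)
  also have "\<dots> = (\<Sum>j<n. if j = i then l j * q j s else 0)"
    using assms by (intro sum.cong refl) (auto simp: eigenbasis_orthonormal)
  finally show ?thesis using assms by (simp add: sum.delta)
qed

lemma eigenbasis_matpow:
  assumes "s < n" "t < n"
  shows "matpow n A k s t = (\<Sum>i<n. l i ^ k * q i s * q i t)"
  using assms
proof (induction k arbitrary: s t)
  case 0
  then show ?case by (simp add: eigenbasis_complete)
next
  case (Suc k)
  have "matpow n A (Suc k) s t = (\<Sum>r<n. A s r * (\<Sum>i<n. l i ^ k * q i r * q i t))"
    using Suc by simp
  also have "\<dots> = (\<Sum>i<n. \<Sum>r<n. (A s r * q i r) * (l i ^ k * q i t))"
    by (subst sum.swap) (simp add: sum_distrib_left mult_ac)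
  also have "\<dots> = (\<Sum>i<n. l i ^ Suc k * q i s * q i t)"
    using Suc.prems by (intro sum.cong refl)
      (simp only: sum_distrib_right[symmetric] eigenbasis_eigenvector lessThan_iff, simp add: mult_ac)
  finally show ?case .
qed

lemma eigenbasis_pow: "eigenbasis n (matpow n A k) q (\<lambda>i. l i ^ k)"
  using eb eigenbasis_matpow unfolding eigenbasis_def by simp

lemma eigenbasis_trace_pow: "trace_pow n A k = (\<Sum>i<n. l i ^ k)"
proof -
  have "trace_pow n A k = (\<Sum>s<n. \<Sum>i<n. l i ^ k * (q i s * q i s))"
    unfolding trace_pow_def by (simp add: eigenbasis_matpow mult_ac)
  also have "\<dots> = (\<Sum>i<n. l i ^ k * inner_on n (q i) (q i))"
    by (subst sum.swap) (simp add: inner_on_def sum_distrib_left)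
  finally show ?thesis by (simp add: eigenbasis_orthonormal)
qed

lemma eigenbasis_eigenvalue: "i < n \<Longrightarrow> l i = bilin n A (q i) (q i)"
proof -
  assume i: "i < n"
  have "bilin n A (q i) (q i) = (\<Sum>j<n. if j = i then l j else 0)"
    unfolding eigenbasis_bilin by (rule sum.cong[OF refl]) (use i in \<open>simp add: eigenbasis_orthonormal\<close>)
  then show ?thesis using i by (simp add: sum.delta)
qed

end

subsection \<open>Trace power inequalities\<close>

text \<open>The Frobenius inner product, equal to the trace of the product of \<open>A\<close> and
  \<open>B\<close> as soon as one of them is symmetric.\<close>

definition frob :: "nat \<Rightarrow> (nat \<Rightarrow> nat \<Rightarrow> real) \<Rightarrow> (nat \<Rightarrow> nat \<Rightarrow> real) \<Rightarrow> real" where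
  "frob n A B = (\<Sum>s<n. \<Sum>t<n. A s t * B s t)"

definition outer :: "(nat \<Rightarrow> real) \<Rightarrow> nat \<Rightarrow> nat \<Rightarrow> real" where
  "outer v s t = v s * v t"

definition shift :: "real \<Rightarrow> (nat \<Rightarrow> nat \<Rightarrow> real) \<Rightarrow> nat \<Rightarrow> nat \<Rightarrow> real" where
  "shift c A s t = A s t + (if s = t then c else 0)"

definition psd_on :: "nat \<Rightarrow> (nat \<Rightarrow> nat \<Rightarrow> real) \<Rightarrow> bool" where
  "psd_on n A \<longleftrightarrow> symm_on n A \<and> (\<forall>x. 0 \<le> bilin n A x x)"

lemma eigenbasis_shift: "eigenbasis n A q l \<Longrightarrow> eigenbasis n (shift c A) q (\<lambda>i. l i + c)"
  unfolding eigenbasis_def shift_def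
  by (auto simp: distrib_right sum.distrib mult.assoc sum_distrib_left[symmetric])

text \<open>Symmetrization: the double sum of \<open>p i * p j * (f i - f j) * (g i - g j)\<close>
  has nonnegative terms and expands to twice the difference of the two sides.\<close>

lemma chebyshev_sum_weighted:
  fixes p f g :: "nat \<Rightarrow> real"
  assumes p: "\<And>i. i < n \<Longrightarrow> 0 \<le> p i"
    and mono: "\<And>i j. i < n \<Longrightarrow> j < n \<Longrightarrow> 0 \<le> (f i - f j) * (g i - g j)"
  shows "(\<Sum>i<n. p i * f i) * (\<Sum>i<n. p i * g i) \<le> (\<Sum>i<n. p i) * (\<Sum>i<n. p i * (f i * g i))"
proof -
  have expand: "(p i * p j) * ((f i - f j) * (g i - g j))
      = p i * (f i * g i) * p j + p i * (p j * (f j * g j)) - (p i * f i) * (p j * g j) - (p i * g i) * (p j * f j)"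
    for i j by (simp add: algebra_simps)
  have "0 \<le> (\<Sum>i<n. \<Sum>j<n. (p i * p j) * ((f i - f j) * (g i - g j)))"
    using p mono by (intro sum_nonneg mult_nonneg_nonneg[of "_ * _" "_ * _"]) auto
  also have "\<dots> = (\<Sum>i<n. \<Sum>j<n. p i * (f i * g i) * p j) + (\<Sum>i<n. \<Sum>j<n. p i * (p j * (f j * g j)))
     - (\<Sum>i<n. \<Sum>j<n. (p i * f i) * (p j * g j)) - (\<Sum>i<n. \<Sum>j<n. (p i * g i) * (p j * f j))"
    unfolding expand by (simp only: sum_subtractf sum.distrib)
  also have "\<dots> = 2 * ((\<Sum>i<n. p i) * (\<Sum>i<n. p i * (f i * g i)) - (\<Sum>i<n. p i * f i) * (\<Sum>i<n. p i * g i))"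
    unfolding sum_product[symmetric] by (simp add: mult.commute)
  finally show ?thesis by simp
qed

text \<open>The tangent of a convex power lies below it. In the induction the next tangent is
  \<open>x\<close> times the previous one minus a nonnegative multiple of
  \<open>(x - y)^2\<close>.\<close>

lemma power_Suc_tangent_le:
  fixes x y :: real
  assumes "0 \<le> x" "0 \<le> y"
  shows "y ^ Suc k + real (Suc k) * y ^ k * (x - y) \<le> x ^ Suc k"
proof (induction k)
  case (Suc k)
  have "y ^ Suc (Suc k) + real (Suc (Suc k)) * y ^ Suc k * (x - y)
      = x * (y ^ Suc k + real (Suc k) * y ^ k * (x - y)) - real (Suc k) * y ^ k * (x - y)\<^sup>2"
    by (simp add: algebra_simps power2_eq_square)
  also have "\<dots> \<le> x * (y ^ Suc k + real (Suc k) * y ^ k * (x - y))" using assms by simp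
  also have "\<dots> \<le> x * x ^ Suc k" using Suc assms by (intro mult_left_mono)
  finally show ?case by simp
qed simp

text \<open>The origin of the factor \<open>exp 1\<close> in the exchange of rows:
  \<open>1 + 1 / x\<close> is at most \<open>exp (1 / x)\<close>. The condition
  \<open>k \<le> x\<close> is the reason for shifting the matrices by a multiple of the
  identity.\<close>

lemma power_add_one_le_exp:
  fixes x :: real
  assumes x: "real k \<le> x" "0 < x"
  shows "(x + 1) ^ k \<le> exp 1 * x ^ k"
proof -
  have "(x + 1) ^ k = (1 + 1 / x) ^ k * x ^ k"
    using x by (simp add: power_mult_distrib[symmetric] field_simps)
  also have "(1 + 1 / x) ^ k \<le> exp (1 / x) ^ k"
    using x exp_ge_add_one_self[of "1 / x"] by (intro power_mono) (auto simp: add_nonneg_nonneg)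
  also have "exp (1 / x) ^ k = exp (real k / x)" by (simp add: exp_of_nat_mult[symmetric])
  also have "\<dots> \<le> exp 1" using x by simp
  finally show ?thesis using x by (simp add: mult_right_mono)
qed

lemma inner_on_nonneg: "0 \<le> inner_on n x x"
  by (simp add: inner_on_def sum_nonneg)

lemma eigenbasis_nonneg: "eigenbasis n A q l \<Longrightarrow> psd_on n A \<Longrightarrow> i < n \<Longrightarrow> 0 \<le> l i"
  using eigenbasis_eigenvalue[of n A q l i] by (simp add: psd_on_def)

lemma bilin_frob_outer: "bilin n A v v = frob n (outer v) A"
  by (simp add: bilin_def frob_def outer_def mult_ac)

text \<open>Against a power of \<open>W\<close>, only the diagonal of \<open>C\<close> in the
  eigenbasis of \<open>W\<close> contributes.\<close>

lemma eigenbasis_frob_matpow: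
  assumes "eigenbasis n W q l"
  shows "frob n C (matpow n W k) = (\<Sum>i<n. l i ^ k * bilin n C (q i) (q i))"
proof -
  have "frob n C (matpow n W k) = (\<Sum>s<n. \<Sum>t<n. \<Sum>i<n. l i ^ k * (q i s * C s t * q i t))"
    unfolding frob_def by (simp add: eigenbasis_matpow[OF assms] sum_distrib_left mult_ac)
  also have "\<dots> = (\<Sum>i<n. \<Sum>s<n. \<Sum>t<n. l i ^ k * (q i s * C s t * q i t))"
    by (subst (2) sum.swap, subst sum.swap) simp
  finally show ?thesis by (simp add: bilin_def sum_distrib_left)
qed

text \<open>
  All traces and quadratic forms are expanded over pairs of eigenvectors of \<open>W\<close> and
  \<open>Z = W + v v'\<close>. The quantities \<open>c a b = v' W\<^sup>a Z\<^sup>b v\<close> are dominated by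
  \<open>d a b = v' W\<^sup>a (W + I)\<^sup>b v\<close>, because \<open>c\<close> picks up the product
  \<open>(v' W\<^sup>a v) (v' Z\<^sup>b v)\<close> where \<open>d\<close> picks up \<open>v' W\<^sup>a (W + I)\<^sup>b v\<close>, and Chebyshev's sum inequality
  compares the two.
\<close>

lemma trace_pow_rank_one_update:
  assumes W: "eigenbasis n W q l" and l: "\<And>i. i < n \<Longrightarrow> real (Suc k) \<le> l i"
    and v: "inner_on n v v \<le> 1"
  shows "trace_pow n (\<lambda>s t. W s t + outer v s t) (Suc k)
    \<le> trace_pow n W (Suc k) + real (Suc k) * exp 1 * frob n (outer v) (matpow n W k)"
proof -
  define Z where "Z = (\<lambda>s t. W s t + outer v s t)"
  have "symm_on n Z" using eigenbasis_symm[OF W] by (simp add: symm_on_def Z_def outer_def)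
  then obtain q' l' where Z: "eigenbasis n Z q' l'" by (rule eigenbasis_exists)
  define P where "P i j = inner_on n (q i) (q' j)" for i j
  define w where "w i = inner_on n (q i) v" for i
  define w' where "w' j = inner_on n (q' j) v" for j
  have P1: "(\<Sum>i<n. P i j * P i j) = 1" if "j < n" for j
    using eigenbasis_parseval[OF W, of "q' j" "q' j"] eigenbasis_orthonormal[OF Z that that] unfolding P_def by simp
  have P_sym: "P i j = inner_on n (q' j) (q i)" for i j by (simp only: P_def inner_on_commute[of n "q i"])
  have P2: "(\<Sum>j<n. P i j * P i j) = 1" if "i < n" for i
    using eigenbasis_parseval[OF Z, of "q i" "q i"] eigenbasis_orthonormal[OF W that that]
    unfolding P_sym by simp
  have wP: "(\<Sum>i<n. w i * P i j) = w' j" for j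
    using eigenbasis_parseval[OF W, of v "q' j"] inner_on_commute[of n v "q' j"] unfolding P_def w_def w'_def by simp
  have ww: "(\<Sum>i<n. w i * w i) = inner_on n v v"
    using eigenbasis_parseval[OF W, of v v] unfolding w_def by simp
  \<comment> \<open>The form of \<open>Z\<close> at \<open>q i\<close> and \<open>q' j\<close> is
    evaluated once through the eigenvalue of \<open>Z\<close> and once as \<open>W + v v'\<close>.
    Under the double sums below this trades one factor \<open>l' j\<close> for \<open>l i\<close>
    plus a rank-one term.\<close>
  have rel: "l' j * P i j = l i * P i j + w i * w' j" if "i < n" "j < n" for i j
  proof -
    have "q i s * Z s t * q' j t = q i s * W s t * q' j t + (q i s * v s) * (q' j t * v t)" for s t
      by (simp add: Z_def outer_def algebra_simps)
    then have "bilin n Z (q i) (q' j) = bilin n W (q i) (q' j) + w i * w' j"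
      by (simp only: bilin_def w_def w'_def inner_on_def sum.distrib sum_product)
    moreover have "bilin n Z (q i) (q' j) = l' j * P i j"
    proof -
      have "bilin n Z (q i) (q' j) = (\<Sum>s<n. q i s * (\<Sum>t<n. Z s t * q' j t))"
        by (simp add: bilin_def sum_distrib_left mult.assoc)
      also have "\<dots> = (\<Sum>s<n. q i s * (l' j * q' j s))"
        using eigenbasis_eigenvector[OF Z _ that(2)] by simp
      finally show ?thesis by (simp add: P_def inner_on_def sum_distrib_left mult_ac)
    qed
    moreover have "bilin n W (q i) (q' j) = l i * P i j"
    proof -
      have "bilin n W (q i) (q' j) = (\<Sum>t<n. \<Sum>s<n. W t s * q i s * q' j t)"
        unfolding bilin_def using eigenbasis_symm[OF W]
        by (subst sum.swap) (auto simp: symm_on_def mult_ac intro!: sum.cong)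
      also have "\<dots> = (\<Sum>t<n. (l i * q i t) * q' j t)"
        using eigenbasis_eigenvector[OF W _ that(1)] by (simp add: sum_distrib_right[symmetric])
      finally show ?thesis by (simp add: P_def inner_on_def sum_distrib_left mult_ac)
    qed
    ultimately show ?thesis by simp
  qed
  have lpos: "0 < l i" if "i < n" for i using l[OF that] by (simp add: order_less_le_trans[OF of_nat_0_less_iff[THEN iffD2]])
  \<comment> \<open>In matrix terms \<open>m a = v' W^a v\<close> and
    \<open>T a b = tr (W^a Z^b)\<close>, with powers of \<open>W\<close> expanded over
    \<open>q\<close> and powers of \<open>Z\<close> over \<open>q'\<close>.\<close>
  define m where "m a = (\<Sum>i<n. (w i)\<^sup>2 * l i ^ a)" for a
  define T where "T a b = (\<Sum>i<n. \<Sum>j<n. l i ^ a * l' j ^ b * (P i j)\<^sup>2)" for a b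
  define c where "c a b = (\<Sum>i<n. \<Sum>j<n. l i ^ a * l' j ^ b * (w i * w' j * P i j))" for a b
  define d where "d a b = (\<Sum>i<n. (w i)\<^sup>2 * (l i ^ a * (l i + 1) ^ b))" for a b
  have T_Suc: "T a (Suc b) = T (Suc a) b + c a b" for a b
  proof -
    have "T a (Suc b) = (\<Sum>i<n. \<Sum>j<n. l i ^ a * l' j ^ b * P i j * (l' j * P i j))"
      by (simp add: T_def power2_eq_square mult_ac)
    also have "\<dots> = (\<Sum>i<n. \<Sum>j<n. l i ^ a * l' j ^ b * P i j * (l i * P i j + w i * w' j))"
      by (simp add: rel)
    also have "\<dots> = T (Suc a) b + c a b"
      by (simp add: T_def c_def power2_eq_square sum.distrib distrib_left mult_ac)
    finally show ?thesis .
  qed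
  have c0: "c 0 b = (\<Sum>j<n. l' j ^ b * (w' j)\<^sup>2)" for b
  proof -
    have "c 0 b = (\<Sum>j<n. \<Sum>i<n. l' j ^ b * w' j * (w i * P i j))"
      unfolding c_def by (subst sum.swap) (simp add: mult_ac)
    also have "\<dots> = (\<Sum>j<n. l' j ^ b * w' j * w' j)" by (simp only: sum_distrib_left[symmetric] wP)
    finally show ?thesis by (simp add: power2_eq_square mult.assoc)
  qed
  have c_Suc: "c a (Suc b) = c (Suc a) b + m a * c 0 b" for a b
  proof -
    have "c a (Suc b) = (\<Sum>i<n. \<Sum>j<n. l i ^ a * l' j ^ b * w i * w' j * (l' j * P i j))"
      by (simp add: c_def mult_ac)
    also have "\<dots> = (\<Sum>i<n. \<Sum>j<n. l i ^ a * l' j ^ b * w i * w' j * (l i * P i j + w i * w' j))"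
      by (simp add: rel)
    also have "\<dots> = c (Suc a) b + (\<Sum>i<n. \<Sum>j<n. ((w i)\<^sup>2 * l i ^ a) * (l' j ^ b * (w' j)\<^sup>2))"
      by (simp add: c_def power2_eq_square sum.distrib distrib_left mult_ac)
    finally show ?thesis by (simp add: m_def c0 sum_product)
  qed
  have d_Suc: "d a (Suc b) = d (Suc a) b + d a b" for a b
  proof -
    have "(w i)\<^sup>2 * (l i ^ a * (l i + 1) ^ Suc b)
        = (w i)\<^sup>2 * (l i ^ Suc a * (l i + 1) ^ b) + (w i)\<^sup>2 * (l i ^ a * (l i + 1) ^ b)" for i
      by (simp add: algebra_simps)
    then show ?thesis by (simp only: d_def sum.distrib)
  qed
  have d0: "0 \<le> d a b" for a b
    unfolding d_def using lpos by (auto intro!: sum_nonneg mult_nonneg_nonneg simp: less_imp_le)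
  have m0: "0 \<le> m a" for a
    unfolding m_def using lpos by (auto intro!: sum_nonneg mult_nonneg_nonneg simp: less_imp_le)
  have cheb: "m a * d 0 b \<le> d a b" for a b
  proof -
    have "m a * d 0 b \<le> (\<Sum>i<n. (w i)\<^sup>2) * d a b"
      unfolding m_def d_def power_0 mult_1_left
    proof (rule chebyshev_sum_weighted)
      fix i j assume ij: "i < n" "j < n"
      have "0 \<le> (x ^ a - y ^ a) * ((x + 1) ^ b - (y + 1) ^ b)" if "0 \<le> y" "y \<le> x" for x y :: real
        using that by (intro mult_nonneg_nonneg) (auto intro!: power_mono)
      from this[of "l i" "l j"] this[of "l j" "l i"] lpos[OF ij(1)] lpos[OF ij(2)]
      show "0 \<le> (l i ^ a - l j ^ a) * ((l i + 1) ^ b - (l j + 1) ^ b)"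
        by (cases "l j \<le> l i") (auto simp: algebra_simps)
    qed simp
    \<comment> \<open>The weights \<open>(w i)^2\<close> add up to the squared length of
      \<open>v\<close>; this is where that length enters.\<close>
    also have "\<dots> \<le> 1 * d a b"
      using v d0 by (intro mult_right_mono) (simp_all add: ww[symmetric] power2_eq_square)
    finally show ?thesis by simp
  qed
  have c_le_d: "c a b \<le> d a b" for a b
  proof (induction b arbitrary: a)
    case 0
    have "c a 0 = (\<Sum>i<n. l i ^ a * w i * (\<Sum>j<n. w' j * P i j))"
      by (simp add: c_def sum_distrib_left mult_ac)
    moreover have "(\<Sum>j<n. w' j * P i j) = w i" for i
      using eigenbasis_parseval[OF Z, of v "q i"] inner_on_commute[of n v "q i"] unfolding P_sym w_def w'_def by simp
    ultimately show ?case by (simp add: d_def power2_eq_square mult_ac)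
  next
    case (Suc b)
    have "c a (Suc b) \<le> d (Suc a) b + m a * d 0 b"
      unfolding c_Suc using Suc m0 by (intro add_mono mult_left_mono)
    also have "\<dots> \<le> d a (Suc b)" unfolding d_Suc using cheb by simp
    finally show ?case .
  qed
  \<comment> \<open>The factors \<open>Z\<close> in \<open>tr (W^a Z^b)\<close> are turned into
    \<open>W\<close> one after another; each replacement leaves one term \<open>c\<close>.\<close>
  have telescope: "T a b = T (a + b) 0 + (\<Sum>r<b. c (a + r) (b - Suc r))" for a b
  proof (induction b arbitrary: a)
    case (Suc b)
    show ?case
      unfolding T_Suc Suc[of "Suc a"] sum.lessThan_Suc_shift by simp
  qed simp
  \<comment> \<open>Exponents \<open>r\<close> and \<open>k - r\<close> add up to \<open>k\<close>,
    and the eigenvalues of \<open>W\<close> are at least \<open>k - r\<close>. So each of the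
    \<open>Suc k\<close> terms is at most \<open>exp 1 * m k\<close>, whatever \<open>r\<close>
    is.\<close>
  have d_top: "d r (k - r) \<le> exp 1 * m k" if "r \<le> k" for r
  proof -
    have "l i ^ r * (l i + 1) ^ (k - r) \<le> exp 1 * l i ^ k" if i: "i < n" for i
    proof -
      have "real (k - r) \<le> l i" using l[OF i] by linarith
      from power_add_one_le_exp[OF this lpos[OF i]] lpos[OF i]
      have "l i ^ r * (l i + 1) ^ (k - r) \<le> l i ^ r * (exp 1 * l i ^ (k - r))"
        by (intro mult_left_mono) auto
      also have "\<dots> = exp 1 * l i ^ k" using \<open>r \<le> k\<close> by (simp add: power_add[symmetric] mult_ac)
      finally show ?thesis .
    qed
    then have "d r (k - r) \<le> (\<Sum>i<n. (w i)\<^sup>2 * (exp 1 * l i ^ k))"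
      unfolding d_def by (intro sum_mono mult_left_mono) auto
    then show ?thesis by (simp add: m_def sum_distrib_left mult_ac)
  qed
  have "trace_pow n Z (Suc k) = T 0 (Suc k)"
  proof -
    have "T 0 (Suc k) = (\<Sum>j<n. l' j ^ Suc k * (\<Sum>i<n. P i j * P i j))"
      unfolding T_def by (subst sum.swap) (simp add: sum_distrib_left power2_eq_square mult_ac)
    then show ?thesis by (simp add: P1 eigenbasis_trace_pow[OF Z])
  qed
  also have "\<dots> = T (Suc k) 0 + (\<Sum>r<Suc k. c r (k - r))" using telescope[of 0 "Suc k"] by simp
  also have "T (Suc k) 0 = trace_pow n W (Suc k)"
    using P2 by (simp add: T_def eigenbasis_trace_pow[OF W] sum_distrib_left[symmetric] power2_eq_square)
  also have "(\<Sum>r<Suc k. c r (k - r)) \<le> (\<Sum>r<Suc k. exp 1 * m k)"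
    using c_le_d d_top by (intro sum_mono order_trans[OF c_le_d]) simp
  also have "m k = frob n (outer v) (matpow n W k)"
    unfolding bilin_frob_outer[symmetric] eigenbasis_bilin[OF eigenbasis_pow[OF W]] m_def
    by (simp add: w_def power2_eq_square mult_ac)
  finally show ?thesis by (simp add: Z_def)
qed

text \<open>Klein's inequality for a power function. The squared overlaps \<open>(P i j)^2\<close>
  of the two eigenbases form a doubly stochastic matrix, so every trace is an average over pairs of
  eigenvalues and the scalar tangent inequality applies to each pair.\<close>

lemma trace_pow_tangent:
  assumes W: "eigenbasis n W q l" and l: "\<And>i. i < n \<Longrightarrow> 0 \<le> l i"
    and C: "eigenbasis n C q' c" and c: "\<And>i. i < n \<Longrightarrow> 0 \<le> c i"
  shows "trace_pow n W (Suc k) + real (Suc k) * (frob n C (matpow n W k) - frob n W (matpow n W k))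
    \<le> trace_pow n C (Suc k)"
proof -
  define P where "P i j = inner_on n (q i) (q' j)" for i j
  have P1: "(\<Sum>i<n. (P i j)\<^sup>2) = 1" if "j < n" for j
    using eigenbasis_parseval[OF W, of "q' j" "q' j"] eigenbasis_orthonormal[OF C that that]
    unfolding P_def power2_eq_square by simp
  have P_sym: "P i j = inner_on n (q' j) (q i)" for i j by (simp only: P_def inner_on_commute[of n "q i"])
  have P2: "(\<Sum>j<n. (P i j)\<^sup>2) = 1" if "i < n" for i
    using eigenbasis_parseval[OF C, of "q i" "q i"] eigenbasis_orthonormal[OF W that that]
    unfolding P_sym power2_eq_square by simp
  have tW: "trace_pow n W (Suc k) = (\<Sum>i<n. \<Sum>j<n. (P i j)\<^sup>2 * l i ^ Suc k)"
    by (simp add: eigenbasis_trace_pow[OF W] sum_distrib_right[symmetric] P2)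
  have tC: "trace_pow n C (Suc k) = (\<Sum>i<n. \<Sum>j<n. (P i j)\<^sup>2 * c j ^ Suc k)"
    by (subst sum.swap) (simp add: eigenbasis_trace_pow[OF C] sum_distrib_right[symmetric] P1)
  have fC: "frob n C (matpow n W k) = (\<Sum>i<n. \<Sum>j<n. (P i j)\<^sup>2 * (l i ^ k * c j))"
    unfolding eigenbasis_frob_matpow[OF W] eigenbasis_bilin[OF C]
    by (simp add: sum_distrib_left P_sym power2_eq_square mult_ac)
  have fW: "frob n W (matpow n W k) = (\<Sum>i<n. \<Sum>j<n. (P i j)\<^sup>2 * (l i ^ k * l i))"
    unfolding eigenbasis_frob_matpow[OF W] using eigenbasis_eigenvalue[OF W]
    by (simp add: sum_distrib_right[symmetric] P2)
  have "trace_pow n W (Suc k) + real (Suc k) * (frob n C (matpow n W k) - frob n W (matpow n W k))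
    = (\<Sum>i<n. \<Sum>j<n. (P i j)\<^sup>2 * (l i ^ Suc k + real (Suc k) * l i ^ k * (c j - l i)))"
  proof -
    have "(P i j)\<^sup>2 * (l i ^ Suc k + real (Suc k) * l i ^ k * (c j - l i)) = (P i j)\<^sup>2 * l i ^ Suc k
        + real (Suc k) * ((P i j)\<^sup>2 * (l i ^ k * c j)) - real (Suc k) * ((P i j)\<^sup>2 * (l i ^ k * l i))" for i j
      by (simp add: algebra_simps)
    then show ?thesis
      unfolding tW fC fW right_diff_distrib sum_distrib_left
      by (simp only: sum_subtractf sum.distrib add_diff_eq)
  qed
  also have "\<dots> \<le> trace_pow n C (Suc k)"
    unfolding tC using l c by (intro sum_mono mult_left_mono power_Suc_tangent_le) auto
  finally show ?thesis .
qed

text \<open>The tangent at the larger point \<open>g i + c\<close> bounds the excess of each power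
  over \<open>c ^ Suc k\<close> by a multiple of \<open>g i\<close>. Hence the dimension occurs only
  in the baseline \<open>n * c ^ Suc k\<close>, and everything above it is controlled by the trace
  of \<open>G\<close>.\<close>

lemma trace_pow_shift_le:
  assumes G: "eigenbasis n G q g" and g: "\<And>i. i < n \<Longrightarrow> 0 \<le> g i" "\<And>i. i < n \<Longrightarrow> g i \<le> \<gamma>" and c: "0 \<le> c"
  shows "trace_pow n (shift c G) (Suc k) \<le> real n * c ^ Suc k + real (Suc k) * (\<Sum>s<n. G s s) * (\<gamma> + c) ^ k"
proof -
  have tr: "(\<Sum>s<n. G s s) = (\<Sum>i<n. g i)"
    using eigenbasis_trace_pow[OF G, of 1] by (simp add: trace_pow_def mult_delta_right sum.delta)
  have "trace_pow n (shift c G) (Suc k) = (\<Sum>i<n. (g i + c) ^ Suc k)"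
    using eigenbasis_trace_pow[OF eigenbasis_shift[OF G]] .
  also have "\<dots> \<le> (\<Sum>i<n. c ^ Suc k + real (Suc k) * g i * (\<gamma> + c) ^ k)"
  proof (rule sum_mono)
    fix i assume "i \<in> {..<n}"
    then have i: "i < n" by simp
    have "(g i + c) ^ Suc k \<le> c ^ Suc k + real (Suc k) * (g i + c) ^ k * g i"
      using power_Suc_tangent_le[of c "g i + c" k] c g(1)[OF i] by simp
    also have "real (Suc k) * (g i + c) ^ k * g i \<le> real (Suc k) * (\<gamma> + c) ^ k * g i"
      using c g(1)[OF i] g(2)[OF i] by (intro mult_right_mono mult_left_mono power_mono) auto
    finally show "(g i + c) ^ Suc k \<le> c ^ Suc k + real (Suc k) * g i * (\<gamma> + c) ^ k" by (simp add: mult_ac)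
  qed
  also have "\<dots> = real n * c ^ Suc k + real (Suc k) * (\<Sum>s<n. G s s) * (\<gamma> + c) ^ k"
    by (simp add: sum.distrib tr sum_distrib_left[symmetric] sum_distrib_right[symmetric])
  finally show ?thesis .
qed

text \<open>Superadditivity of powers on nonnegative numbers gives the same baseline
  \<open>n * c ^ Suc k\<close> as in the upper bound, so that it cancels when the two are
  compared.\<close>

lemma trace_pow_shift_ge:
  assumes X: "eigenbasis n X q x" and x: "\<And>i. i < n \<Longrightarrow> 0 \<le> x i" and c: "0 \<le> c" and i: "i < n"
  shows "real n * c ^ Suc k + x i ^ Suc k \<le> trace_pow n (shift c X) (Suc k)"
proof -
  have pow: "a ^ Suc k + b ^ Suc k \<le> (a + b) ^ Suc k" if "0 \<le> a" "0 \<le> b" for a b :: real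
  proof -
    have "a * a ^ k \<le> a * (a + b) ^ k" "b * b ^ k \<le> b * (a + b) ^ k"
      using that by (auto intro!: mult_left_mono power_mono)
    then show ?thesis by (simp add: algebra_simps)
  qed
  have "real n * c ^ Suc k + x i ^ Suc k \<le> real n * c ^ Suc k + (\<Sum>j<n. x j ^ Suc k)"
    using i x by (intro add_left_mono member_le_sum) auto
  also have "\<dots> = (\<Sum>j<n. x j ^ Suc k + c ^ Suc k)" by (simp add: sum.distrib)
  also have "\<dots> \<le> (\<Sum>j<n. (x j + c) ^ Suc k)" using pow x c by (intro sum_mono) auto
  also have "\<dots> = trace_pow n (shift c X) (Suc k)"
    using eigenbasis_trace_pow[OF eigenbasis_shift[OF X]] by simp
  finally show ?thesis .
qed

lemma eigenbasis_bilin_le: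
  assumes X: "eigenbasis n X q x" and x: "\<And>i. i < n \<Longrightarrow> x i \<le> b"
  shows "bilin n X y y \<le> b * inner_on n y y"
proof -
  have "bilin n X y y \<le> (\<Sum>i<n. b * (inner_on n (q i) y * inner_on n (q i) y))"
    unfolding eigenbasis_bilin[OF X] mult.assoc using x by (intro sum_mono mult_right_mono) auto
  then show ?thesis by (simp add: sum_distrib_left[symmetric] eigenbasis_parseval[OF X])
qed

subsection \<open>Conditioning on the past under conditional independence\<close>

text \<open>Rectangles that form an intersection-stable generator of the sigma-algebra spanned by
  \<open>F\<close> and \<open>X 0, ..., X (j - 1)\<close>. On them the product formula for
  conditional probabilities can be applied directly.\<close>

definition past_generator ::
  "'a measure \<Rightarrow> 'a measure \<Rightarrow> (nat \<Rightarrow> 'b measure) \<Rightarrow> (nat \<Rightarrow> 'a \<Rightarrow> 'b) \<Rightarrow> nat \<Rightarrow> 'a set set" where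
  "past_generator P F E X j =
     {A \<inter> {\<omega> \<in> space P. \<forall>i<j. X i \<omega> \<in> C i} | A C. A \<in> sets F \<and> (\<forall>i<j. C i \<in> sets (E i))}"

lemma past_generatorI:
  "A \<in> sets F \<Longrightarrow> (\<And>i. i < j \<Longrightarrow> C i \<in> sets (E i)) \<Longrightarrow>
    A \<inter> {\<omega> \<in> space P. \<forall>i<j. X i \<omega> \<in> C i} \<in> past_generator P F E X j"
  unfolding past_generator_def by blast

definition past :: 
  "'a measure \<Rightarrow> 'a measure \<Rightarrow> (nat \<Rightarrow> 'b measure) \<Rightarrow> (nat \<Rightarrow> 'a \<Rightarrow> 'b) \<Rightarrow> nat \<Rightarrow> 'a measure" where
  "past P F E X j = sigma (space P) (past_generator P F E X j)"

lemma space_past: "space (past P F E X j) = space P"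
  by (simp add: past_def space_measure_of_conv)

lemma Int_stable_past_generator: "Int_stable (past_generator P F E X j)"
proof (rule Int_stableI)
  fix a b assume "a \<in> past_generator P F E X j" "b \<in> past_generator P F E X j"
  then obtain A C B D where a: "a = A \<inter> {\<omega> \<in> space P. \<forall>i<j. X i \<omega> \<in> C i}" "A \<in> sets F" "\<forall>i<j. C i \<in> sets (E i)"
    and b: "b = B \<inter> {\<omega> \<in> space P. \<forall>i<j. X i \<omega> \<in> D i}" "B \<in> sets F" "\<forall>i<j. D i \<in> sets (E i)"
    unfolding past_generator_def by auto
  have "a \<inter> b = (A \<inter> B) \<inter> {\<omega> \<in> space P. \<forall>i<j. X i \<omega> \<in> C i \<inter> D i}" using a b by auto
  moreover have "A \<inter> B \<in> sets F" "\<forall>i<j. C i \<inter> D i \<in> sets (E i)" using a b by auto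
  ultimately show "a \<inter> b \<in> past_generator P F E X j"
    unfolding past_generator_def by (intro CollectI exI[of _ "A \<inter> B"] exI[of _ "\<lambda>i. C i \<inter> D i"]) simp
qed

context finite_measure_subalgebra
begin

lemma integrable_indicator_finite: "A \<in> sets M \<Longrightarrow> integrable M (indicator A :: 'a \<Rightarrow> real)"
  by (intro integrable_real_indicator) (auto simp: less_top[symmetric])

lemma integrable_bounded_mult:
  fixes f g :: "'a \<Rightarrow> real"
  assumes "integrable M f" "g \<in> borel_measurable M" "\<And>\<omega>. \<omega> \<in> space M \<Longrightarrow> \<bar>g \<omega>\<bar> \<le> b"
  shows "integrable M (\<lambda>\<omega>. g \<omega> * f \<omega>)"
proof (rule Bochner_Integration.integrable_bound[where f = "\<lambda>\<omega>. b * f \<omega>"])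
  show "AE \<omega> in M. norm (g \<omega> * f \<omega>) \<le> norm (b * f \<omega>)"
  proof (rule AE_I2)
    fix \<omega> assume "\<omega> \<in> space M"
    from assms(3)[OF this] show "norm (g \<omega> * f \<omega>) \<le> norm (b * f \<omega>)"
      by (auto simp: abs_mult intro!: mult_right_mono)
  qed
qed (use assms in auto)

lemma space_F: "space F = space M" and sets_F: "sets F \<subseteq> sets M"
  using subalg by (auto simp: subalgebra_def)

section \<open>Conditional expectation given the past\<close>

context
  fixes E :: "nat \<Rightarrow> 'b measure" and X N
  assumes ci: "cond_indep_vars M F E X {..<N}"
begin

lemma cond_indep_measurable: "i < N \<Longrightarrow> X i \<in> M \<rightarrow>\<^sub>M E i"
  using ci by (simp add: cond_indep_vars_def)

lemma cond_indep_prod: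
  assumes "I \<subseteq> {..<N}" "finite I" "\<And>i. i \<in> I \<Longrightarrow> A i \<in> sets (E i)"
  shows "AE \<omega> in M. real_cond_exp M F (indicator {\<omega> \<in> space M. \<forall>i\<in>I. X i \<omega> \<in> A i}) \<omega>
    = (\<Prod>i\<in>I. real_cond_exp M F (indicator {\<omega> \<in> space M. X i \<omega> \<in> A i}) \<omega>)"
  using ci assms unfolding cond_indep_vars_def by blast

lemma cond_indep_space: "i < N \<Longrightarrow> \<omega> \<in> space M \<Longrightarrow> X i \<omega> \<in> space (E i)"
  using measurable_space[OF cond_indep_measurable] .

lemma past_event_measurable:
  assumes "j \<le> N" "\<And>i. i < j \<Longrightarrow> C i \<in> sets (E i)"
  shows "{\<omega> \<in> space M. \<forall>i<j. X i \<omega> \<in> C i} \<in> sets M"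
proof -
  have *: "{\<omega> \<in> space M. X i \<omega> \<in> C i} \<in> sets M" if "i < j" for i
  proof -
    have "{\<omega> \<in> space M. X i \<omega> \<in> C i} = X i -` C i \<inter> space M" by auto
    moreover have "X i -` C i \<inter> space M \<in> sets M"
      by (rule measurable_sets[OF cond_indep_measurable assms(2)]) (use that assms(1) in auto)
    ultimately show ?thesis by (simp only:)
  qed
  have "{\<omega> \<in> space M. \<forall>i\<in>{..<j}. X i \<omega> \<in> C i} \<in> sets M"
  proof (rule sets.sets_Collect_finite_All)
    show "{\<omega> \<in> space M. X i \<omega> \<in> C i} \<in> sets M" if "i \<in> {..<j}" for i
      by (rule *) (use that in simp)
  qed (rule finite_lessThan)
  then show ?thesis by (simp only: Ball_def lessThan_iff)
qed

lemma past_generator_sets: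
  assumes "j \<le> N" shows "past_generator M F E X j \<subseteq> sets M"
proof
  fix B assume "B \<in> past_generator M F E X j"
  then obtain A C where "B = A \<inter> {\<omega> \<in> space M. \<forall>i<j. X i \<omega> \<in> C i}" "A \<in> sets F" "\<forall>i<j. C i \<in> sets (E i)"
    unfolding past_generator_def by blast
  moreover from this have "{\<omega> \<in> space M. \<forall>i<j. X i \<omega> \<in> C i} \<in> sets M"
    by (intro past_event_measurable[OF assms]) blast
  ultimately show "B \<in> sets M" using sets_F by (blast intro: sets.Int)
qed

lemma sets_past:
  assumes "j \<le> N"
  shows "sets (past M F E X j) = sigma_sets (space M) (past_generator M F E X j)"
  using past_generator_sets[OF assms] sets.space_closed unfolding past_def
  by (intro sets_measure_of) blast

lemma subalgebra_past:
  assumes "j \<le> N" shows "subalgebra M (past M F E X j)"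
  using sets.sigma_sets_subset[OF past_generator_sets[OF assms]] sets_past[OF assms]
  by (simp add: subalgebra_def space_past)

lemma F_subset_past:
  assumes "j \<le> N" shows "subalgebra (past M F E X j) F"
proof -
  have "A \<in> past_generator M F E X j" if A: "A \<in> sets F" for A
  proof -
    have "A = A \<inter> {\<omega> \<in> space M. \<forall>i<j. X i \<omega> \<in> space (E i)}"
    proof -
      have "\<forall>i<j. X i \<omega> \<in> space (E i)" if "\<omega> \<in> space M" for \<omega>
        using cond_indep_space[OF _ that] assms by (meson order_less_le_trans)
      then show ?thesis using sets.sets_into_space[OF A] space_F by blast
    qed
    then show ?thesis using past_generatorI[OF A, of j "\<lambda>i. space (E i)" E M X] sets.top by metis
  qed
  then have "sets F \<subseteq> sets (past M F E X j)" unfolding sets_past[OF assms] by blast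
  then show ?thesis using space_F by (simp add: subalgebra_def space_past)
qed

lemma measurable_past:
  assumes "i < j" "j \<le> N" shows "X i \<in> past M F E X j \<rightarrow>\<^sub>M E i"
proof (rule measurableI)
  show "X i \<omega> \<in> space (E i)" if "\<omega> \<in> space (past M F E X j)" for \<omega>
    using that cond_indep_space[of i \<omega>] assms by (simp add: space_past)
  fix A assume A: "A \<in> sets (E i)"
  define C where "C k = (if k = i then A else space (E k))" for k
  have "X i -` A \<inter> space (past M F E X j) = space M \<inter> {\<omega> \<in> space M. \<forall>k<j. X k \<omega> \<in> C k}"
  proof (rule Set.set_eqI)
    fix \<omega>
    have "(\<forall>k<j. X k \<omega> \<in> C k) \<longleftrightarrow> X i \<omega> \<in> A" if \<omega>: "\<omega> \<in> space M"
    proof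
      assume "\<forall>k<j. X k \<omega> \<in> C k"
      then have "X i \<omega> \<in> C i" using assms(1) by blast
      then show "X i \<omega> \<in> A" by (simp add: C_def)
    next
      assume Xi: "X i \<omega> \<in> A"
      show "\<forall>k<j. X k \<omega> \<in> C k"
      proof (intro allI impI)
        fix k assume "k < j"
        then have "X k \<omega> \<in> space (E k)" using cond_indep_space[of k \<omega>] \<omega> assms(2) by linarith
        then show "X k \<omega> \<in> C k" using Xi by (simp add: C_def)
      qed
    qed
    then show "\<omega> \<in> X i -` A \<inter> space (past M F E X j) \<longleftrightarrow>
        \<omega> \<in> space M \<inter> {\<omega> \<in> space M. \<forall>k<j. X k \<omega> \<in> C k}"
      unfolding space_past by blast
  qed
  moreover have "space M \<in> sets F" using sets.top[of F] unfolding space_F .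
  moreover have "\<forall>k<j. C k \<in> sets (E k)" using A by (simp add: C_def)
  ultimately have "X i -` A \<inter> space (past M F E X j) \<in> past_generator M F E X j"
    unfolding past_generator_def by blast
  then show "X i -` A \<inter> space (past M F E X j) \<in> sets (past M F E X j)"
    unfolding sets_past[OF assms(2)] by (rule sigma_sets.Basic)
qed

text \<open>The product formulas for the indices up to \<open>j\<close> and below \<open>j\<close>
  differ by one factor, so the conditional probability of \<open>R\<close> is that of
  \<open>Q\<close> times \<open>real_cond_exp M F h\<close>. This factor is measurable with respect
  to \<open>F\<close>, which permits returning from the conditional probability of \<open>Q\<close>
  to \<open>Q\<close> itself.\<close>

lemma integral_past_generator:
  assumes j: "j < N" and B: "B \<in> past_generator M F E X j" and C: "C \<in> sets (E j)"
  defines "h \<equiv> indicator {\<omega> \<in> space M. X j \<omega> \<in> C} :: 'a \<Rightarrow> real"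
  shows "(\<integral>\<omega>. indicator B \<omega> * h \<omega> \<partial>M) = (\<integral>\<omega>. indicator B \<omega> * real_cond_exp M F h \<omega> \<partial>M)"
proof -
  obtain A D where B: "B = A \<inter> {\<omega> \<in> space M. \<forall>i<j. X i \<omega> \<in> D i}" and A[measurable]: "A \<in> sets F"
    and D: "\<forall>i<j. D i \<in> sets (E i)"
    using B unfolding past_generator_def by auto
  have AM[measurable]: "A \<in> sets M" using A sets_F by auto
  define D' where "D' = D(j := C)"
  have D': "\<forall>i\<in>{..j}. D' i \<in> sets (E i)" "\<forall>i\<in>{..<j}. D' i \<in> sets (E i)"
    using D C by (auto simp: D'_def)
  define Q where "Q = {\<omega> \<in> space M. \<forall>i\<in>{..<j}. X i \<omega> \<in> D' i}"
  define R where "R = {\<omega> \<in> space M. \<forall>i\<in>{..j}. X i \<omega> \<in> D' i}"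
  have Q': "Q = {\<omega> \<in> space M. \<forall>i<j. X i \<omega> \<in> D i}" unfolding Q_def by (auto simp: D'_def)
  have Qm[measurable]: "Q \<in> sets M" unfolding Q' by (rule past_event_measurable) (use D j in auto)
  have R': "R = {\<omega> \<in> space M. \<forall>i<Suc j. X i \<omega> \<in> D' i}"
    unfolding R_def by (simp add: less_Suc_eq_le Ball_def)
  have Rm[measurable]: "R \<in> sets M"
    unfolding R' by (rule past_event_measurable) (use D' j in auto)
  have "{\<omega> \<in> space M. X j \<omega> \<in> C} = X j -` C \<inter> space M" by auto
  then have Hm: "{\<omega> \<in> space M. X j \<omega> \<in> C} \<in> sets M"
    using measurable_sets[OF cond_indep_measurable[OF j] C] by (simp only:)
  have hm[measurable]: "h \<in> borel_measurable M" and hi: "integrable M h"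
    unfolding h_def by (rule borel_measurable_indicator[OF Hm], rule integrable_indicator_finite[OF Hm])
  have prodQ: "AE \<omega> in M. real_cond_exp M F (indicator Q) \<omega>
      = (\<Prod>i\<in>{..<j}. real_cond_exp M F (indicator {\<omega> \<in> space M. X i \<omega> \<in> D' i}) \<omega>)"
    unfolding Q_def by (rule cond_indep_prod) (use D'(2) j in auto)
  have prodR: "AE \<omega> in M. real_cond_exp M F (indicator R) \<omega>
      = (\<Prod>i\<in>{..j}. real_cond_exp M F (indicator {\<omega> \<in> space M. X i \<omega> \<in> D' i}) \<omega>)"
    unfolding R_def by (rule cond_indep_prod) (use D'(1) j in auto)
  have split: "AE \<omega> in M. real_cond_exp M F (indicator R) \<omega> = real_cond_exp M F h \<omega> * real_cond_exp M F (indicator Q) \<omega>"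
    using prodQ prodR
  proof eventually_elim
    case (elim \<omega>)
    have "{..j} = insert j {..<j}" by auto
    then show ?case using elim by (simp add: D'_def h_def)
  qed
  have "(\<integral>\<omega>. indicator B \<omega> * h \<omega> \<partial>M) = (\<integral>\<omega>. indicator A \<omega> * indicator R \<omega> \<partial>M)"
  proof (rule Bochner_Integration.integral_cong)
    fix \<omega> assume "\<omega> \<in> space M"
    have "R = Q \<inter> {\<omega> \<in> space M. X j \<omega> \<in> C}"
      unfolding R' Q' by (auto simp: D'_def less_Suc_eq)
    then show "indicator B \<omega> * h \<omega> = indicator A \<omega> * (indicator R \<omega> :: real)"
      by (simp add: B Q'[symmetric] h_def indicator_inter_arith)
  qed simp
  also have "\<dots> = (\<integral>\<omega>. indicator A \<omega> * real_cond_exp M F (indicator R) \<omega> \<partial>M)"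
    by (rule real_cond_exp_intg(2)[symmetric])
      (auto simp: indicator_inter_arith[symmetric] intro!: integrable_indicator_finite)
  also have "\<dots> = (\<integral>\<omega>. (indicator A \<omega> * real_cond_exp M F h \<omega>) * real_cond_exp M F (indicator Q) \<omega> \<partial>M)"
    by (rule integral_cong_AE) (use split in auto)
  also have "\<dots> = (\<integral>\<omega>. (indicator A \<omega> * real_cond_exp M F h \<omega>) * indicator Q \<omega> \<partial>M)"
  proof (rule real_cond_exp_intg(2))
    have "integrable M (\<lambda>\<omega>. real_cond_exp M F h \<omega> * indicator (A \<inter> Q) \<omega>)"
      by (rule integrable_real_mult_indicator) (use hi real_cond_exp_int(1) in auto)
    then show "integrable M (\<lambda>\<omega>. indicator A \<omega> * real_cond_exp M F h \<omega> * indicator Q \<omega>)"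
      by (simp add: indicator_inter_arith mult_ac)
  qed auto
  also have "\<dots> = (\<integral>\<omega>. indicator B \<omega> * real_cond_exp M F h \<omega> \<partial>M)"
    by (simp add: B Q'[symmetric] indicator_inter_arith mult_ac)
  finally show ?thesis .
qed

text \<open>As functions of \<open>B\<close> both sides are finite measures, with densities
  \<open>h\<close> and \<open>real_cond_exp M F h\<close>. Restricted to the past they agree on an
  intersection-stable generator and therefore coincide.\<close>

lemma integral_past_set:
  assumes j: "j < N" and B: "B \<in> sets (past M F E X j)" and C: "C \<in> sets (E j)"
  defines "h \<equiv> indicator {\<omega> \<in> space M. X j \<omega> \<in> C} :: 'a \<Rightarrow> real"
  shows "(\<integral>\<omega>. indicator B \<omega> * h \<omega> \<partial>M) = (\<integral>\<omega>. indicator B \<omega> * real_cond_exp M F h \<omega> \<partial>M)"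
proof -
  have jN: "j \<le> N" using j by simp
  let ?H = "past M F E X j"
  note sub = subalgebra_past[OF jN]
  have setsH: "A \<in> sets ?H \<Longrightarrow> A \<in> sets M" for A using sub by (auto simp: subalgebra_def)
  have "{\<omega> \<in> space M. X j \<omega> \<in> C} = X j -` C \<inter> space M" by auto
  then have Hm: "{\<omega> \<in> space M. X j \<omega> \<in> C} \<in> sets M"
    using measurable_sets[OF cond_indep_measurable[OF j] C] by (simp only:)
  have hm[measurable]: "h \<in> borel_measurable M" and hi: "integrable M h"
    unfolding h_def by (rule borel_measurable_indicator[OF Hm], rule integrable_indicator_finite[OF Hm])
  have ri: "integrable M (real_cond_exp M F h)" by (rule real_cond_exp_int(1)[OF hi])
  have rpos: "AE \<omega> in M. 0 \<le> real_cond_exp M F h \<omega>"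
    by (rule real_cond_exp_pos[OF _ hm]) (simp add: h_def)
  define M1 where "M1 = density M (\<lambda>\<omega>. ennreal (h \<omega>))"
  define M2 where "M2 = density M (\<lambda>\<omega>. ennreal (real_cond_exp M F h \<omega>))"
  have sub1: "subalgebra M1 ?H" and sub2: "subalgebra M2 ?H"
    using sub by (simp_all add: M1_def M2_def subalgebra_def)
  have em1: "emeasure (restr_to_subalg M1 ?H) A = ennreal (\<integral>\<omega>. indicator A \<omega> * h \<omega> \<partial>M)" if "A \<in> sets ?H" for A
  proof -
    have Am[measurable]: "A \<in> sets M" using setsH that by auto
    have "emeasure (restr_to_subalg M1 ?H) A = emeasure M1 A"
      by (rule emeasure_restr_to_subalg[OF sub1 that])
    also have "\<dots> = (\<integral>\<^sup>+\<omega>. ennreal (h \<omega>) * indicator A \<omega> \<partial>M)"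
      unfolding M1_def by (rule emeasure_density) measurable
    also have "\<dots> = (\<integral>\<^sup>+\<omega>. ennreal (indicator A \<omega> * h \<omega>) \<partial>M)"
      by (intro nn_integral_cong) (auto split: split_indicator)
    also have "\<dots> = ennreal (\<integral>\<omega>. indicator A \<omega> * h \<omega> \<partial>M)"
      by (rule nn_integral_eq_integral)
        (use integrable_real_mult_indicator[OF Am hi] in \<open>auto simp: h_def mult.commute\<close>)
    finally show ?thesis .
  qed
  have em2: "emeasure (restr_to_subalg M2 ?H) A = ennreal (\<integral>\<omega>. indicator A \<omega> * real_cond_exp M F h \<omega> \<partial>M)"
    if "A \<in> sets ?H" for A
  proof -
    have Am[measurable]: "A \<in> sets M" using setsH that by auto
    have "emeasure (restr_to_subalg M2 ?H) A = emeasure M2 A"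
      by (rule emeasure_restr_to_subalg[OF sub2 that])
    also have "\<dots> = (\<integral>\<^sup>+\<omega>. ennreal (real_cond_exp M F h \<omega>) * indicator A \<omega> \<partial>M)"
      unfolding M2_def by (rule emeasure_density) measurable
    also have "\<dots> = (\<integral>\<^sup>+\<omega>. ennreal (indicator A \<omega> * real_cond_exp M F h \<omega>) \<partial>M)"
      by (intro nn_integral_cong) (auto split: split_indicator)
    also have "\<dots> = ennreal (\<integral>\<omega>. indicator A \<omega> * real_cond_exp M F h \<omega> \<partial>M)"
    proof (rule nn_integral_eq_integral)
      show "integrable M (\<lambda>\<omega>. indicator A \<omega> * real_cond_exp M F h \<omega>)"
        using integrable_real_mult_indicator[OF Am ri] by (simp add: mult.commute)
      show "AE \<omega> in M. 0 \<le> indicator A \<omega> * real_cond_exp M F h \<omega>" using rpos by auto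
    qed
    finally show ?thesis .
  qed
  \<comment> \<open>Uniqueness of measures asks for generator sets of finite measure that exhaust
    the space; the space itself is one of them.\<close>
  have top: "space M \<in> past_generator M F E X j"
  proof -
    have eq: "space M = space M \<inter> {\<omega> \<in> space M. \<forall>i<j. X i \<omega> \<in> space (E i)}"
    proof -
      have "\<forall>i<j. X i \<omega> \<in> space (E i)" if "\<omega> \<in> space M" for \<omega>
        using cond_indep_space[OF _ that] jN by (meson order_less_le_trans)
      then show ?thesis by blast
    qed
    have "space M \<in> sets F" using sets.top[of F] unfolding space_F .
    then have "space M \<inter> {\<omega> \<in> space M. \<forall>i<j. X i \<omega> \<in> space (E i)} \<in> past_generator M F E X j"
      by (rule past_generatorI) (rule sets.top)
    then show ?thesis unfolding eq[symmetric] .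
  qed
  have "restr_to_subalg M1 ?H = restr_to_subalg M2 ?H"
  proof (rule measure_eqI_generator_eq[where A = "\<lambda>_. space M" and \<Omega> = "space M"
        and E = "past_generator M F E X j"])
    show "Int_stable (past_generator M F E X j)" by (rule Int_stable_past_generator)
    show "past_generator M F E X j \<subseteq> Pow (space M)"
      using past_generator_sets[OF jN] sets.space_closed by blast
    show "emeasure (restr_to_subalg M1 ?H) A = emeasure (restr_to_subalg M2 ?H) A"
      if "A \<in> past_generator M F E X j" for A
    proof -
      have "A \<in> sets ?H" using that unfolding sets_past[OF jN] by (rule sigma_sets.Basic)
      then show ?thesis using integral_past_generator[OF j that C] by (simp add: em1 em2 h_def)
    qed
    show "sets (restr_to_subalg M1 ?H) = sigma_sets (space M) (past_generator M F E X j)"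
      "sets (restr_to_subalg M2 ?H) = sigma_sets (space M) (past_generator M F E X j)"
      by (simp_all add: sets_restr_to_subalg[OF sub1] sets_restr_to_subalg[OF sub2] sets_past[OF jN])
    show "emeasure (restr_to_subalg M1 ?H) (space M) \<noteq> \<infinity>"
      using em1[of "space M"] sets.top[of ?H] by (simp add: space_past)
    show "range (\<lambda>_. space M) \<subseteq> past_generator M F E X j" using top by blast
  qed simp
  then have "ennreal (\<integral>\<omega>. indicator B \<omega> * h \<omega> \<partial>M) = ennreal (\<integral>\<omega>. indicator B \<omega> * real_cond_exp M F h \<omega> \<partial>M)"
    using em1[OF B] em2[OF B] by simp
  moreover have "0 \<le> (\<integral>\<omega>. indicator B \<omega> * h \<omega> \<partial>M)" by (rule integral_nonneg_AE) (auto simp: h_def)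
  moreover have "0 \<le> (\<integral>\<omega>. indicator B \<omega> * real_cond_exp M F h \<omega> \<partial>M)"
    by (rule integral_nonneg_AE) (use rpos in auto)
  ultimately show ?thesis by (simp add: ennreal_inj)
qed

text \<open>Given \<open>F\<close>, the earlier variables carry no further information about
  \<open>X j\<close>. This extends the statement for events to bounded functions of
  \<open>X j\<close>.\<close>

lemma real_cond_exp_past:
  fixes g :: "'b \<Rightarrow> real"
  assumes j: "j < N" and g: "g \<in> borel_measurable (E j)" and bound: "\<And>x. x \<in> space (E j) \<Longrightarrow> \<bar>g x\<bar> \<le> b"
  shows "AE \<omega> in M. real_cond_exp M (past M F E X j) (\<lambda>\<omega>. g (X j \<omega>)) \<omega> = real_cond_exp M F (\<lambda>\<omega>. g (X j \<omega>)) \<omega>"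
proof -
  have jN: "j \<le> N" using j by simp
  let ?H = "past M F E X j"
  note sub = subalgebra_past[OF jN] and Xj[measurable] = cond_indep_measurable[OF j] and g[measurable]
  interpret H: finite_measure_subalgebra M ?H by unfold_locales (rule sub)
  have gi: "integrable M (\<lambda>\<omega>. g (X j \<omega>))"
    using bound cond_indep_space[OF j] by (intro integrable_const_bound[of _ b]) auto
  show ?thesis
  proof (rule H.real_cond_exp_charact)
    show "integrable M (\<lambda>\<omega>. g (X j \<omega>))" by (rule gi)
    show "integrable M (real_cond_exp M F (\<lambda>\<omega>. g (X j \<omega>)))" by (rule real_cond_exp_int(1)[OF gi])
    show "real_cond_exp M F (\<lambda>\<omega>. g (X j \<omega>)) \<in> borel_measurable ?H"
      by (rule measurable_from_subalg[OF F_subset_past[OF jN]]) simp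
  next
    fix B assume B: "B \<in> sets ?H"
    have Bm[measurable]: "B \<in> sets M" using B sub by (auto simp: subalgebra_def)
    have Bi: "integrable M (indicator B :: 'a \<Rightarrow> real)" by (rule integrable_indicator_finite[OF Bm])
    let ?r = "real_cond_exp M F (indicator B)"
    have ri: "integrable M ?r" by (rule real_cond_exp_int(1)[OF Bi])
    have rpos: "AE \<omega> in M. 0 \<le> ?r \<omega>" by (rule real_cond_exp_pos) auto
    define M1 where "M1 = distr (density M (\<lambda>\<omega>. ennreal (indicator B \<omega>))) (E j) (X j)"
    define M2 where "M2 = distr (density M (\<lambda>\<omega>. ennreal (?r \<omega>))) (E j) (X j)"
    \<comment> \<open>Moving the conditional expectation from the function of \<open>X j\<close> to the indicator of \<open>B\<close> turns the
      claim into the equality of two measures on the range of \<open>X j\<close>, which is checked on sets.\<close>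
    have "M1 = M2"
    proof (rule measure_eqI)
      show "sets M1 = sets M2" by (simp add: M1_def M2_def)
      fix C assume "C \<in> sets M1"
      then have C[measurable]: "C \<in> sets (E j)" by (simp add: M1_def)
      define h where "h = (indicator {\<omega> \<in> space M. X j \<omega> \<in> C} :: 'a \<Rightarrow> real)"
      have hm[measurable]: "h \<in> borel_measurable M" unfolding h_def by measurable
      have hi: "integrable M h"
        by (rule integrable_const_bound[of _ 1]) (auto simp: h_def)
      have e1: "emeasure M1 C = ennreal (\<integral>\<omega>. indicator B \<omega> * h \<omega> \<partial>M)"
      proof -
        have "emeasure M1 C = (\<integral>\<^sup>+\<omega>. ennreal (indicator B \<omega>) * indicator (X j -` C \<inter> space M) \<omega> \<partial>M)"
          unfolding M1_def by (subst emeasure_distr) (auto simp: emeasure_density)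
        also have "\<dots> = (\<integral>\<^sup>+\<omega>. ennreal (indicator B \<omega> * h \<omega>) \<partial>M)"
          by (intro nn_integral_cong) (auto simp: h_def split: split_indicator)
        also have "\<dots> = ennreal (\<integral>\<omega>. indicator B \<omega> * h \<omega> \<partial>M)"
          by (rule nn_integral_eq_integral)
            (use integrable_real_mult_indicator[OF Bm hi] in \<open>auto simp: h_def mult.commute\<close>)
        finally show ?thesis .
      qed
      have ih: "integrable M (\<lambda>\<omega>. h \<omega> * ?r \<omega>)"
        by (rule integrable_bounded_mult[OF ri hm, of 1]) (auto simp: h_def)
      have e2: "emeasure M2 C = ennreal (\<integral>\<omega>. h \<omega> * ?r \<omega> \<partial>M)"
      proof -
        have "emeasure M2 C = (\<integral>\<^sup>+\<omega>. ennreal (?r \<omega>) * indicator (X j -` C \<inter> space M) \<omega> \<partial>M)"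
          unfolding M2_def by (subst emeasure_distr) (auto simp: emeasure_density)
        also have "\<dots> = (\<integral>\<^sup>+\<omega>. ennreal (h \<omega> * ?r \<omega>) \<partial>M)"
          by (intro nn_integral_cong) (auto simp: h_def split: split_indicator)
        also have "\<dots> = ennreal (\<integral>\<omega>. h \<omega> * ?r \<omega> \<partial>M)"
          by (rule nn_integral_eq_integral[OF ih]) (use rpos in \<open>auto simp: h_def\<close>)
        finally show ?thesis .
      qed
      \<comment> \<open>Conditional expectation is self-adjoint: first \<open>indicator B\<close> is
        replaced by its conditional expectation against the \<open>F\<close>-measurable
        \<open>real_cond_exp M F h\<close>, then the latter is replaced by \<open>h\<close>.\<close>
      have "(\<integral>\<omega>. indicator B \<omega> * h \<omega> \<partial>M) = (\<integral>\<omega>. real_cond_exp M F h \<omega> * indicator B \<omega> \<partial>M)"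
        using integral_past_set[OF j B C] by (simp add: h_def mult.commute)
      also have "\<dots> = (\<integral>\<omega>. real_cond_exp M F h \<omega> * ?r \<omega> \<partial>M)"
        by (rule real_cond_exp_intg(2)[symmetric])
          (use integrable_real_mult_indicator[OF Bm real_cond_exp_int(1)[OF hi]] in auto)
      also have "\<dots> = (\<integral>\<omega>. ?r \<omega> * real_cond_exp M F h \<omega> \<partial>M)" by (simp add: mult.commute)
      also have "\<dots> = (\<integral>\<omega>. ?r \<omega> * h \<omega> \<partial>M)"
        by (rule real_cond_exp_intg(2)) (use ih in \<open>auto simp: mult.commute\<close>)
      finally show "emeasure M1 C = emeasure M2 C" by (simp add: e1 e2 mult.commute)
    qed
    then have eq: "integral\<^sup>L M1 g = integral\<^sup>L M2 g" by simp
    have "(\<integral>\<omega>\<in>B. g (X j \<omega>) \<partial>M) = (\<integral>\<omega>. indicator B \<omega> * g (X j \<omega>) \<partial>M)"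
      by (simp add: set_lebesgue_integral_def)
    also have "\<dots> = integral\<^sup>L M1 g"
      unfolding M1_def by (subst integral_distr) (auto simp: integral_density)
    also have "\<dots> = integral\<^sup>L M2 g" by (rule eq)
    also have "\<dots> = (\<integral>\<omega>. ?r \<omega> * g (X j \<omega>) \<partial>M)"
      unfolding M2_def by (subst integral_distr) (use rpos in \<open>auto simp: integral_density\<close>)
    also have "\<dots> = (\<integral>\<omega>. ?r \<omega> * real_cond_exp M F (\<lambda>\<omega>. g (X j \<omega>)) \<omega> \<partial>M)"
    proof (rule real_cond_exp_intg(2)[symmetric])
      show "integrable M (\<lambda>\<omega>. ?r \<omega> * g (X j \<omega>))"
        using integrable_bounded_mult[OF ri, of "\<lambda>\<omega>. g (X j \<omega>)" b] bound cond_indep_space[OF j]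
        by (simp add: mult.commute)
    qed auto
    also have "\<dots> = (\<integral>\<omega>. real_cond_exp M F (\<lambda>\<omega>. g (X j \<omega>)) \<omega> * ?r \<omega> \<partial>M)" by (simp add: mult.commute)
    also have "\<dots> = (\<integral>\<omega>. real_cond_exp M F (\<lambda>\<omega>. g (X j \<omega>)) \<omega> * indicator B \<omega> \<partial>M)"
      by (rule real_cond_exp_intg(2))
        (use integrable_real_mult_indicator[OF Bm real_cond_exp_int(1)[OF gi]] in auto)
    also have "\<dots> = (\<integral>\<omega>\<in>B. real_cond_exp M F (\<lambda>\<omega>. g (X j \<omega>)) \<omega> \<partial>M)"
      by (simp add: set_lebesgue_integral_def mult.commute)
    finally show "(\<integral>\<omega>\<in>B. g (X j \<omega>) \<partial>M) = (\<integral>\<omega>\<in>B. real_cond_exp M F (\<lambda>\<omega>. g (X j \<omega>)) \<omega> \<partial>M)" .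
  qed
qed

text \<open>The form in which a row is exchanged: \<open>f\<close> will be an entry of a matrix
  power that contains earlier rows and conditional moments only.\<close>

lemma integral_past_mult:
  fixes g :: "'b \<Rightarrow> real"
  assumes j: "j < N" and g: "g \<in> borel_measurable (E j)" and bound: "\<And>x. x \<in> space (E j) \<Longrightarrow> \<bar>g x\<bar> \<le> b"
    and f: "f \<in> borel_measurable (past M F E X j)" and fb: "\<And>\<omega>. \<omega> \<in> space M \<Longrightarrow> \<bar>f \<omega>\<bar> \<le> c"
  shows "(\<integral>\<omega>. f \<omega> * g (X j \<omega>) \<partial>M) = (\<integral>\<omega>. f \<omega> * real_cond_exp M F (\<lambda>\<omega>. g (X j \<omega>)) \<omega> \<partial>M)"
proof -
  have jN: "j \<le> N" using j by simp
  let ?H = "past M F E X j"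
  note sub = subalgebra_past[OF jN] and Xj[measurable] = cond_indep_measurable[OF j] and g[measurable]
  have fM[measurable]: "f \<in> borel_measurable M" by (rule measurable_from_subalg[OF sub f])
  interpret H: finite_measure_subalgebra M ?H by unfold_locales (rule sub)
  have gi: "integrable M (\<lambda>\<omega>. g (X j \<omega>))"
    using bound cond_indep_space[OF j] by (intro integrable_const_bound[of _ b]) auto
  have "(\<integral>\<omega>. f \<omega> * g (X j \<omega>) \<partial>M) = (\<integral>\<omega>. f \<omega> * real_cond_exp M ?H (\<lambda>\<omega>. g (X j \<omega>)) \<omega> \<partial>M)"
    by (rule H.real_cond_exp_intg(2)[symmetric])
      (use integrable_bounded_mult[OF gi fM fb] f in auto)
  also have "\<dots> = (\<integral>\<omega>. f \<omega> * real_cond_exp M F (\<lambda>\<omega>. g (X j \<omega>)) \<omega> \<partial>M)"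
    by (rule integral_cong_AE) (use real_cond_exp_past[OF j g bound] in auto)
  finally show ?thesis .
qed

end

end

subsection \<open>A conditional matrix Chernoff bound\<close>

lemma matpow_measurable:
  assumes "\<And>s t. s < n \<Longrightarrow> t < n \<Longrightarrow> (\<lambda>\<omega>. A \<omega> s t) \<in> borel_measurable H" "s < n" "t < n"
  shows "(\<lambda>\<omega>. matpow n (A \<omega>) k s t) \<in> borel_measurable H"
  using assms(2,3)
proof (induction k arbitrary: s t)
  case (Suc k)
  then show ?case unfolding matpow.simps
    by (intro borel_measurable_sum borel_measurable_times assms(1)) auto
qed simp

lemma trace_pow_measurable:
  assumes "\<And>s t. s < n \<Longrightarrow> t < n \<Longrightarrow> (\<lambda>\<omega>. A \<omega> s t) \<in> borel_measurable H"
  shows "(\<lambda>\<omega>. trace_pow n (A \<omega>) k) \<in> borel_measurable H"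
  unfolding trace_pow_def by (intro borel_measurable_sum matpow_measurable assms) auto

text \<open>Only finiteness matters: on a suitable event this crude bound makes the traces
  integrable and the entries admissible as bounded factors.\<close>

lemma matpow_bound:
  assumes "\<And>s t. s < n \<Longrightarrow> t < n \<Longrightarrow> \<bar>A s t\<bar> \<le> b" "s < n" "t < n"
  shows "\<bar>matpow n A k s t\<bar> \<le> (real n * b) ^ k"
  using assms(2,3)
proof (induction k arbitrary: s t)
  case (Suc k)
  have b: "0 \<le> b" using assms(1)[OF Suc.prems] by linarith
  have "\<bar>matpow n A (Suc k) s t\<bar> \<le> (\<Sum>r<n. \<bar>A s r * matpow n A k r t\<bar>)"
    unfolding matpow.simps by (rule sum_abs)
  also have "\<dots> \<le> (\<Sum>r<n. b * (real n * b) ^ k)"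
    unfolding abs_mult using Suc assms(1) b by (intro sum_mono mult_mono) auto
  finally show ?case by simp
qed simp

lemma trace_pow_bound:
  assumes "\<And>s t. s < n \<Longrightarrow> t < n \<Longrightarrow> \<bar>A s t\<bar> \<le> b"
  shows "\<bar>trace_pow n A k\<bar> \<le> real n * (real n * b) ^ k"
proof -
  have "\<bar>trace_pow n A k\<bar> \<le> (\<Sum>s<n. \<bar>matpow n A k s s\<bar>)"
    unfolding trace_pow_def by (rule sum_abs)
  also have "\<dots> \<le> (\<Sum>s<n. (real n * b) ^ k)"
    using assms by (intro sum_mono matpow_bound) auto
  finally show ?thesis by simp
qed

section \<open>Quadratic forms and positive semidefinite matrices\<close>

lemma bilin_add: "bilin n (\<lambda>s t. A s t + C s t) x y = bilin n A x y + bilin n C x y"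
  by (simp add: bilin_def sum.distrib distrib_left distrib_right)

lemma bilin_scale: "bilin n (\<lambda>s t. c * A s t) x y = c * bilin n A x y"
  by (simp add: bilin_def sum_distrib_left mult_ac)

lemma bilin_sum: "bilin n (\<lambda>s t. \<Sum>i\<in>I. A i s t) x y = (\<Sum>i\<in>I. bilin n (A i) x y)"
proof (cases "finite I")
  case True
  then show ?thesis by (induction I rule: finite_induct) (simp_all add: bilin_add, simp add: bilin_def)
next
  case False
  then show ?thesis by (simp add: bilin_def)
qed

lemma bilin_outer: "bilin n (outer v) x y = inner_on n v x * inner_on n v y"
  by (simp add: bilin_def outer_def inner_on_def sum_product mult_ac)

lemma bilin_shift: "bilin n (shift c A) x x = bilin n A x x + c * inner_on n x x"
proof -
  have "bilin n (shift c A) x x = bilin n A x x + (\<Sum>s<n. \<Sum>t<n. if s = t then c * (x s * x t) else 0)"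
    unfolding bilin_def shift_def sum.distrib[symmetric] by (intro sum.cong refl) (auto simp: algebra_simps)
  then show ?thesis by (simp add: inner_on_def sum_distrib_left sum.delta)
qed

lemma psd_outer: "psd_on n (outer v)"
  by (simp add: psd_on_def symm_on_def bilin_outer) (simp add: outer_def)

lemma psd_add: "psd_on n A \<Longrightarrow> psd_on n C \<Longrightarrow> psd_on n (\<lambda>s t. A s t + C s t)"
  by (simp add: psd_on_def symm_on_def bilin_add)

lemma psd_scale: "0 \<le> c \<Longrightarrow> psd_on n A \<Longrightarrow> psd_on n (\<lambda>s t. c * A s t)"
  by (simp add: psd_on_def symm_on_def bilin_scale)

lemma psd_sum: "(\<And>i. i \<in> I \<Longrightarrow> psd_on n (A i)) \<Longrightarrow> psd_on n (\<lambda>s t. \<Sum>i\<in>I. A i s t)"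
  by (auto simp: psd_on_def symm_on_def bilin_sum intro!: sum_nonneg sum.cong)

lemma psd_shift: "0 \<le> c \<Longrightarrow> psd_on n A \<Longrightarrow> psd_on n (shift c A)"
  by (simp add: psd_on_def bilin_shift inner_on_nonneg) (auto simp: symm_on_def shift_def)

lemma psd_eigenbasis:
  assumes "psd_on n A"
  obtains q l where "eigenbasis n A q l" "\<And>i. i < n \<Longrightarrow> 0 \<le> l i"
proof -
  have "symm_on n A" using assms by (simp add: psd_on_def)
  then obtain q l where ql: "eigenbasis n A q l" by (rule eigenbasis_exists)
  show ?thesis using that[OF ql eigenbasis_nonneg[OF ql assms]] .
qed

lemma psd_shift_eigenbasis:
  assumes "psd_on n A"
  obtains q l where "eigenbasis n (shift c A) q l" "\<And>i. i < n \<Longrightarrow> c \<le> l i"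
proof -
  obtain q l where ql: "eigenbasis n A q l" "\<And>i. i < n \<Longrightarrow> 0 \<le> l i" by (rule psd_eigenbasis[OF assms]) blast
  show ?thesis using that[OF eigenbasis_shift[OF ql(1), of c]] ql(2) by simp
qed

lemma frob_add: "frob n (\<lambda>s t. A s t + C s t) D = frob n A D + frob n C D"
  by (simp add: frob_def sum.distrib distrib_right)

lemma frob_scale: "frob n (\<lambda>s t. c * A s t) D = c * frob n A D"
  by (simp add: frob_def sum_distrib_left mult_ac)

text \<open>The vectors are functions \<phi> of the variables \<open>X j\<close>. Truncation can
  thus be placed into \<phi>, while conditional independence is assumed for the rows before
  truncation.\<close>

locale cond_indep_rank_one = finite_measure_subalgebra +
  fixes E :: "nat \<Rightarrow> 'b measure" and X :: "nat \<Rightarrow> 'a \<Rightarrow> 'b" and N n :: nat and \<phi> :: "nat \<Rightarrow> 'b \<Rightarrow> nat \<Rightarrow> real"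
  assumes ci: "cond_indep_vars M F E X {..<N}"
    and \<phi>_meas: "\<And>j s. j < N \<Longrightarrow> s < n \<Longrightarrow> (\<lambda>x. \<phi> j x s) \<in> borel_measurable (E j)"
    and \<phi>_bound: "\<And>j x. j < N \<Longrightarrow> x \<in> space (E j) \<Longrightarrow> inner_on n (\<phi> j x) (\<phi> j x) \<le> 1"
begin

definition v :: "nat \<Rightarrow> 'a \<Rightarrow> nat \<Rightarrow> real" where
  "v j \<omega> = \<phi> j (X j \<omega>)"

definition B :: "nat \<Rightarrow> 'a \<Rightarrow> nat \<Rightarrow> nat \<Rightarrow> real" where
  "B j \<omega> s t = real_cond_exp M F (\<lambda>\<omega>. v j \<omega> s * v j \<omega> t) \<omega>"

text \<open>The intermediate matrices when the rows are exchanged for their conditional second moments one by one.\<close>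

definition mixed :: "nat \<Rightarrow> nat \<Rightarrow> nat \<Rightarrow> 'a \<Rightarrow> nat \<Rightarrow> nat \<Rightarrow> real" where
  "mixed k i j \<omega> = shift (real (Suc k))
     (\<lambda>s t. (\<Sum>r<i. outer (v r \<omega>) s t) + (\<Sum>r=j..<N. exp 1 * B r \<omega> s t))"

text \<open>The chosen versions \<open>B\<close> have these properties only almost everywhere. A
  good event belongs to \<open>F\<close> and has them at every point, so that pathwise trace
  inequalities can be integrated against its indicator without disturbing conditional
  expectations.\<close>

definition good :: "'a set \<Rightarrow> bool" where
  "good G \<longleftrightarrow> G \<in> sets F \<and> (\<forall>\<omega>\<in>G. \<forall>j<N. psd_on n (B j \<omega>) \<and>
     (\<forall>s<n. \<forall>t<n. \<bar>B j \<omega> s t\<bar> \<le> 1) \<and> (\<Sum>s<n. B j \<omega> s s) \<le> 1)"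

lemma entry_bound:
  assumes "j < N" "x \<in> space (E j)" "s < n"
  shows "\<bar>\<phi> j x s\<bar> \<le> 1"
proof -
  have "(\<phi> j x s)\<^sup>2 \<le> (\<Sum>s<n. (\<phi> j x s)\<^sup>2)" using assms(3) by (intro member_le_sum) auto
  also have "\<dots> \<le> 1" using \<phi>_bound[OF assms(1,2)] by (simp add: inner_on_def power2_eq_square)
  finally show ?thesis by (simp add: abs_square_le_1)
qed

lemma prod_entry_bound:
  assumes "j < N" "x \<in> space (E j)" "s < n" "t < n"
  shows "\<bar>\<phi> j x s * \<phi> j x t\<bar> \<le> 1"
  unfolding abs_mult using entry_bound[OF assms(1,2)] assms by (intro mult_le_one) auto

lemma v_past: "i < j \<Longrightarrow> j \<le> N \<Longrightarrow> s < n \<Longrightarrow> (\<lambda>\<omega>. v i \<omega> s) \<in> borel_measurable (past M F E X j)"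
  unfolding v_def by (rule measurable_compose[OF measurable_past[OF ci] \<phi>_meas]) auto

lemma v_meas: "i < N \<Longrightarrow> s < n \<Longrightarrow> (\<lambda>\<omega>. v i \<omega> s) \<in> borel_measurable M"
  unfolding v_def by (rule measurable_compose[OF cond_indep_measurable[OF ci] \<phi>_meas]) auto

lemma B_meas_F: "(\<lambda>\<omega>. B j \<omega> s t) \<in> borel_measurable F"
  unfolding B_def by simp

text \<open>Conditional moments are measurable with respect to \<open>F\<close>, so the index
  \<open>l\<close> at which their sum starts is arbitrary; only the number \<open>i\<close> of
  genuine rows is tied to the past.\<close>

lemma mixed_past:
  assumes "i \<le> j" "j \<le> N" "s < n" "t < n"
  shows "(\<lambda>\<omega>. mixed k i l \<omega> s t) \<in> borel_measurable (past M F E X j)"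
  unfolding mixed_def shift_def outer_def
  using assms measurable_from_subalg[OF F_subset_past[OF ci assms(2)] B_meas_F]
  by (intro borel_measurable_add borel_measurable_sum borel_measurable_times v_past) auto

lemma mixed_meas:
  assumes "i \<le> N" "s < n" "t < n"
  shows "(\<lambda>\<omega>. mixed k i l \<omega> s t) \<in> borel_measurable M"
  using measurable_from_subalg[OF subalgebra_past[OF ci] mixed_past[of i N]] assms by auto

lemma v_inner_le: "j < N \<Longrightarrow> \<omega> \<in> space M \<Longrightarrow> inner_on n (v j \<omega>) (v j \<omega>) \<le> 1"
  unfolding v_def by (rule \<phi>_bound) (auto intro: cond_indep_space[OF ci])

lemma mixed_bound:
  assumes G: "good G" "\<omega> \<in> G" and i: "i \<le> N" and st: "s < n" "t < n"
  shows "\<bar>mixed k i l \<omega> s t\<bar> \<le> real (Suc k) + real N + real N * exp 1"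
proof -
  have \<omega>: "\<omega> \<in> space M" using G sets.sets_into_space[of G F] by (auto simp: good_def space_F)
  have "\<bar>\<Sum>r<i. outer (v r \<omega>) s t\<bar> \<le> (\<Sum>r<i. \<bar>outer (v r \<omega>) s t\<bar>)" by (rule sum_abs)
  also have "\<dots> \<le> (\<Sum>r<i. 1)"
  proof (rule sum_mono)
    fix r assume "r \<in> {..<i}"
    then have "r < N" using i by simp
    from prod_entry_bound[OF this cond_indep_space[OF ci this \<omega>] st]
    show "\<bar>outer (v r \<omega>) s t\<bar> \<le> 1" by (simp add: outer_def v_def)
  qed
  also have "\<dots> \<le> real N" using i by simp
  finally have 1: "\<bar>\<Sum>r<i. outer (v r \<omega>) s t\<bar> \<le> real N" .
  have "\<bar>\<Sum>r=l..<N. exp 1 * B r \<omega> s t\<bar> \<le> (\<Sum>r=l..<N. \<bar>exp 1 * B r \<omega> s t\<bar>)" by (rule sum_abs)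
  also have "\<dots> \<le> (\<Sum>r=l..<N. exp 1)"
    using G st by (intro sum_mono) (simp add: abs_mult good_def)
  also have "\<dots> \<le> real N * exp 1" by simp
  finally have 2: "\<bar>\<Sum>r=l..<N. exp 1 * B r \<omega> s t\<bar> \<le> real N * exp 1" .
  show ?thesis using 1 2 unfolding mixed_def shift_def by (auto simp: abs_if split: if_splits)
qed

lemma mixed_psd:
  assumes "good G" "\<omega> \<in> G"
  shows "psd_on n (\<lambda>s t. (\<Sum>r<i. outer (v r \<omega>) s t) + (\<Sum>r=j..<N. exp 1 * B r \<omega> s t))"
  using assms by (intro psd_add psd_sum psd_outer psd_scale) (auto simp: good_def)

lemma integrable_good_trace:
  assumes "good G" "i \<le> N"
  shows "integrable M (\<lambda>\<omega>. indicator G \<omega> * trace_pow n (mixed k i j \<omega>) m)"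
proof (rule integrable_const_bound)
  have G: "G \<in> sets M" using assms sets_F by (auto simp: good_def)
  show "(\<lambda>\<omega>. indicator G \<omega> * trace_pow n (mixed k i j \<omega>) m) \<in> borel_measurable M"
    using G assms by (intro borel_measurable_times trace_pow_measurable mixed_meas) auto
  show "AE \<omega> in M. norm (indicator G \<omega> * trace_pow n (mixed k i j \<omega>) m)
    \<le> real n * (real n * (real (Suc k) + real N + real N * exp 1)) ^ m"
  proof (rule AE_I2)
    fix \<omega>
    show "norm (indicator G \<omega> * trace_pow n (mixed k i j \<omega>) m)
    \<le> real n * (real n * (real (Suc k) + real N + real N * exp 1)) ^ m"
    proof (cases "\<omega> \<in> G")
      case True
      then show ?thesis
        using trace_pow_bound[of n "mixed k i j \<omega>" "real (Suc k) + real N + real N * exp 1" m]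
          mixed_bound[OF assms(1) True assms(2)] by simp
    next
      case False
      then show ?thesis by simp
    qed
  qed
qed

text \<open>In entries, the power of the mixed matrix is a bounded function measurable with respect
  to the past of \<open>j\<close>, multiplied by \<open>v j \<omega> s * v j \<omega> t\<close>.
  Conditioning on that past replaces each product by its conditional moment given
  \<open>F\<close>.\<close>

lemma integral_good_frob:
  assumes G: "good G" and j: "j < N"
  shows "(\<integral>\<omega>. indicator G \<omega> * frob n (outer (v j \<omega>)) (matpow n (mixed k j l \<omega>) m) \<partial>M)
    = (\<integral>\<omega>. indicator G \<omega> * frob n (B j \<omega>) (matpow n (mixed k j l \<omega>) m) \<partial>M)"
    and "integrable M (\<lambda>\<omega>. indicator G \<omega> * frob n (outer (v j \<omega>)) (matpow n (mixed k j l \<omega>) m))"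
    and "integrable M (\<lambda>\<omega>. indicator G \<omega> * frob n (B j \<omega>) (matpow n (mixed k j l \<omega>) m))"
proof -
  let ?H = "past M F E X j"
  have GF: "G \<in> sets F" using G by (simp add: good_def)
  have jN: "j \<le> N" using j by simp
  define f where "f s t \<omega> = indicator G \<omega> * matpow n (mixed k j l \<omega>) m s t" for s t \<omega>
  define b where "b = (real n * (real (Suc k) + real N + real N * exp 1)) ^ m"
  have GH: "indicator G \<in> borel_measurable ?H"
    by (rule measurable_from_subalg[OF F_subset_past[OF ci jN]]) (use GF in auto)
  have fH: "f s t \<in> borel_measurable ?H" if "s < n" "t < n" for s t
    unfolding f_def[abs_def] using that jN
    by (intro borel_measurable_times GH matpow_measurable mixed_past) auto
  have fM: "f s t \<in> borel_measurable M" if "s < n" "t < n" for s t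
    using measurable_from_subalg[OF subalgebra_past[OF ci jN] fH[OF that]] .
  have b0: "0 \<le> b" unfolding b_def by simp
  have fb: "\<bar>f s t \<omega>\<bar> \<le> b" if "s < n" "t < n" for s t \<omega>
  proof (cases "\<omega> \<in> G")
    case True
    show ?thesis
      using matpow_bound[of n "mixed k j l \<omega>" "real (Suc k) + real N + real N * exp 1" s t m]
        mixed_bound[OF G True jN] that True by (simp add: f_def b_def)
  qed (simp add: f_def b0)
  have vv: "integrable M (\<lambda>\<omega>. v j \<omega> s * v j \<omega> t)" if "s < n" "t < n" for s t
    by (rule integrable_const_bound[of _ 1])
      (use prod_entry_bound[OF j cond_indep_space[OF ci j] that] v_meas j that in \<open>auto simp: v_def\<close>)
  have Bi: "integrable M (\<lambda>\<omega>. B j \<omega> s t)" if "s < n" "t < n" for s t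
    unfolding B_def by (rule real_cond_exp_int(1)[OF vv[OF that]])
  have int1: "integrable M (\<lambda>\<omega>. f s t \<omega> * (v j \<omega> s * v j \<omega> t))" if "s < n" "t < n" for s t
    using integrable_bounded_mult[OF vv[OF that] fM[OF that] fb[OF that]] .
  have int2: "integrable M (\<lambda>\<omega>. f s t \<omega> * B j \<omega> s t)" if "s < n" "t < n" for s t
    using integrable_bounded_mult[OF Bi[OF that] fM[OF that] fb[OF that]] .
  have eq: "(\<integral>\<omega>. f s t \<omega> * (v j \<omega> s * v j \<omega> t) \<partial>M) = (\<integral>\<omega>. f s t \<omega> * B j \<omega> s t \<partial>M)"
    if st: "s < n" "t < n" for s t
    unfolding B_def v_def
    by (rule integral_past_mult[OF ci j, of "\<lambda>x. \<phi> j x s * \<phi> j x t" 1 "f s t" b])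
      (use \<phi>_meas[OF j] prod_entry_bound[OF j] fH fb st in auto)
  have e1: "indicator G \<omega> * frob n (outer (v j \<omega>)) (matpow n (mixed k j l \<omega>) m)
      = (\<Sum>s<n. \<Sum>t<n. f s t \<omega> * (v j \<omega> s * v j \<omega> t))" for \<omega>
    by (simp add: frob_def f_def outer_def sum_distrib_left mult_ac)
  have e2: "indicator G \<omega> * frob n (B j \<omega>) (matpow n (mixed k j l \<omega>) m)
      = (\<Sum>s<n. \<Sum>t<n. f s t \<omega> * B j \<omega> s t)" for \<omega>
    by (simp add: frob_def f_def sum_distrib_left mult_ac)
  show "integrable M (\<lambda>\<omega>. indicator G \<omega> * frob n (outer (v j \<omega>)) (matpow n (mixed k j l \<omega>) m))"
    unfolding e1 using int1 by (intro Bochner_Integration.integrable_sum) auto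
  show "integrable M (\<lambda>\<omega>. indicator G \<omega> * frob n (B j \<omega>) (matpow n (mixed k j l \<omega>) m))"
    unfolding e2 using int2 by (intro Bochner_Integration.integrable_sum) auto
  have "(\<integral>\<omega>. (\<Sum>s<n. \<Sum>t<n. f s t \<omega> * (v j \<omega> s * v j \<omega> t)) \<partial>M)
      = (\<Sum>s<n. \<Sum>t<n. \<integral>\<omega>. f s t \<omega> * (v j \<omega> s * v j \<omega> t) \<partial>M)"
    using int1 by (subst Bochner_Integration.integral_sum)
      (auto intro!: sum.cong Bochner_Integration.integral_sum Bochner_Integration.integrable_sum)
  also have "\<dots> = (\<Sum>s<n. \<Sum>t<n. \<integral>\<omega>. f s t \<omega> * B j \<omega> s t \<partial>M)" using eq by simp
  also have "\<dots> = (\<integral>\<omega>. (\<Sum>s<n. \<Sum>t<n. f s t \<omega> * B j \<omega> s t) \<partial>M)"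
    using int2 by (subst Bochner_Integration.integral_sum)
      (auto intro!: sum.cong Bochner_Integration.integral_sum[symmetric] Bochner_Integration.integrable_sum)
  finally show "(\<integral>\<omega>. indicator G \<omega> * frob n (outer (v j \<omega>)) (matpow n (mixed k j l \<omega>) m) \<partial>M)
    = (\<integral>\<omega>. indicator G \<omega> * frob n (B j \<omega>) (matpow n (mixed k j l \<omega>) m) \<partial>M)"
    unfolding e1 e2 .
qed

lemma integral_mixed_step:
  assumes G: "good G" and j: "j < N"
  shows "(\<integral>\<omega>. indicator G \<omega> * trace_pow n (mixed k (Suc j) (Suc j) \<omega>) (Suc k) \<partial>M)
    \<le> (\<integral>\<omega>. indicator G \<omega> * trace_pow n (mixed k j j \<omega>) (Suc k) \<partial>M)"
proof -
  let ?R = "\<lambda>\<omega>. mixed k j (Suc j) \<omega>"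
  let ?tr = "\<lambda>\<omega>. indicator G \<omega> * trace_pow n (?R \<omega>) (Suc k)"
  let ?c = "real (Suc k) * exp 1"
  let ?f1 = "\<lambda>\<omega>. indicator G \<omega> * frob n (outer (v j \<omega>)) (matpow n (?R \<omega>) k)"
  let ?f2 = "\<lambda>\<omega>. indicator G \<omega> * frob n (B j \<omega>) (matpow n (?R \<omega>) k)"
  have jN: "j \<le> N" "Suc j \<le> N" using j by auto
  note ints = integrable_good_trace[OF G jN(1)] integrable_good_trace[OF G jN(2)] integral_good_frob(2,3)[OF G j]
  \<comment> \<open>Both neighbours arise from \<open>?R\<close>, which omits index \<open>j\<close>
    from either sum: one adds the genuine row, the other \<open>exp 1\<close> times its conditional
    moment.\<close>
  have up: "mixed k (Suc j) (Suc j) \<omega> = (\<lambda>s t. ?R \<omega> s t + outer (v j \<omega>) s t)" for \<omega>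
    by (intro ext) (simp add: mixed_def shift_def)
  have down: "mixed k j j \<omega> = (\<lambda>s t. ?R \<omega> s t + exp 1 * B j \<omega> s t)" for \<omega>
    using j by (intro ext) (simp add: mixed_def shift_def sum.atLeast_Suc_lessThan)
  have "(\<integral>\<omega>. indicator G \<omega> * trace_pow n (mixed k (Suc j) (Suc j) \<omega>) (Suc k) \<partial>M)
    \<le> (\<integral>\<omega>. ?tr \<omega> + ?c * ?f1 \<omega> \<partial>M)"
  proof (rule integral_mono)
    show "indicator G \<omega> * trace_pow n (mixed k (Suc j) (Suc j) \<omega>) (Suc k) \<le> ?tr \<omega> + ?c * ?f1 \<omega>"
      if "\<omega> \<in> space M" for \<omega>
    proof (cases "\<omega> \<in> G")
      case True
      obtain q l where "eigenbasis n (?R \<omega>) q l" "\<And>i. i < n \<Longrightarrow> real (Suc k) \<le> l i"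
        unfolding mixed_def
        by (rule psd_shift_eigenbasis[OF mixed_psd[OF G True, of j "Suc j"], where c = "real (Suc k)"]) blast
      from trace_pow_rank_one_update[OF this v_inner_le[OF j that]] True show ?thesis
        by (simp add: up)
    qed simp
  qed (use ints in auto)
  also have "\<dots> = (\<integral>\<omega>. ?tr \<omega> + ?c * ?f2 \<omega> \<partial>M)"
    using ints integral_good_frob(1)[OF G j, of k "Suc j" k] by simp
  also have "\<dots> \<le> (\<integral>\<omega>. indicator G \<omega> * trace_pow n (mixed k j j \<omega>) (Suc k) \<partial>M)"
  proof (rule integral_mono)
    show "?tr \<omega> + ?c * ?f2 \<omega> \<le> indicator G \<omega> * trace_pow n (mixed k j j \<omega>) (Suc k)"
      if "\<omega> \<in> space M" for \<omega>
    proof (cases "\<omega> \<in> G")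
      case True
      have R: "psd_on n (?R \<omega>)" and S: "psd_on n (mixed k j j \<omega>)"
        unfolding mixed_def by (intro psd_shift mixed_psd[OF G True]; simp)+
      obtain q l where ql: "eigenbasis n (?R \<omega>) q l" "\<And>i. i < n \<Longrightarrow> 0 \<le> l i" by (rule psd_eigenbasis[OF R]) blast
      obtain q' c where qc: "eigenbasis n (mixed k j j \<omega>) q' c" "\<And>i. i < n \<Longrightarrow> 0 \<le> c i" by (rule psd_eigenbasis[OF S]) blast
      have "frob n (mixed k j j \<omega>) D - frob n (?R \<omega>) D = exp 1 * frob n (B j \<omega>) D" for D
        unfolding down frob_add frob_scale by simp
      then show ?thesis using trace_pow_tangent[OF ql qc, of k] True by (simp add: mult_ac)
    qed simp
  qed (use ints in auto)
  finally show ?thesis .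
qed

lemma integral_mixed_le:
  assumes G: "good G"
  shows "(\<integral>\<omega>. indicator G \<omega> * trace_pow n (mixed k N N \<omega>) (Suc k) \<partial>M)
    \<le> (\<integral>\<omega>. indicator G \<omega> * trace_pow n (mixed k 0 0 \<omega>) (Suc k) \<partial>M)"
proof -
  have "j \<le> N \<Longrightarrow> (\<integral>\<omega>. indicator G \<omega> * trace_pow n (mixed k j j \<omega>) (Suc k) \<partial>M)
    \<le> (\<integral>\<omega>. indicator G \<omega> * trace_pow n (mixed k 0 0 \<omega>) (Suc k) \<partial>M)" for j
  proof (induction j)
    case (Suc j)
    then show ?case using integral_mixed_step[OF G, of j k] by simp
  qed simp
  then show ?thesis by simp
qed

text \<open>The sum of the matrices \<open>exp 1 * B j\<close> has trace at most
  \<open>exp 1 * N\<close>, since each \<open>B j\<close> has trace at most 1, and eigenvalues at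
  most \<open>exp 1 * \<gamma>\<close>. These are the two inputs of
  \<open>trace_pow_shift_le\<close>.\<close>

lemma mixed_0_trace_le:
  assumes G: "good G" "\<omega> \<in> G" and \<gamma>: "0 \<le> \<gamma>"
    "\<And>x. (\<Sum>j<N. bilin n (B j \<omega>) x x) \<le> \<gamma> * inner_on n x x"
  shows "trace_pow n (mixed k 0 0 \<omega>) (Suc k) \<le> real n * real (Suc k) ^ Suc k
    + exp 1 * real N * (exp 1 * \<gamma> + real (Suc k)) ^ Suc k"
proof -
  let ?p = "real (Suc k)"
  define D where "D = (\<lambda>s t. \<Sum>j<N. exp 1 * B j \<omega> s t)"
  have D: "psd_on n D"
    unfolding D_def using G by (intro psd_sum psd_scale) (auto simp: good_def)
  obtain q g where g: "eigenbasis n D q g" "\<And>i. i < n \<Longrightarrow> 0 \<le> g i" by (rule psd_eigenbasis[OF D]) blast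
  have g2: "g i \<le> exp 1 * \<gamma>" if i: "i < n" for i
  proof -
    have "g i = exp 1 * (\<Sum>j<N. bilin n (B j \<omega>) (q i) (q i))"
      unfolding eigenbasis_eigenvalue[OF g(1) i] unfolding D_def
      by (simp add: bilin_sum bilin_scale sum_distrib_left)
    also have "\<dots> \<le> exp 1 * (\<gamma> * inner_on n (q i) (q i))" using \<gamma>(2) by simp
    finally show ?thesis using eigenbasis_orthonormal[OF g(1) i i] by simp
  qed
  have "(\<Sum>s<n. D s s) = exp 1 * (\<Sum>j<N. \<Sum>s<n. B j \<omega> s s)"
    unfolding D_def by (subst sum.swap) (simp add: sum_distrib_left)
  also have "\<dots> \<le> exp 1 * (\<Sum>j<N. 1)"
    using G by (intro mult_left_mono sum_mono) (auto simp: good_def)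
  finally have tr: "(\<Sum>s<n. D s s) \<le> exp 1 * real N" by simp
  have "mixed k 0 0 \<omega> = shift ?p D"
    by (intro ext) (simp add: mixed_def D_def shift_def lessThan_atLeast0)
  then have "trace_pow n (mixed k 0 0 \<omega>) (Suc k)
      \<le> real n * ?p ^ Suc k + ?p * (\<Sum>s<n. D s s) * (exp 1 * \<gamma> + ?p) ^ k"
    using trace_pow_shift_le[OF g(1,2) g2, of ?p k] by simp
  \<comment> \<open>The factor \<open>?p\<close> is enlarged to
    \<open>exp 1 * \<gamma> + ?p\<close>, which raises the exponent from \<open>k\<close> to
    \<open>Suc k\<close>.\<close>
  also have "?p * (\<Sum>s<n. D s s) * (exp 1 * \<gamma> + ?p) ^ k \<le> (exp 1 * \<gamma> + ?p) * (exp 1 * real N) * (exp 1 * \<gamma> + ?p) ^ k"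
  proof (intro mult_right_mono mult_mono tr)
    have "(\<Sum>s<n. D s s) = (\<Sum>i<n. g i)"
      using eigenbasis_trace_pow[OF g(1), of 1] by (simp add: trace_pow_def mult_delta_right sum.delta)
    then show "0 \<le> (\<Sum>s<n. D s s)" using g(2) by (auto intro!: sum_nonneg)
  qed (use \<gamma> in auto)
  finally show ?thesis by (simp add: mult_ac)
qed

text \<open>An eigenvalue above \<open>b\<close> would alone lift the trace by more than
  \<open>b ^ Suc k\<close> over its baseline.\<close>

lemma mixed_N_bilin_le:
  assumes b: "0 < b" and tr: "trace_pow n (mixed k N N \<omega>) (Suc k) < real n * real (Suc k) ^ Suc k + b ^ Suc k"
  shows "(\<Sum>j<N. (inner_on n (v j \<omega>) y)\<^sup>2) \<le> b * inner_on n y y"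
proof -
  define A where "A = (\<lambda>s t. \<Sum>j<N. outer (v j \<omega>) s t)"
  have "psd_on n A" unfolding A_def by (intro psd_sum psd_outer)
  then obtain q x where x: "eigenbasis n A q x" "\<And>i. i < n \<Longrightarrow> 0 \<le> x i" by (rule psd_eigenbasis) blast
  have eq: "mixed k N N \<omega> = shift (real (Suc k)) A"
    by (intro ext) (simp add: mixed_def A_def shift_def)
  have "x i \<le> b" if i: "i < n" for i
  proof -
    have "real n * real (Suc k) ^ Suc k + x i ^ Suc k \<le> trace_pow n (mixed k N N \<omega>) (Suc k)"
      unfolding eq by (rule trace_pow_shift_ge[OF x _ i]) auto
    then have "x i ^ Suc k < b ^ Suc k" using tr by linarith
    then show ?thesis using power_less_imp_less_base[of "x i" "Suc k" b] b by simp
  qed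
  then have "bilin n A y y \<le> b * inner_on n y y" by (rule eigenbasis_bilin_le[OF x(1)])
  then show ?thesis by (simp add: A_def bilin_sum bilin_outer power2_eq_square)
qed

text \<open>Makes the excess of the trace over its baseline nonnegative, as Markov's inequality
  requires.\<close>

lemma mixed_N_trace_ge: "real n * real (Suc k) ^ Suc k \<le> trace_pow n (mixed k N N \<omega>) (Suc k)"
proof -
  define A where "A = (\<lambda>s t. \<Sum>j<N. outer (v j \<omega>) s t)"
  have "psd_on n A" unfolding A_def by (intro psd_sum psd_outer)
  then obtain q x where x: "eigenbasis n A q x" "\<And>i. i < n \<Longrightarrow> 0 \<le> x i" by (rule psd_eigenbasis) blast
  have eq: "mixed k N N \<omega> = shift (real (Suc k)) A"
    by (intro ext) (simp add: mixed_def A_def shift_def)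
  have "trace_pow n (mixed k N N \<omega>) (Suc k) = (\<Sum>i<n. (x i + real (Suc k)) ^ Suc k)"
    unfolding eq by (rule eigenbasis_trace_pow[OF eigenbasis_shift[OF x(1)]])
  moreover have "(\<Sum>i<n. real (Suc k) ^ Suc k) \<le> (\<Sum>i<n. (x i + real (Suc k)) ^ Suc k)"
    using x(2) by (intro sum_mono power_mono) auto
  ultimately show ?thesis by simp
qed

text \<open>Markov's inequality for the excess of the trace over its baseline. Because the trace
  controls all eigenvalues at once, a single exceptional set serves every vector
  \<open>y\<close>.\<close>

theorem matrix_chernoff:
  assumes G: "good G" and M1: "measure M (space M) \<le> 1" and \<gamma>: "0 \<le> \<gamma>"
    "\<And>\<omega> x. \<omega> \<in> G \<Longrightarrow> (\<Sum>j<N. bilin n (B j \<omega>) x x) \<le> \<gamma> * inner_on n x x"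
    and b: "0 < b"
  obtains Bad where "Bad \<in> sets M"
    "measure M Bad \<le> exp 1 * real N * ((exp 1 * \<gamma> + real (Suc k)) / b) ^ Suc k"
    "\<And>\<omega> y. \<omega> \<in> G - Bad \<Longrightarrow> (\<Sum>j<N. (inner_on n (v j \<omega>) y)\<^sup>2) \<le> b * inner_on n y y"
proof -
  define c where "c = real n * real (Suc k) ^ Suc k"
  define K where "K = exp 1 * real N * (exp 1 * \<gamma> + real (Suc k)) ^ Suc k"
  have K0: "0 \<le> K" unfolding K_def using \<gamma>(1) by (intro mult_nonneg_nonneg zero_le_power) auto
  have GM: "G \<in> sets M" using G sets_F by (auto simp: good_def)
  \<comment> \<open>The baseline \<open>c\<close> is subtracted before Markov's inequality is
    applied; otherwise the dimension \<open>n\<close> would enter the probability bound.\<close>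
  define f where "f \<omega> = indicator G \<omega> * trace_pow n (mixed k N N \<omega>) (Suc k) - indicator G \<omega> * c" for \<omega>
  have Gi: "integrable M (\<lambda>\<omega>. indicator G \<omega> * a)" for a :: real
    using integrable_real_indicator[of G M] GM by (simp add: less_top[symmetric])
  have fi: "integrable M f"
    unfolding f_def[abs_def] by (intro Bochner_Integration.integrable_diff integrable_good_trace[OF G] Gi) simp
  have "(\<integral>\<omega>. indicator G \<omega> * trace_pow n (mixed k 0 0 \<omega>) (Suc k) \<partial>M) \<le> (\<integral>\<omega>. indicator G \<omega> * (c + K) \<partial>M)"
  proof (rule integral_mono)
    show "integrable M (\<lambda>\<omega>. indicator G \<omega> * trace_pow n (mixed k 0 0 \<omega>) (Suc k))"
      by (rule integrable_good_trace[OF G]) simp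
    show "indicator G \<omega> * trace_pow n (mixed k 0 0 \<omega>) (Suc k) \<le> indicator G \<omega> * (c + K)" for \<omega>
      using mixed_0_trace_le[OF G _ \<gamma>, of \<omega> k] by (auto simp: c_def K_def indicator_def)
  qed (rule Gi)
  also have "\<dots> = (\<integral>\<omega>. indicator G \<omega> * c \<partial>M) + (\<integral>\<omega>. indicator G \<omega> * K \<partial>M)"
    using Gi by (simp add: distrib_left)
  also have "(\<integral>\<omega>. indicator G \<omega> * K \<partial>M) \<le> K"
  proof -
    have "measure M G \<le> 1" using bounded_measure[of G] M1 by linarith
    then show ?thesis using K0 GM by (simp add: mult_left_le_one_le)
  qed
  finally have le0: "(\<integral>\<omega>. indicator G \<omega> * trace_pow n (mixed k 0 0 \<omega>) (Suc k) \<partial>M) \<le> (\<integral>\<omega>. indicator G \<omega> * c \<partial>M) + K"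
    by simp
  have "(\<integral>\<omega>. f \<omega> \<partial>M) = (\<integral>\<omega>. indicator G \<omega> * trace_pow n (mixed k N N \<omega>) (Suc k) \<partial>M) - (\<integral>\<omega>. indicator G \<omega> * c \<partial>M)"
    unfolding f_def by (intro Bochner_Integration.integral_diff integrable_good_trace[OF G] Gi) simp
  then have fK: "(\<integral>\<omega>. f \<omega> \<partial>M) \<le> K" using le0 integral_mixed_le[OF G, of k] by linarith
  have f0: "0 \<le> f \<omega>" for \<omega>
    using mixed_N_trace_ge[of k \<omega>] by (auto simp: f_def c_def indicator_def)
  have bp: "0 < b ^ Suc k" using b by simp
  define Bad where "Bad = {\<omega> \<in> space M. b ^ Suc k \<le> f \<omega>}"
  have "measure M Bad \<le> (\<integral>\<omega>. f \<omega> \<partial>M) / b ^ Suc k"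
    unfolding Bad_def by (rule integral_Markov_inequality_measure[OF fi, of "{}"]) (use f0 bp in auto)
  also have "\<dots> \<le> K / b ^ Suc k" using fK bp by (intro divide_right_mono) auto
  finally have "measure M Bad \<le> exp 1 * real N * ((exp 1 * \<gamma> + real (Suc k)) / b) ^ Suc k"
    by (simp only: K_def power_divide times_divide_eq_right)
  moreover have "Bad \<in> sets M" unfolding Bad_def using borel_measurable_integrable[OF fi] by measurable
  moreover have "(\<Sum>j<N. (inner_on n (v j \<omega>) y)\<^sup>2) \<le> b * inner_on n y y" if "\<omega> \<in> G - Bad" for \<omega> y
  proof (rule mixed_N_bilin_le[OF b])
    have "\<omega> \<in> space M" using that sets.sets_into_space[OF GM] by auto
    then have "f \<omega> < b ^ Suc k" using that by (auto simp: Bad_def)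
    then show "trace_pow n (mixed k N N \<omega>) (Suc k) < real n * real (Suc k) ^ Suc k + b ^ Suc k"
      using that by (simp add: f_def c_def)
  qed
  ultimately show ?thesis using that by blast
qed

end

subsection \<open>Duality of nuclear and spectral norm\<close>

lemma set_sum_mset_singletons: "set_mset (\<Sum>i<(n::nat). {#f i#}) = f ` {..<n}"
  by (induction n) (auto simp: lessThan_Suc)

lemma image_sum_mset_singletons: "sum_mset (image_mset f (\<Sum>i<(n::nat). {#l i#})) = (\<Sum>i<n. f (l i))"
  by (induction n) (auto simp: add.commute)

text \<open>\<open>q\<close> consists of right singular vectors of \<open>A\<close>, and
  \<open>l i\<close> is the squared length of \<open>A\<close> applied to \<open>q i\<close>; the
  inner products with the rows are the coordinates of that image.\<close>

lemma singular_values_eigenbasis: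
  assumes A: "A \<in> carrier_mat m n"
  obtains q l where
    "eigenbasis n (\<lambda>s t. \<Sum>j<m. A $$ (j,s) * A $$ (j,t)) q l"
    "\<And>i. i < n \<Longrightarrow> l i = (\<Sum>j<m. (inner_on n (q i) (\<lambda>t. A $$ (j,t)))\<^sup>2)"
    "singular_values A = image_mset sqrt (\<Sum>i<n. {#l i#})"
proof -
  let ?C = "transpose_mat A * A"
  have C: "?C \<in> carrier_mat n n" using A by simp
  have sym: "transpose_mat ?C = ?C"
    using transpose_mult[of "transpose_mat A" n m A n] A by simp
  obtain q l where ql: "eigenbasis n (\<lambda>s t. ?C $$ (s,t)) q l" "char_poly ?C = (\<Prod>i<n. [:- l i, 1:])"
    by (rule eigenbasis_mat[OF C sym])
  have ent: "?C $$ (s,t) = (\<Sum>j<m. A $$ (j,s) * A $$ (j,t))" if "s < n" "t < n" for s t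
    using that A by (simp add: scalar_prod_def lessThan_atLeast0)
  have eb: "eigenbasis n (\<lambda>s t. \<Sum>j<m. A $$ (j,s) * A $$ (j,t)) q l"
    using ql(1) ent unfolding eigenbasis_def by simp
  have "bilin n (\<lambda>s t. \<Sum>j<m. A $$ (j,s) * A $$ (j,t)) x x = (\<Sum>j<m. (inner_on n x (\<lambda>t. A $$ (j,t)))\<^sup>2)" for x
    using bilin_sum[of n "\<lambda>j. outer (\<lambda>t. A $$ (j,t))" "{..<m}" x x]
    by (simp add: bilin_outer inner_on_commute[of n x] power2_eq_square) (simp add: outer_def)
  then have l: "l i = (\<Sum>j<m. (inner_on n (q i) (\<lambda>t. A $$ (j,t)))\<^sup>2)" if "i < n" for i
    using eigenbasis_eigenvalue[OF eb that] by simp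
  have "proots (\<Prod>i<n. [:- l i, 1:]) = (\<Sum>i<n. {#l i#})"
    by (subst proots_prod) auto
  then show ?thesis using that[OF eb l] ql(2) unfolding singular_values_def by simp
qed

text \<open>The rows are expanded in the right singular vectors of \<open>A\<close>. For each of
  them Cauchy-Schwarz over the rows gives the length of its image under \<open>U\<close>, at most
  \<sigma>, times the singular value. The bound on \<open>U\<close> is kept in quadratic form, the
  form in which the probabilistic argument delivers it.\<close>

lemma nuclear_norm_duality:
  assumes A: "A \<in> carrier_mat m n"
    and U: "\<And>y. (\<Sum>j<m. (inner_on n (\<lambda>t. U $$ (j,t)) y)\<^sup>2) \<le> \<sigma>\<^sup>2 * inner_on n y y" and \<sigma>: "0 \<le> \<sigma>"
  shows "\<bar>\<Sum>t<n. \<Sum>j<m. U $$ (j,t) * A $$ (j,t)\<bar> \<le> \<sigma> * nuclear_norm A"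
proof -
  obtain q l where eb: "eigenbasis n (\<lambda>s t. \<Sum>j<m. A $$ (j,s) * A $$ (j,t)) q l"
    and l: "\<And>i. i < n \<Longrightarrow> l i = (\<Sum>j<m. (inner_on n (q i) (\<lambda>t. A $$ (j,t)))\<^sup>2)"
    and sv: "singular_values A = image_mset sqrt (\<Sum>i<n. {#l i#})"
    by (rule singular_values_eigenbasis[OF A]) blast
  define a where "a i j = inner_on n (q i) (\<lambda>t. A $$ (j,t))" for i j
  define b where "b i j = inner_on n (q i) (\<lambda>t. U $$ (j,t))" for i j
  have "(\<Sum>t<n. \<Sum>j<m. U $$ (j,t) * A $$ (j,t)) = (\<Sum>j<m. inner_on n (\<lambda>t. U $$ (j,t)) (\<lambda>t. A $$ (j,t)))"
    by (simp only: inner_on_def, rule sum.swap)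
  also have "\<dots> = (\<Sum>j<m. \<Sum>i<n. b i j * a i j)"
    by (simp only: a_def b_def eigenbasis_parseval[OF eb])
  also have "\<dots> = (\<Sum>i<n. \<Sum>j<m. b i j * a i j)" by (rule sum.swap)
  finally have eq: "(\<Sum>t<n. \<Sum>j<m. U $$ (j,t) * A $$ (j,t)) = (\<Sum>i<n. \<Sum>j<m. b i j * a i j)" .
  have each: "\<bar>\<Sum>j<m. b i j * a i j\<bar> \<le> \<sigma> * sqrt (l i)" if i: "i < n" for i
  proof -
    have "b i j = inner_on n (\<lambda>t. U $$ (j,t)) (q i)" for j by (simp only: b_def inner_on_commute[of n "q i"])
    then have "(\<Sum>j<m. (b i j)\<^sup>2) \<le> \<sigma>\<^sup>2"
      using U[of "q i"] eigenbasis_orthonormal[OF eb i i] by simp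
    then have "(\<Sum>j<m. (b i j)\<^sup>2) * (\<Sum>j<m. (a i j)\<^sup>2) \<le> \<sigma>\<^sup>2 * l i"
      unfolding l[OF i] a_def by (intro mult_right_mono) (auto intro: sum_nonneg)
    then have "(\<Sum>j<m. b i j * a i j)\<^sup>2 \<le> \<sigma>\<^sup>2 * l i"
      using Cauchy_Schwarz_ineq_sum[of "b i" "a i" "{..<m}"] by linarith
    then have "sqrt ((\<Sum>j<m. b i j * a i j)\<^sup>2) \<le> sqrt (\<sigma>\<^sup>2 * l i)" by (rule real_sqrt_le_mono)
    then show ?thesis using \<sigma> by (simp add: real_sqrt_mult)
  qed
  have "\<bar>\<Sum>i<n. \<Sum>j<m. b i j * a i j\<bar> \<le> (\<Sum>i<n. \<bar>\<Sum>j<m. b i j * a i j\<bar>)" by (rule sum_abs)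
  also have "\<dots> \<le> (\<Sum>i<n. \<sigma> * sqrt (l i))" using each by (intro sum_mono) simp
  also have "\<dots> = \<sigma> * nuclear_norm A"
    unfolding nuclear_norm_def sv image_sum_mset_singletons by (simp add: sum_distrib_left)
  finally show ?thesis unfolding eq .
qed

lemma spectral_norm_nonneg: "0 \<le> spectral_norm A"
  unfolding spectral_norm_def by (rule Max_ge) auto

text \<open>By Cauchy-Schwarz the form is at most the length of \<open>x\<close> times that of its
  image under \<open>S\<close>, and the latter is governed by the Gram matrix, whose eigenvalues are
  the squared singular values.\<close>

lemma bilin_le_spectral_norm:
  assumes S: "S \<in> carrier_mat n n"
  shows "bilin n (\<lambda>s t. S $$ (s,t)) x x \<le> spectral_norm S * inner_on n x x"
proof -
  let ?\<sigma> = "spectral_norm S"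
  obtain q l where eb: "eigenbasis n (\<lambda>s t. \<Sum>j<n. S $$ (j,s) * S $$ (j,t)) q l"
    and l: "\<And>i. i < n \<Longrightarrow> l i = (\<Sum>j<n. (inner_on n (q i) (\<lambda>t. S $$ (j,t)))\<^sup>2)"
    and sv: "singular_values S = image_mset sqrt (\<Sum>i<n. {#l i#})"
    by (rule singular_values_eigenbasis[OF S]) blast
  have "l i \<le> ?\<sigma>\<^sup>2" if i: "i < n" for i
  proof -
    have "sqrt (l i) \<le> ?\<sigma>"
      unfolding spectral_norm_def sv using i by (intro Max_ge) (auto simp: set_sum_mset_singletons)
    moreover have "0 \<le> l i" unfolding l[OF i] by (intro sum_nonneg) simp
    ultimately show ?thesis by (metis real_sqrt_ge_zero power_mono real_sqrt_pow2)
  qed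
  then have "bilin n (\<lambda>s t. \<Sum>j<n. S $$ (j,s) * S $$ (j,t)) x x \<le> ?\<sigma>\<^sup>2 * inner_on n x x"
    by (rule eigenbasis_bilin_le[OF eb])
  moreover have "bilin n (\<lambda>s t. \<Sum>j<n. S $$ (j,s) * S $$ (j,t)) x x = (\<Sum>j<n. (inner_on n (\<lambda>t. S $$ (j,t)) x)\<^sup>2)"
    using bilin_sum[of n "\<lambda>j. outer (\<lambda>t. S $$ (j,t))" "{..<n}" x x]
    by (simp add: bilin_outer power2_eq_square) (simp add: outer_def)
  ultimately have Sx: "(\<Sum>j<n. (inner_on n (\<lambda>t. S $$ (j,t)) x)\<^sup>2) \<le> ?\<sigma>\<^sup>2 * inner_on n x x" by simp
  have "bilin n (\<lambda>s t. S $$ (s,t)) x x = (\<Sum>s<n. x s * inner_on n (\<lambda>t. S $$ (s,t)) x)"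
    by (simp add: bilin_def inner_on_def sum_distrib_left mult.assoc)
  moreover have "(\<Sum>s<n. x s * inner_on n (\<lambda>t. S $$ (s,t)) x)\<^sup>2
      \<le> (\<Sum>s<n. (x s)\<^sup>2) * (\<Sum>s<n. (inner_on n (\<lambda>t. S $$ (s,t)) x)\<^sup>2)"
    by (rule Cauchy_Schwarz_ineq_sum)
  moreover have "(\<Sum>s<n. (x s)\<^sup>2) = inner_on n x x" by (simp add: inner_on_def power2_eq_square)
  moreover have "inner_on n x x * (\<Sum>s<n. (inner_on n (\<lambda>t. S $$ (s,t)) x)\<^sup>2)
      \<le> inner_on n x x * (?\<sigma>\<^sup>2 * inner_on n x x)"
    by (rule mult_left_mono[OF Sx inner_on_nonneg])
  ultimately have "(bilin n (\<lambda>s t. S $$ (s,t)) x x)\<^sup>2 \<le> (?\<sigma> * inner_on n x x)\<^sup>2"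
    by (simp add: power2_eq_square mult_ac)
  then show ?thesis
    by (rule power2_le_imp_le) (simp add: spectral_norm_nonneg inner_on_nonneg)
qed

text \<open>Duality is applied to \<open>B\<close> and to \<open>M\<close> separately, each with
  nuclear norm at most \<open>K\<close>, which avoids the triangle inequality for the nuclear norm
  of their difference. The two cross terms carry a factor 2 each, hence the constant 4.\<close>

lemma nuclear_ls_error_bound:
  assumes M: "M \<in> carrier_mat N T" and U: "U \<in> carrier_mat N T"
    and K: "nuclear_norm M \<le> K"
    and ls: "nuclear_ls_estimate N T K (M + U) B"
    and op: "\<And>y. (\<Sum>j<N. (inner_on T (\<lambda>t. U $$ (j,t)) y)\<^sup>2) \<le> \<sigma>\<^sup>2 * inner_on T y y" and \<sigma>: "0 \<le> \<sigma>"
  shows "(\<Sum>t<T. \<Sum>j<N. (B $$ (j,t) - M $$ (j,t))\<^sup>2) \<le> 4 * \<sigma> * K"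
proof -
  have B: "B \<in> carrier_mat N T" and KB: "nuclear_norm B \<le> K"
    and min: "sq_loss N T (M + U) B \<le> sq_loss N T (M + U) M"
    using ls M K unfolding nuclear_ls_estimate_def is_arg_min_def by (auto simp: not_less)
  have entry: "((M + U) $$ (j,t) - B $$ (j,t))\<^sup>2 = (U $$ (j,t))\<^sup>2 + (B $$ (j,t) - M $$ (j,t))\<^sup>2
      - 2 * (U $$ (j,t) * B $$ (j,t)) + 2 * (U $$ (j,t) * M $$ (j,t))" if "t < T" "j < N" for j t
    using that M U by (simp add: power2_eq_square algebra_simps)
  have "sq_loss N T (M + U) B = (\<Sum>t<T. \<Sum>j<N. (U $$ (j,t))\<^sup>2 + (B $$ (j,t) - M $$ (j,t))\<^sup>2
      - 2 * (U $$ (j,t) * B $$ (j,t)) + 2 * (U $$ (j,t) * M $$ (j,t)))"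
    unfolding sq_loss_def by (intro sum.cong refl entry) auto
  also have "\<dots> = (\<Sum>t<T. \<Sum>j<N. (U $$ (j,t))\<^sup>2) + (\<Sum>t<T. \<Sum>j<N. (B $$ (j,t) - M $$ (j,t))\<^sup>2)
      - 2 * (\<Sum>t<T. \<Sum>j<N. U $$ (j,t) * B $$ (j,t)) + 2 * (\<Sum>t<T. \<Sum>j<N. U $$ (j,t) * M $$ (j,t))"
    by (simp only: sum.distrib sum_subtractf sum_distrib_left)
  finally have lB: "sq_loss N T (M + U) B = \<dots>" .
  have "sq_loss N T (M + U) M = (\<Sum>t<T. \<Sum>j<N. (U $$ (j,t))\<^sup>2)"
    unfolding sq_loss_def using M U by (intro sum.cong refl) auto
  then have "(\<Sum>t<T. \<Sum>j<N. (B $$ (j,t) - M $$ (j,t))\<^sup>2)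
      \<le> 2 * (\<Sum>t<T. \<Sum>j<N. U $$ (j,t) * B $$ (j,t)) - 2 * (\<Sum>t<T. \<Sum>j<N. U $$ (j,t) * M $$ (j,t))"
    using min lB by linarith
  moreover have "\<bar>\<Sum>t<T. \<Sum>j<N. U $$ (j,t) * B $$ (j,t)\<bar> \<le> \<sigma> * K"
    using nuclear_norm_duality[OF B op \<sigma>] mult_left_mono[OF KB \<sigma>] by linarith
  moreover have "\<bar>\<Sum>t<T. \<Sum>j<N. U $$ (j,t) * M $$ (j,t)\<bar> \<le> \<sigma> * K"
    using nuclear_norm_duality[OF M op \<sigma>] mult_left_mono[OF K \<sigma>] by linarith
  ultimately show ?thesis by linarith
qed

subsection \<open>The operator norm of a matrix with conditionally independent rows\<close>

text \<open>Countably many vectors suffice to express that a matrix of conditional expectations is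
  positive semidefinite almost everywhere.\<close>

definition rat_vec :: "rat list \<Rightarrow> nat \<Rightarrow> real" where
  "rat_vec xs s = (if s < length xs then of_rat (xs ! s) else 0)"

text \<open>Lists of rationals form a countable type, so almost sure statements about the vectors
  \<open>rat_vec xs\<close> can be combined; density then carries them to all vectors.\<close>

lemma rat_vec_dense:
  obtains f :: "nat \<Rightarrow> rat list" where "\<And>s. s < n \<Longrightarrow> (\<lambda>m. rat_vec (f m) s) \<longlonglongrightarrow> x s"
proof -
  have "\<exists>r. x s < of_rat r \<and> of_rat r < x s + inverse (real (Suc m))" for s m
    by (rule of_rat_dense) simp
  then have "\<exists>r. \<forall>s m. x s < real_of_rat (r s m) \<and> real_of_rat (r s m) < x s + inverse (real (Suc m))"
    by (intro choice allI) blast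
  then obtain r where r: "\<And>s m. x s < of_rat (r s m)" "\<And>s m. of_rat (r s m) < x s + inverse (real (Suc m))"
    by blast
  have lim: "(\<lambda>m. real_of_rat (r s m)) \<longlonglongrightarrow> x s" for s
  proof (rule tendsto_sandwich[where f = "\<lambda>_. x s" and h = "\<lambda>m. x s + inverse (real (Suc m))"])
    show "(\<lambda>m. x s + inverse (real (Suc m))) \<longlonglongrightarrow> x s"
      using tendsto_add[OF tendsto_const LIMSEQ_inverse_real_of_nat, of "x s"] by simp
    show "\<forall>\<^sub>F m in sequentially. x s \<le> of_rat (r s m)" using r(1) by (simp add: less_imp_le)
    show "\<forall>\<^sub>F m in sequentially. of_rat (r s m) \<le> x s + inverse (real (Suc m))" using r(2) by (simp add: less_imp_le)
  qed simp
  show ?thesis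
  proof (rule that[of "\<lambda>m. map (\<lambda>s. r s m) [0..<n]"])
    fix s assume "s < n"
    then show "(\<lambda>m. rat_vec (map (\<lambda>s. r s m) [0..<n]) s) \<longlonglongrightarrow> x s"
      using lim by (simp add: rat_vec_def)
  qed
qed

lemma bilin_le_of_rat:
  assumes "\<And>xs. bilin n A (rat_vec xs) (rat_vec xs) \<le> c * inner_on n (rat_vec xs) (rat_vec xs)"
  shows "bilin n A x x \<le> c * inner_on n x x"
proof -
  obtain f :: "nat \<Rightarrow> rat list" where f: "\<And>s. s < n \<Longrightarrow> (\<lambda>m. rat_vec (f m) s) \<longlonglongrightarrow> x s"
    by (rule rat_vec_dense[of n x]) blast
  have 1: "(\<lambda>m. bilin n A (rat_vec (f m)) (rat_vec (f m))) \<longlonglongrightarrow> bilin n A x x"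
    unfolding bilin_def using f by (auto intro!: tendsto_intros)
  have 2: "(\<lambda>m. c * inner_on n (rat_vec (f m)) (rat_vec (f m))) \<longlonglongrightarrow> c * inner_on n x x"
    unfolding inner_on_def using f by (auto intro!: tendsto_intros)
  show ?thesis by (rule LIMSEQ_le[OF 1 2]) (use assms in auto)
qed

lemma bilin_nonneg_of_rat:
  assumes "\<And>xs. 0 \<le> bilin n A (rat_vec xs) (rat_vec xs)"
  shows "0 \<le> bilin n A x x"
proof -
  have "bilin n (\<lambda>s t. (- 1) * A s t) x x \<le> 0 * inner_on n x x"
    by (rule bilin_le_of_rat, subst bilin_scale) (use assms in simp)
  then show ?thesis unfolding bilin_scale by simp
qed

text \<open>For \<open>a > h\<close>, write \<open>a\<close> as
  \<open>a powr (1 - \<kappa>) * a powr \<kappa>\<close> and use that the first factor decreases in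
  \<open>a\<close>. The lemma passes from squares to moments of order \<open>2 * \<kappa>\<close>,
  with a free threshold \<open>h\<close>.\<close>

lemma le_add_powr:
  fixes a h \<kappa> :: real
  assumes a: "0 \<le> a" and h: "0 < h" and \<kappa>: "1 < \<kappa>"
  shows "a \<le> h + h powr (1 - \<kappa>) * a powr \<kappa>"
proof (cases "a \<le> h")
  case True
  then show ?thesis by (simp add: add_increasing2)
next
  case False
  then have "a = a powr (1 - \<kappa>) * a powr \<kappa>" using h by (simp add: powr_add[symmetric])
  also have "\<dots> \<le> h powr (1 - \<kappa>) * a powr \<kappa>"
    using False h \<kappa> by (intro mult_right_mono powr_mono2') auto
  finally show ?thesis using h by simp
qed

context finite_measure_subalgebra
begin

lemma real_cond_exp_sum_on:
  fixes f :: "'i \<Rightarrow> 'a \<Rightarrow> real"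
  assumes "\<And>i. i \<in> I \<Longrightarrow> integrable M (f i)"
  shows "AE x in M. real_cond_exp M F (\<lambda>x. \<Sum>i\<in>I. f i x) x = (\<Sum>i\<in>I. real_cond_exp M F (f i) x)"
proof -
  define g where "g i = (if i \<in> I then f i else (\<lambda>_. 0))" for i
  have "AE x in M. real_cond_exp M F (\<lambda>x. \<Sum>i\<in>I. g i x) x = (\<Sum>i\<in>I. real_cond_exp M F (g i) x)"
    by (rule real_cond_exp_sum) (use assms in \<open>simp add: g_def\<close>)
  then show ?thesis by (simp add: g_def cong: sum.cong)
qed

lemma real_cond_exp_bilin:
  assumes int: "\<And>s t. s < n \<Longrightarrow> t < n \<Longrightarrow> integrable M (\<lambda>\<omega>. f \<omega> s t)"
  shows "AE \<omega> in M. real_cond_exp M F (\<lambda>\<omega>. bilin n (f \<omega>) x x) \<omega>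
    = bilin n (\<lambda>s t. real_cond_exp M F (\<lambda>\<omega>. f \<omega> s t) \<omega>) x x"
proof -
  define I where "I = {..<n} \<times> {..<n}"
  have bil: "bilin n A x x = (\<Sum>i\<in>I. (x (fst i) * x (snd i)) * A (fst i) (snd i))" for A
    unfolding I_def by (simp add: bilin_def sum.cartesian_product' mult_ac)
  have intI: "integrable M (\<lambda>\<omega>. f \<omega> (fst i) (snd i))" if "i \<in> I" for i
    using int that by (auto simp: I_def)
  have bil': "bilin n (f \<omega>) x x = (\<Sum>i\<in>I. (x (fst i) * x (snd i)) * f \<omega> (fst i) (snd i))" for \<omega>
    by (rule bil)
  have "AE \<omega> in M. real_cond_exp M F (\<lambda>\<omega>. \<Sum>i\<in>I. (x (fst i) * x (snd i)) * f \<omega> (fst i) (snd i)) \<omega>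
      = (\<Sum>i\<in>I. real_cond_exp M F (\<lambda>\<omega>. (x (fst i) * x (snd i)) * f \<omega> (fst i) (snd i)) \<omega>)"
    by (rule real_cond_exp_sum_on) (use intI in auto)
  moreover have "AE \<omega> in M. \<forall>i\<in>I. real_cond_exp M F (\<lambda>\<omega>. (x (fst i) * x (snd i)) * f \<omega> (fst i) (snd i)) \<omega>
      = (x (fst i) * x (snd i)) * real_cond_exp M F (\<lambda>\<omega>. f \<omega> (fst i) (snd i)) \<omega>"
    by (rule AE_finite_allI) (auto simp: I_def intro!: real_cond_exp_cmult int)
  ultimately show ?thesis unfolding bil by eventually_elim simp
qed

end

lemma bilin_cong:
  "(\<And>s t. s < n \<Longrightarrow> t < n \<Longrightarrow> A s t = C s t) \<Longrightarrow> bilin n A x y = bilin n C x y"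
  unfolding bilin_def by (intro sum.cong refl) auto

lemma ennreal_divide_le_imp_le_mult:
  fixes a c :: ennreal
  assumes "a / of_nat T \<le> c" "0 < T"
  shows "a \<le> c * of_nat T"
proof -
  have "a = a * (of_nat T / of_nat T)" using assms(2) of_nat_less_top[of T] by (subst ennreal_divide_self) auto
  also have "\<dots> = a / of_nat T * of_nat T" by (metis ennreal_times_divide mult.commute)
  also have "\<dots> \<le> c * of_nat T" by (rule mult_right_mono[OF assms(1)]) simp
  finally show ?thesis .
qed

text \<open>\<open>L\<close> is the truncation level for squared row lengths, \<open>C1\<close> the
  level for the conditional moment, and \<open>F\<close> stands for the sigma-algebra generated by
  \<open>M\<close>.\<close>

locale row_truncation = prob_space P + finite_measure_subalgebra P F for P :: "'a measure" and F +
  fixes u :: "'a \<Rightarrow> real mat" and N T :: nat and \<kappa> L C1 :: real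
  assumes u_rm: "random_matrix P N T u"
    and ci_rows: "cond_indep_vars P F (\<lambda>_. \<Pi>\<^sub>M t\<in>{..<T}. borel) (matrix_row T u) {..<N}"
    and N_pos: "0 < N" and T_pos: "0 < T" and \<kappa>: "1 < \<kappa>" and L_pos: "0 < L" and C1: "0 \<le> C1"
begin

text \<open>Long rows become 0 and the others are divided by \<open>sqrt L\<close>. In both cases
  \<open>L\<close> times the outer product of the result lies below that of the row as a quadratic
  form.\<close>

definition trunc :: "nat \<Rightarrow> (nat \<Rightarrow> real) \<Rightarrow> nat \<Rightarrow> real" where
  "trunc j x s = (if inner_on T x x \<le> L then x s / sqrt L else 0)"

definition row :: "nat \<Rightarrow> 'a \<Rightarrow> nat \<Rightarrow> real" where
  "row j \<omega> t = u \<omega> $$ (j, t)"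

definition moment :: "'a \<Rightarrow> ennreal" where
  "moment = max_cond_moment P F N T (2 * \<kappa>) u"

definition G0 :: "'a set" where
  "G0 = {\<omega> \<in> space P. moment \<omega> \<le> ennreal C1}"

lemma row_meas: "j < N \<Longrightarrow> t < T \<Longrightarrow> (\<lambda>\<omega>. row j \<omega> t) \<in> borel_measurable P"
  using u_rm by (simp add: random_matrix_def row_def)

sublocale cond_indep_rank_one P F "\<lambda>_. \<Pi>\<^sub>M t\<in>{..<T}. borel" "matrix_row T u" N T trunc
proof unfold_locales
  show "cond_indep_vars P F (\<lambda>_. \<Pi>\<^sub>M t\<in>{..<T}. borel) (matrix_row T u) {..<N}" by (rule ci_rows)
next
  fix j s assume s: "s < T"
  have comp: "(\<lambda>x. x t) \<in> borel_measurable (\<Pi>\<^sub>M t\<in>{..<T}. borel)" if "t < T" for t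
    using measurable_component_singleton[of t "{..<T}" "\<lambda>_. borel"] that by simp
  have [measurable]: "(\<lambda>x. inner_on T x x) \<in> borel_measurable (\<Pi>\<^sub>M t\<in>{..<T}. borel)"
    unfolding inner_on_def by (intro borel_measurable_sum borel_measurable_times comp) auto
  note comp[OF s, measurable]
  show "(\<lambda>x. trunc j x s) \<in> borel_measurable (\<Pi>\<^sub>M t\<in>{..<T}. borel)"
    unfolding trunc_def by measurable
next
  fix j and x :: "nat \<Rightarrow> real"
  show "inner_on T (trunc j x) (trunc j x) \<le> 1"
  proof (cases "inner_on T x x \<le> L")
    case True
    have "inner_on T (trunc j x) (trunc j x) = inner_on T x x / L"
      using True L_pos by (simp add: inner_on_def trunc_def sum_divide_distrib)
    then show ?thesis using True L_pos by simp
  next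
    case False
    then show ?thesis by (simp add: inner_on_def trunc_def)
  qed
qed

lemma v_eq:
  assumes "t < T"
  shows "v j \<omega> t = (if inner_on T (row j \<omega>) (row j \<omega>) \<le> L then row j \<omega> t / sqrt L else 0)"
proof -
  have "inner_on T (matrix_row T u j \<omega>) (matrix_row T u j \<omega>) = inner_on T (row j \<omega>) (row j \<omega>)"
    by (simp add: inner_on_def matrix_row_def row_def)
  then show ?thesis using assms by (simp add: v_def trunc_def matrix_row_def row_def)
qed

lemma inner_v:
  "inner_on T (v j \<omega>) x = (if inner_on T (row j \<omega>) (row j \<omega>) \<le> L then inner_on T (row j \<omega>) x / sqrt L else 0)"
  by (simp add: inner_on_def v_eq sum_divide_distrib)

section \<open>Conditional second moments of the truncated rows\<close>

lemma vv_integrable: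
  assumes "j < N" "s < T" "t < T"
  shows "integrable P (\<lambda>\<omega>. v j \<omega> s * v j \<omega> t)"
  by (rule integrable_const_bound[of _ 1])
    (use prod_entry_bound[OF assms(1) cond_indep_space[OF ci assms(1)] assms(2,3)] v_meas assms in \<open>auto simp: v_def\<close>)

text \<open>The exceptional null set depends on \<open>x\<close>, so the claim is made for one
  vector at a time and later combined over countably many.\<close>

lemma bilin_B_nonneg:
  assumes j: "j < N"
  shows "AE \<omega> in P. 0 \<le> bilin T (B j \<omega>) x x"
proof -
  have "AE \<omega> in P. 0 \<le> real_cond_exp P F (\<lambda>\<omega>. bilin T (\<lambda>s t. v j \<omega> s * v j \<omega> t) x x) \<omega>"
  proof (rule real_cond_exp_pos)
    show "AE \<omega> in P. 0 \<le> bilin T (\<lambda>s t. v j \<omega> s * v j \<omega> t) x x"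
      using bilin_outer[of T _ x x] by (simp add: outer_def[abs_def])
    show "(\<lambda>\<omega>. bilin T (\<lambda>s t. v j \<omega> s * v j \<omega> t) x x) \<in> borel_measurable P"
      unfolding bilin_def using v_meas[OF j] by (intro borel_measurable_sum borel_measurable_times) auto
  qed
  moreover have "AE \<omega> in P. real_cond_exp P F (\<lambda>\<omega>. bilin T (\<lambda>s t. v j \<omega> s * v j \<omega> t) x x) \<omega>
      = bilin T (\<lambda>s t. real_cond_exp P F (\<lambda>\<omega>. v j \<omega> s * v j \<omega> t) \<omega>) x x"
    by (rule real_cond_exp_bilin) (rule vv_integrable[OF j])
  ultimately show ?thesis by eventually_elim (simp add: B_def[abs_def])
qed

lemma trace_B_le:
  assumes j: "j < N"
  shows "AE \<omega> in P. (\<Sum>s<T. B j \<omega> s s) \<le> 1"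
proof -
  have "AE \<omega> in P. real_cond_exp P F (\<lambda>\<omega>. \<Sum>s<T. v j \<omega> s * v j \<omega> s) \<omega>
      = (\<Sum>s<T. real_cond_exp P F (\<lambda>\<omega>. v j \<omega> s * v j \<omega> s) \<omega>)"
    by (rule real_cond_exp_sum_on) (use vv_integrable[OF j] in auto)
  moreover have "AE \<omega> in P. real_cond_exp P F (\<lambda>\<omega>. \<Sum>s<T. v j \<omega> s * v j \<omega> s) \<omega> \<le> real_cond_exp P F (\<lambda>_. 1) \<omega>"
  proof (rule real_cond_exp_mono)
    show "AE \<omega> in P. (\<Sum>s<T. v j \<omega> s * v j \<omega> s) \<le> 1"
      using v_inner_le[OF j] by (auto simp: inner_on_def)
    show "integrable P (\<lambda>\<omega>. \<Sum>s<T. v j \<omega> s * v j \<omega> s)"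
      by (rule Bochner_Integration.integrable_sum) (use vv_integrable[OF j] in auto)
  qed simp
  moreover have "AE \<omega> in P. real_cond_exp P F (\<lambda>_. 1) \<omega> = 1"
    by (rule real_cond_exp_F_meas) auto
  ultimately show ?thesis by eventually_elim (simp add: B_def)
qed

lemma entry_B_le:
  assumes j: "j < N" and st: "s < T" "t < T"
  shows "AE \<omega> in P. \<bar>B j \<omega> s t\<bar> \<le> 1"
proof -
  have b: "AE \<omega> in P. \<bar>v j \<omega> s * v j \<omega> t\<bar> \<le> 1"
    using prod_entry_bound[OF j cond_indep_space[OF ci j] st] by (simp add: v_def)
  have one: "AE \<omega> in P. real_cond_exp P F (\<lambda>_. c) \<omega> = c" for c :: real
    by (rule real_cond_exp_F_meas) auto
  have "AE \<omega> in P. real_cond_exp P F (\<lambda>\<omega>. v j \<omega> s * v j \<omega> t) \<omega> \<le> real_cond_exp P F (\<lambda>_. 1) \<omega>"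
    by (rule real_cond_exp_mono) (use b vv_integrable[OF j st] in auto)
  moreover have "AE \<omega> in P. real_cond_exp P F (\<lambda>_. - 1) \<omega> \<le> real_cond_exp P F (\<lambda>\<omega>. v j \<omega> s * v j \<omega> t) \<omega>"
    by (rule real_cond_exp_mono) (use b vv_integrable[OF j st] in auto)
  ultimately show ?thesis using one[of 1] one[of "- 1"] by eventually_elim (auto simp: B_def)
qed

section \<open>Consequences of the moment condition on the event \<open>G0\<close>\<close>

definition cond_moment :: "nat \<Rightarrow> nat \<Rightarrow> 'a \<Rightarrow> ennreal" where
  "cond_moment j t = nn_cond_exp P F (\<lambda>\<omega>. ennreal (\<bar>u \<omega> $$ (j, t)\<bar> powr (2 * \<kappa>)))"

lemma moment_F: "moment \<in> borel_measurable F"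
  unfolding moment_def max_cond_moment_def[abs_def]
  by (intro borel_measurable_Max borel_measurable_divide_ennreal borel_measurable_sum) auto

lemma G0_F: "G0 \<in> sets F"
proof -
  have "G0 = {\<omega> \<in> space F. moment \<omega> \<le> ennreal C1}" by (simp add: G0_def space_F)
  then show ?thesis using moment_F by simp
qed

lemma G0_P: "G0 \<in> sets P"
  using G0_F sets_F by auto

lemma cond_moment_le:
  assumes "\<omega> \<in> G0" "j < N"
  shows "(\<Sum>t<T. cond_moment j t \<omega>) \<le> ennreal (C1 * real T)"
proof -
  have "(\<Sum>t<T. cond_moment j t \<omega>) / of_nat T \<le> moment \<omega>"
    unfolding moment_def max_cond_moment_def cond_moment_def using assms(2) by (intro Max_ge) auto
  also have "\<dots> \<le> ennreal C1" using assms(1) by (simp add: G0_def)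
  finally have "(\<Sum>t<T. cond_moment j t \<omega>) \<le> ennreal C1 * of_nat T"
    using T_pos by (rule ennreal_divide_le_imp_le_mult)
  then show ?thesis using C1 by (simp add: ennreal_mult' ennreal_of_nat_eq_real_of_nat)
qed

definition row_moment :: "nat \<Rightarrow> 'a \<Rightarrow> real" where
  "row_moment j \<omega> = (\<Sum>t<T. \<bar>row j \<omega> t\<bar> powr (2 * \<kappa>))"

text \<open>\<open>G0\<close> belongs to \<open>F\<close>, so on it the moments may be replaced by
  their conditional versions, whose sum is at most \<open>C1 * T\<close>. Working with extended
  nonnegative integrals first lets integrability come out as a result.\<close>

lemma row_moment_integral:
  assumes j: "j < N"
  shows "integrable P (\<lambda>\<omega>. indicator G0 \<omega> * row_moment j \<omega>)"
    and "(\<integral>\<omega>. indicator G0 \<omega> * row_moment j \<omega> \<partial>P) \<le> C1 * real T"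
proof -
  have rm[measurable]: "(\<lambda>\<omega>. \<bar>row j \<omega> t\<bar> powr (2 * \<kappa>)) \<in> borel_measurable P" if "t < T" for t
    using row_meas[OF j that] by measurable
  have Rm: "row_moment j \<in> borel_measurable P"
    unfolding row_moment_def[abs_def] by (intro borel_measurable_sum rm) auto
  have m: "(\<lambda>\<omega>. indicator G0 \<omega> * row_moment j \<omega>) \<in> borel_measurable P"
    using G0_P Rm by (intro borel_measurable_times) auto
  have nn: "0 \<le> indicator G0 \<omega> * row_moment j \<omega>" for \<omega>
    unfolding row_moment_def by (intro mult_nonneg_nonneg sum_nonneg) auto
  have e: "ennreal (indicator G0 \<omega> * row_moment j \<omega>)
      = (\<Sum>t<T. indicator G0 \<omega> * ennreal (\<bar>row j \<omega> t\<bar> powr (2 * \<kappa>)))" for \<omega>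
    unfolding row_moment_def by (auto simp: indicator_def)
  have "(\<integral>\<^sup>+\<omega>. ennreal (indicator G0 \<omega> * row_moment j \<omega>) \<partial>P)
      = (\<Sum>t<T. \<integral>\<^sup>+\<omega>. indicator G0 \<omega> * ennreal (\<bar>row j \<omega> t\<bar> powr (2 * \<kappa>)) \<partial>P)"
    unfolding e using G0_P rm
    by (intro nn_integral_sum borel_measurable_times_ennreal borel_measurable_indicator measurable_compose[OF rm measurable_ennreal]) auto
  also have "\<dots> = (\<Sum>t<T. \<integral>\<^sup>+\<omega>. indicator G0 \<omega> * cond_moment j t \<omega> \<partial>P)"
  proof (intro sum.cong refl)
    fix t assume "t \<in> {..<T}"
    then have "(\<lambda>\<omega>. ennreal (\<bar>u \<omega> $$ (j, t)\<bar> powr (2 * \<kappa>))) \<in> borel_measurable P"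
      using rm[of t] by (simp add: row_def)
    then show "(\<integral>\<^sup>+\<omega>. indicator G0 \<omega> * ennreal (\<bar>row j \<omega> t\<bar> powr (2 * \<kappa>)) \<partial>P)
        = (\<integral>\<^sup>+\<omega>. indicator G0 \<omega> * cond_moment j t \<omega> \<partial>P)"
      unfolding cond_moment_def row_def using G0_F by (intro nn_cond_exp_intg[symmetric]) auto
  qed
  also have "\<dots> = (\<integral>\<^sup>+\<omega>. (\<Sum>t<T. indicator G0 \<omega> * cond_moment j t \<omega>) \<partial>P)"
    unfolding cond_moment_def using G0_P
    by (intro nn_integral_sum[symmetric] borel_measurable_times_ennreal borel_measurable_indicator) auto
  also have "\<dots> \<le> (\<integral>\<^sup>+\<omega>. ennreal (C1 * real T) \<partial>P)"
    using cond_moment_le[OF _ j] by (intro nn_integral_mono) (auto simp: indicator_def)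
  also have "\<dots> = ennreal (C1 * real T)" by (simp add: emeasure_space_1)
  finally have le: "(\<integral>\<^sup>+\<omega>. ennreal (indicator G0 \<omega> * row_moment j \<omega>) \<partial>P) \<le> ennreal (C1 * real T)" .
  show "integrable P (\<lambda>\<omega>. indicator G0 \<omega> * row_moment j \<omega>)"
    by (rule integrableI_nonneg[OF m]) (use nn le in \<open>auto simp: order_le_less_trans\<close>)
  show "(\<integral>\<omega>. indicator G0 \<omega> * row_moment j \<omega> \<partial>P) \<le> C1 * real T"
    by (rule integral_real_bounded[OF _ le]) (use C1 in auto)
qed

lemma prob_large_row:
  assumes j: "j < N"
  shows "measure P {\<omega> \<in> space P. \<omega> \<in> G0 \<and> L < inner_on T (row j \<omega>) (row j \<omega>)} \<le> C1 * (2 * real T / L) powr \<kappa>"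
    and "{\<omega> \<in> space P. \<omega> \<in> G0 \<and> L < inner_on T (row j \<omega>) (row j \<omega>)} \<in> sets P"
proof -
  \<comment> \<open>With this threshold the terms \<open>h\<close> add up to \<open>L / 2\<close>
    over the \<open>T\<close> entries, so a row of squared length above \<open>L\<close> must get
    the other half from its moment. This forces the moment to be at least \<open>c\<close>, and
    Markov's inequality finishes.\<close>
  define h where "h = L / (2 * real T)"
  have h: "0 < h" using L_pos T_pos by (simp add: h_def)
  define c where "c = real T * h powr \<kappa>"
  have c: "0 < c" using h T_pos by (simp add: c_def)
  have inc: "c \<le> row_moment j \<omega>" if "L < inner_on T (row j \<omega>) (row j \<omega>)" for \<omega>
  proof -
    have "inner_on T (row j \<omega>) (row j \<omega>) \<le> (\<Sum>t<T. h + h powr (1 - \<kappa>) * \<bar>row j \<omega> t\<bar> powr (2 * \<kappa>))"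
      unfolding inner_on_def
    proof (rule sum_mono)
      fix t
      have "((row j \<omega> t)\<^sup>2) powr \<kappa> = \<bar>row j \<omega> t\<bar> powr (2 * \<kappa>)"
        by (simp add: powr_powr[symmetric])
      then show "row j \<omega> t * row j \<omega> t \<le> h + h powr (1 - \<kappa>) * \<bar>row j \<omega> t\<bar> powr (2 * \<kappa>)"
        using le_add_powr[of "(row j \<omega> t)\<^sup>2" h \<kappa>] h \<kappa> by (simp add: power2_eq_square)
    qed
    also have "\<dots> = L / 2 + h powr (1 - \<kappa>) * row_moment j \<omega>"
      using T_pos by (simp add: sum.distrib row_moment_def sum_distrib_left h_def)
    finally have "L / 2 \<le> h powr (1 - \<kappa>) * row_moment j \<omega>" using that by linarith
    then have "h powr (\<kappa> - 1) * (L / 2) \<le> h powr (\<kappa> - 1) * (h powr (1 - \<kappa>) * row_moment j \<omega>)"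
      by (intro mult_left_mono) auto
    also have "\<dots> = row_moment j \<omega>" using h by (simp add: mult.assoc[symmetric] powr_add[symmetric])
    also have "h powr (\<kappa> - 1) * (L / 2) = c"
      using h T_pos by (simp add: c_def powr_diff) (simp add: h_def)
    finally show ?thesis .
  qed
  have im: "(\<lambda>\<omega>. inner_on T (row j \<omega>) (row j \<omega>)) \<in> borel_measurable P"
    unfolding inner_on_def using row_meas[OF j] by (intro borel_measurable_sum borel_measurable_times) auto
  have "{\<omega> \<in> space P. \<omega> \<in> G0 \<and> L < inner_on T (row j \<omega>) (row j \<omega>)}
      = G0 \<inter> {\<omega> \<in> space P. L < inner_on T (row j \<omega>) (row j \<omega>)}"
    by (auto simp: G0_def)
  then show "{\<omega> \<in> space P. \<omega> \<in> G0 \<and> L < inner_on T (row j \<omega>) (row j \<omega>)} \<in> sets P"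
    using G0_P im by simp
  let ?S = "{\<omega> \<in> space P. c \<le> indicator G0 \<omega> * row_moment j \<omega>}"
  have "measure P {\<omega> \<in> space P. \<omega> \<in> G0 \<and> L < inner_on T (row j \<omega>) (row j \<omega>)} \<le> measure P ?S"
  proof (rule finite_measure_mono)
    show "?S \<in> sets P"
      by (rule borel_measurable_le[OF borel_measurable_const
            borel_measurable_integrable[OF row_moment_integral(1)[OF j]]])
  qed (use inc in auto)
  also have "\<dots> \<le> (\<integral>\<omega>. indicator G0 \<omega> * row_moment j \<omega> \<partial>P) / c"
    by (rule integral_Markov_inequality_measure[OF row_moment_integral(1)[OF j], of "{}"])
      (use c in \<open>auto simp: row_moment_def intro!: mult_nonneg_nonneg sum_nonneg\<close>)
  also have "\<dots> \<le> C1 * real T / c" using row_moment_integral(2)[OF j] c by (intro divide_right_mono) auto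
  also have "\<dots> = C1 * (2 * real T / L) powr \<kappa>"
  proof -
    have "2 * real T / L = 1 / h" by (simp add: h_def)
    then have "(2 * real T / L) powr \<kappa> = 1 / h powr \<kappa>" using h by (simp add: powr_divide)
    then show ?thesis using T_pos by (simp add: c_def)
  qed
  finally show "measure P {\<omega> \<in> space P. \<omega> \<in> G0 \<and> L < inner_on T (row j \<omega>) (row j \<omega>)} \<le> C1 * (2 * real T / L) powr \<kappa>" .
qed

text \<open>Products of entries of \<open>u\<close> need not be integrable by themselves. On
  \<open>G0\<close> they are dominated by the row moment, through threshold 1 in
  \<open>le_add_powr\<close>, and this makes linearity of conditional expectation available
  there.\<close>

lemma row_prod_integrable:
  assumes j: "j < N" and st: "s < T" "t < T"
  shows "integrable P (\<lambda>\<omega>. indicator G0 \<omega> * (row j \<omega> s * row j \<omega> t))"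
proof (rule Bochner_Integration.integrable_bound)
  show "integrable P (\<lambda>\<omega>. 2 + 2 * (indicator G0 \<omega> * row_moment j \<omega>))"
    using row_moment_integral(1)[OF j] by simp
  show "(\<lambda>\<omega>. indicator G0 \<omega> * (row j \<omega> s * row j \<omega> t)) \<in> borel_measurable P"
    using G0_P row_meas[OF j] st by (intro borel_measurable_times) auto
  show "AE \<omega> in P. norm (indicator G0 \<omega> * (row j \<omega> s * row j \<omega> t)) \<le> norm (2 + 2 * (indicator G0 \<omega> * row_moment j \<omega>))"
  proof (rule AE_I2)
    fix \<omega>
    have sq: "(row j \<omega> r)\<^sup>2 \<le> 1 + row_moment j \<omega>" if r: "r < T" for r
    proof -
      have "((row j \<omega> r)\<^sup>2) powr \<kappa> = \<bar>row j \<omega> r\<bar> powr (2 * \<kappa>)"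
        by (simp add: powr_powr[symmetric])
      then have "(row j \<omega> r)\<^sup>2 \<le> 1 + \<bar>row j \<omega> r\<bar> powr (2 * \<kappa>)"
        using le_add_powr[of "(row j \<omega> r)\<^sup>2" 1 \<kappa>] \<kappa> by simp
      also have "\<bar>row j \<omega> r\<bar> powr (2 * \<kappa>) \<le> row_moment j \<omega>"
        unfolding row_moment_def using r by (intro member_le_sum) auto
      finally show ?thesis by simp
    qed
    have "\<bar>row j \<omega> s * row j \<omega> t\<bar> \<le> (row j \<omega> s)\<^sup>2 + (row j \<omega> t)\<^sup>2"
    proof -
      have "0 \<le> (\<bar>row j \<omega> s\<bar> - \<bar>row j \<omega> t\<bar>)\<^sup>2" by simp
      then have "2 * (\<bar>row j \<omega> s\<bar> * \<bar>row j \<omega> t\<bar>) \<le> (row j \<omega> s)\<^sup>2 + (row j \<omega> t)\<^sup>2"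
        by (simp add: power2_diff)
      then show ?thesis by (simp add: abs_mult) (use mult_nonneg_nonneg[of "\<bar>row j \<omega> s\<bar>" "\<bar>row j \<omega> t\<bar>"] in linarith)
    qed
    also have "\<dots> \<le> 2 + 2 * row_moment j \<omega>" using sq[OF st(1)] sq[OF st(2)] by linarith
    finally show "norm (indicator G0 \<omega> * (row j \<omega> s * row j \<omega> t)) \<le> norm (2 + 2 * (indicator G0 \<omega> * row_moment j \<omega>))"
      by (auto simp: indicator_def)
  qed
qed

definition raw :: "nat \<Rightarrow> 'a \<Rightarrow> nat \<Rightarrow> nat \<Rightarrow> real" where
  "raw j \<omega> s t = real_cond_exp P F (\<lambda>\<omega>. u \<omega> $$ (j, s) * u \<omega> $$ (j, t)) \<omega>"

text \<open>Pointwise, \<open>L\<close> times the square of the truncated row against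
  \<open>x\<close> is at most the square of the full row. The comparison is conditioned on
  \<open>F\<close> after multiplication by the indicator of \<open>G0\<close>, which is then pulled
  out.\<close>

lemma bilin_B_le_raw:
  assumes j: "j < N"
  shows "AE \<omega> in P. \<omega> \<in> G0 \<longrightarrow> L * bilin T (B j \<omega>) x x \<le> bilin T (raw j \<omega>) x x"
proof -
  define f where "f \<omega> s t = indicator G0 \<omega> * (row j \<omega> s * row j \<omega> t) - L * (indicator G0 \<omega> * (v j \<omega> s * v j \<omega> t))" for \<omega> s t
  have GF[measurable]: "indicator G0 \<in> borel_measurable F" using G0_F by simp
  have vi: "integrable P (\<lambda>\<omega>. indicator G0 \<omega> * (v j \<omega> s * v j \<omega> t))" if "s < T" "t < T" for s t
    using integrable_real_mult_indicator[OF G0_P vv_integrable[OF j that]] by (simp add: mult.commute)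
  have fi: "integrable P (\<lambda>\<omega>. f \<omega> s t)" if "s < T" "t < T" for s t
    unfolding f_def using row_prod_integrable[OF j that] vi[OF that] by simp
  have pos: "0 \<le> bilin T (f \<omega>) x x" for \<omega>
  proof -
    have "bilin T (f \<omega>) x x = indicator G0 \<omega> * ((inner_on T (row j \<omega>) x)\<^sup>2 - L * (inner_on T (v j \<omega>) x)\<^sup>2)"
    proof -
      have "f \<omega> = (\<lambda>s t. indicator G0 \<omega> * outer (row j \<omega>) s t + (- L * indicator G0 \<omega>) * outer (v j \<omega>) s t)"
        by (intro ext) (simp add: f_def outer_def)
      then show ?thesis
        by (simp only: bilin_add bilin_scale bilin_outer) (simp add: power2_eq_square algebra_simps)
    qed
    moreover have "L * (inner_on T (v j \<omega>) x)\<^sup>2 \<le> (inner_on T (row j \<omega>) x)\<^sup>2"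
      using L_pos by (simp add: inner_v power_divide)
    ultimately show ?thesis by simp
  qed
  have "AE \<omega> in P. 0 \<le> real_cond_exp P F (\<lambda>\<omega>. bilin T (f \<omega>) x x) \<omega>"
  proof (rule real_cond_exp_pos)
    show "(\<lambda>\<omega>. bilin T (f \<omega>) x x) \<in> borel_measurable P"
      unfolding bilin_def using borel_measurable_integrable[OF fi]
      by (intro borel_measurable_sum borel_measurable_times) auto
  qed (use pos in auto)
  moreover have "AE \<omega> in P. real_cond_exp P F (\<lambda>\<omega>. bilin T (f \<omega>) x x) \<omega>
      = bilin T (\<lambda>s t. real_cond_exp P F (\<lambda>\<omega>. f \<omega> s t) \<omega>) x x"
    by (rule real_cond_exp_bilin[OF fi])
  moreover have "AE \<omega> in P. \<forall>i\<in>{..<T} \<times> {..<T}. real_cond_exp P F (\<lambda>\<omega>. f \<omega> (fst i) (snd i)) \<omega>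
      = indicator G0 \<omega> * raw j \<omega> (fst i) (snd i) - L * (indicator G0 \<omega> * B j \<omega> (fst i) (snd i))"
  proof (rule AE_finite_allI)
    fix i assume "i \<in> {..<T} \<times> {..<T}"
    then have st: "fst i < T" "snd i < T" by auto
    have "AE \<omega> in P. real_cond_exp P F (\<lambda>\<omega>. f \<omega> (fst i) (snd i)) \<omega>
      = real_cond_exp P F (\<lambda>\<omega>. indicator G0 \<omega> * (row j \<omega> (fst i) * row j \<omega> (snd i))) \<omega>
        - real_cond_exp P F (\<lambda>\<omega>. L * (indicator G0 \<omega> * (v j \<omega> (fst i) * v j \<omega> (snd i)))) \<omega>"
      unfolding f_def by (rule real_cond_exp_diff) (use row_prod_integrable[OF j st] vi[OF st] in auto)
    moreover have "AE \<omega> in P. real_cond_exp P F (\<lambda>\<omega>. L * (indicator G0 \<omega> * (v j \<omega> (fst i) * v j \<omega> (snd i)))) \<omega>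
      = L * real_cond_exp P F (\<lambda>\<omega>. indicator G0 \<omega> * (v j \<omega> (fst i) * v j \<omega> (snd i))) \<omega>"
      by (rule real_cond_exp_cmult[OF vi[OF st]])
    moreover have "AE \<omega> in P. real_cond_exp P F (\<lambda>\<omega>. indicator G0 \<omega> * (v j \<omega> (fst i) * v j \<omega> (snd i))) \<omega>
      = indicator G0 \<omega> * real_cond_exp P F (\<lambda>\<omega>. v j \<omega> (fst i) * v j \<omega> (snd i)) \<omega>"
      by (rule real_cond_exp_mult[OF GF _ vi[OF st]]) (use vv_integrable[OF j st] in auto)
    \<comment> \<open>Integrability is supplied for the product with the indicator; the product of
      the two entries alone contributes measurability.\<close>
    moreover have "AE \<omega> in P. real_cond_exp P F (\<lambda>\<omega>. indicator G0 \<omega> * (row j \<omega> (fst i) * row j \<omega> (snd i))) \<omega>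
      = indicator G0 \<omega> * real_cond_exp P F (\<lambda>\<omega>. row j \<omega> (fst i) * row j \<omega> (snd i)) \<omega>"
      by (rule real_cond_exp_mult[OF GF _ row_prod_integrable[OF j st]]) (use row_meas[OF j] st in auto)
    ultimately show "AE \<omega> in P. real_cond_exp P F (\<lambda>\<omega>. f \<omega> (fst i) (snd i)) \<omega>
      = indicator G0 \<omega> * raw j \<omega> (fst i) (snd i) - L * (indicator G0 \<omega> * B j \<omega> (fst i) (snd i))"
      by eventually_elim (simp add: raw_def B_def row_def)
  qed simp
  ultimately show ?thesis
  proof eventually_elim
    case (elim \<omega>)
    show ?case
    proof
      assume \<omega>: "\<omega> \<in> G0"
      have "bilin T (\<lambda>s t. real_cond_exp P F (\<lambda>\<omega>. f \<omega> s t) \<omega>) x x = bilin T (\<lambda>s t. raw j \<omega> s t + (- L) * B j \<omega> s t) x x"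
        by (rule bilin_cong) (use elim(3) \<omega> in auto)
      also have "\<dots> = bilin T (raw j \<omega>) x x - L * bilin T (B j \<omega>) x x"
        by (simp only: bilin_add bilin_scale)
      finally show "L * bilin T (B j \<omega>) x x \<le> bilin T (raw j \<omega>) x x" using elim(1,2) by simp
    qed
  qed
qed

end

section \<open>Exceptional events and the operator norm bound\<close>

context row_truncation
begin

definition avg :: "'a \<Rightarrow> real mat" where
  "avg = avg_cond_second_moment P F N T u"

text \<open>The event is described through the conditional moments \<open>B\<close> and countably
  many vectors, not through the spectral norm of \<open>avg\<close>; its membership in
  \<open>F\<close> is then immediate.\<close>

definition G :: "real \<Rightarrow> 'a set" where
  "G \<gamma> = {\<omega> \<in> G0. (\<forall>j<N. (\<forall>s<T. \<forall>t<T. \<bar>B j \<omega> s t\<bar> \<le> 1) \<and> (\<Sum>s<T. B j \<omega> s s) \<le> 1 \<and>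
      (\<forall>xs. 0 \<le> bilin T (B j \<omega>) (rat_vec xs) (rat_vec xs))) \<and>
    (\<forall>xs. (\<Sum>j<N. bilin T (B j \<omega>) (rat_vec xs) (rat_vec xs)) \<le> \<gamma> * inner_on T (rat_vec xs) (rat_vec xs))}"

lemma G_F: "G \<gamma> \<in> sets F"
proof -
  note [measurable] = B_meas_F
  have [measurable]: "(\<lambda>\<omega>. bilin T (B j \<omega>) x x) \<in> borel_measurable F" for j x
    unfolding bilin_def by measurable
  have "G \<gamma> = G0 \<inter> {\<omega> \<in> space F. (\<forall>j<N. (\<forall>s<T. \<forall>t<T. \<bar>B j \<omega> s t\<bar> \<le> 1) \<and> (\<Sum>s<T. B j \<omega> s s) \<le> 1 \<and>
      (\<forall>xs. 0 \<le> bilin T (B j \<omega>) (rat_vec xs) (rat_vec xs))) \<and>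
    (\<forall>xs. (\<Sum>j<N. bilin T (B j \<omega>) (rat_vec xs) (rat_vec xs)) \<le> \<gamma> * inner_on T (rat_vec xs) (rat_vec xs))}"
    using sets.sets_into_space[OF G0_F] unfolding G_def by blast
  also have "\<dots> \<in> sets F"
    by (intro sets.Int G0_F) measurable
  finally show ?thesis .
qed

lemma good_G: "good (G \<gamma>)"
proof -
  have "symm_on T (B j \<omega>)" for j \<omega>
    by (simp add: symm_on_def B_def mult.commute)
  then show ?thesis
    using G_F bilin_nonneg_of_rat unfolding good_def psd_on_def G_def by blast
qed

lemma bilin_avg: "(\<Sum>j<N. bilin T (raw j \<omega>) x x) = real N * bilin T (\<lambda>s t. avg \<omega> $$ (s,t)) x x"
proof -
  have "bilin T (\<lambda>s t. avg \<omega> $$ (s,t)) x x = bilin T (\<lambda>s t. (1 / real N) * (\<Sum>j<N. raw j \<omega> s t)) x x"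
    by (rule bilin_cong) (simp add: avg_def avg_cond_second_moment_def raw_def)
  also have "\<dots> = 1 / real N * (\<Sum>j<N. bilin T (raw j \<omega>) x x)"
    by (simp only: bilin_scale bilin_sum)
  finally show ?thesis using N_pos by simp
qed

text \<open>As quadratic forms, \<open>L\<close> times the sum of the \<open>B j\<close> lies below
  the sum of the \<open>raw j\<close>, which is \<open>N\<close> times \<open>avg\<close> and hence
  at most \<open>N * C2\<close>. This is the origin of the value \<open>N * C2 / L\<close> of
  \<gamma>.\<close>

lemma AE_G:
  "AE \<omega> in P. moment \<omega> \<le> ennreal C1 \<longrightarrow> spectral_norm (avg \<omega>) \<le> C2 \<longrightarrow> \<omega> \<in> G (real N * C2 / L)"
proof -
  have 1: "AE \<omega> in P. \<forall>j\<in>{..<N}. \<forall>s\<in>{..<T}. \<forall>t\<in>{..<T}. \<bar>B j \<omega> s t\<bar> \<le> 1"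
    by (intro AE_finite_allI entry_B_le) auto
  have 2: "AE \<omega> in P. \<forall>j\<in>{..<N}. (\<Sum>s<T. B j \<omega> s s) \<le> 1"
    by (intro AE_finite_allI trace_B_le) auto
  have 3: "AE \<omega> in P. \<forall>j\<in>{..<N}. \<forall>xs. 0 \<le> bilin T (B j \<omega>) (rat_vec xs) (rat_vec xs)"
    by (intro AE_finite_allI AE_all_countable[THEN iffD2] allI bilin_B_nonneg) auto
  have 4: "AE \<omega> in P. \<forall>j\<in>{..<N}. \<forall>xs. \<omega> \<in> G0 \<longrightarrow>
      L * bilin T (B j \<omega>) (rat_vec xs) (rat_vec xs) \<le> bilin T (raw j \<omega>) (rat_vec xs) (rat_vec xs)"
    by (intro AE_finite_allI AE_all_countable[THEN iffD2] allI bilin_B_le_raw) auto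
  from 1 2 3 4 AE_space show ?thesis
  proof eventually_elim
    case (elim \<omega>)
    show ?case
    proof (intro impI)
      assume m: "moment \<omega> \<le> ennreal C1" and s: "spectral_norm (avg \<omega>) \<le> C2"
      have G0: "\<omega> \<in> G0" using m elim(5) by (simp add: G0_def)
      have "(\<Sum>j<N. bilin T (B j \<omega>) (rat_vec xs) (rat_vec xs)) \<le> real N * C2 / L * inner_on T (rat_vec xs) (rat_vec xs)" for xs
      proof -
        let ?x = "rat_vec xs"
        have "L * (\<Sum>j<N. bilin T (B j \<omega>) ?x ?x) \<le> (\<Sum>j<N. bilin T (raw j \<omega>) ?x ?x)"
          unfolding sum_distrib_left using elim(4) G0 by (intro sum_mono) auto
        also have "\<dots> = real N * bilin T (\<lambda>s t. avg \<omega> $$ (s,t)) ?x ?x" by (rule bilin_avg)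
        also have "\<dots> \<le> real N * (spectral_norm (avg \<omega>) * inner_on T ?x ?x)"
          by (intro mult_left_mono bilin_le_spectral_norm) (auto simp: avg_def avg_cond_second_moment_def)
        also have "\<dots> \<le> real N * (C2 * inner_on T ?x ?x)"
          using s by (intro mult_left_mono mult_right_mono inner_on_nonneg) auto
        finally show ?thesis using L_pos by (simp add: field_simps)
      qed
      then show "\<omega> \<in> G (real N * C2 / L)" using elim(1,2,3) G0 unfolding G_def by auto
    qed
  qed
qed

text \<open>The four probabilities belong to a large conditional moment, a large spectral norm, a
  row longer than the truncation level, and failure of the Chernoff bound. Off these events, and off
  a null set, no row has been cut to 0, so the rows of \<open>u\<close> are \<open>sqrt L\<close>
  times the vectors \<open>v\<close>.\<close>

lemma operator_norm_bound:
  assumes C2: "0 \<le> C2" and b: "0 < b"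
    and spec: "(\<lambda>\<omega>. ennreal (spectral_norm (avg \<omega>))) \<in> borel_measurable P"
  obtains Bad where "Bad \<in> sets P"
    "measure P Bad \<le> measure P {\<omega> \<in> space P. moment \<omega> > ennreal C1}
      + measure P {\<omega> \<in> space P. ennreal (spectral_norm (avg \<omega>)) > ennreal C2}
      + real N * (C1 * (2 * real T / L) powr \<kappa>)
      + exp 1 * real N * ((exp 1 * (real N * C2 / L) + real (Suc k)) / b) ^ Suc k"
    "\<And>\<omega> y. \<omega> \<in> space P - Bad \<Longrightarrow> (\<Sum>j<N. (inner_on T (\<lambda>t. u \<omega> $$ (j,t)) y)\<^sup>2) \<le> L * b * inner_on T y y"
proof -
  let ?\<gamma> = "real N * C2 / L"
  have \<gamma>: "0 \<le> ?\<gamma>" using C2 L_pos by simp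
  have G\<gamma>: "(\<Sum>j<N. bilin T (B j \<omega>) x x) \<le> ?\<gamma> * inner_on T x x" if "\<omega> \<in> G ?\<gamma>" for \<omega> x
  proof -
    have "bilin T (\<lambda>s t. \<Sum>j<N. B j \<omega> s t) x x \<le> ?\<gamma> * inner_on T x x"
      by (rule bilin_le_of_rat) (use that in \<open>simp add: G_def bilin_sum\<close>)
    then show ?thesis by (simp only: bilin_sum)
  qed
  obtain Bc where Bc: "Bc \<in> sets P"
    "measure P Bc \<le> exp 1 * real N * ((exp 1 * ?\<gamma> + real (Suc k)) / b) ^ Suc k"
    "\<And>\<omega> y. \<omega> \<in> G ?\<gamma> - Bc \<Longrightarrow> (\<Sum>j<N. (inner_on T (v j \<omega>) y)\<^sup>2) \<le> b * inner_on T y y"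
    by (rule matrix_chernoff[OF good_G[of ?\<gamma>] _ \<gamma> G\<gamma> b, where k = k]) (simp add: prob_space, assumption, rule that)
  define E1 where "E1 = {\<omega> \<in> space P. moment \<omega> > ennreal C1}"
  define E2 where "E2 = {\<omega> \<in> space P. ennreal (spectral_norm (avg \<omega>)) > ennreal C2}"
  define E3 where "E3 j = {\<omega> \<in> space P. \<omega> \<in> G0 \<and> L < inner_on T (row j \<omega>) (row j \<omega>)}" for j
  have E1: "E1 \<in> sets P"
    unfolding E1_def
    by (rule borel_measurable_less[OF borel_measurable_const measurable_from_subalg[OF subalg moment_F]])
  have E2: "E2 \<in> sets P" unfolding E2_def by (rule borel_measurable_less[OF borel_measurable_const spec])
  have E3: "E3 j \<in> sets P" if "j < N" for j unfolding E3_def by (rule prob_large_row(2)[OF that])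
  obtain Z where Z: "Z \<in> null_sets P"
    and GZ: "\<And>\<omega>. \<omega> \<in> space P - Z \<Longrightarrow>
      moment \<omega> \<le> ennreal C1 \<longrightarrow> spectral_norm (avg \<omega>) \<le> C2 \<longrightarrow> \<omega> \<in> G ?\<gamma>"
    by (rule AE_E3[OF AE_G[of C2]], rule that)
  define U where "U = (\<Union>j<N. E3 j)"
  have U: "U \<in> sets P" unfolding U_def using E3 by auto
  have mU: "measure P U \<le> real N * (C1 * (2 * real T / L) powr \<kappa>)"
  proof -
    have "measure P U \<le> (\<Sum>j<N. measure P (E3 j))"
      unfolding U_def by (rule finite_measure_subadditive_finite) (use E3 in auto)
    also have "\<dots> \<le> (\<Sum>j<N. C1 * (2 * real T / L) powr \<kappa>)"
      unfolding E3_def by (intro sum_mono prob_large_row(1)) auto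
    finally show ?thesis by simp
  qed
  have mZ: "measure P Z = 0" and Zs: "Z \<in> sets P" using Z by (auto simp: measure_def null_sets_def)
  define Bad where "Bad = (((E1 \<union> E2) \<union> U) \<union> Bc) \<union> Z"
  have Bad: "Bad \<in> sets P" unfolding Bad_def using E1 E2 U Bc(1) Zs by auto
  have "measure P Bad \<le> measure P (((E1 \<union> E2) \<union> U) \<union> Bc) + measure P Z"
    unfolding Bad_def by (rule measure_Un_le) (use E1 E2 U Bc(1) Zs in auto)
  moreover have "measure P (((E1 \<union> E2) \<union> U) \<union> Bc) \<le> measure P ((E1 \<union> E2) \<union> U) + measure P Bc"
    by (rule measure_Un_le) (use E1 E2 U Bc(1) Zs in auto)
  moreover have "measure P ((E1 \<union> E2) \<union> U) \<le> measure P (E1 \<union> E2) + measure P U"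
    by (rule measure_Un_le) (use E1 E2 U Bc(1) Zs in auto)
  moreover have "measure P (E1 \<union> E2) \<le> measure P E1 + measure P E2"
    by (rule measure_Un_le) (use E1 E2 U Bc(1) Zs in auto)
  ultimately have "measure P Bad \<le> measure P E1 + measure P E2 + measure P U + measure P Bc" using mZ by linarith
  then have mB: "measure P Bad \<le> measure P E1 + measure P E2 + real N * (C1 * (2 * real T / L) powr \<kappa>)
      + exp 1 * real N * ((exp 1 * ?\<gamma> + real (Suc k)) / b) ^ Suc k"
    using mU Bc(2) by linarith
  have op: "(\<Sum>j<N. (inner_on T (\<lambda>t. u \<omega> $$ (j,t)) y)\<^sup>2) \<le> L * b * inner_on T y y" if \<omega>: "\<omega> \<in> space P - Bad" for \<omega> y
  proof -
    have m: "moment \<omega> \<le> ennreal C1" using \<omega> by (auto simp: Bad_def E1_def not_less)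
    have "ennreal (spectral_norm (avg \<omega>)) \<le> ennreal C2" using \<omega> by (auto simp: Bad_def E2_def not_less)
    then have s: "spectral_norm (avg \<omega>) \<le> C2" using C2 by (simp add: ennreal_le_iff)
    have "\<omega> \<in> G ?\<gamma>" using GZ m s \<omega> by (auto simp: Bad_def)
    then have vb: "(\<Sum>j<N. (inner_on T (v j \<omega>) y)\<^sup>2) \<le> b * inner_on T y y"
      using Bc(3) \<omega> by (auto simp: Bad_def)
    have "(inner_on T (\<lambda>t. u \<omega> $$ (j,t)) y)\<^sup>2 = L * (inner_on T (v j \<omega>) y)\<^sup>2" if j: "j < N" for j
    proof -
      have "\<omega> \<in> G0" using m \<omega> by (simp add: G0_def)
      then have "inner_on T (row j \<omega>) (row j \<omega>) \<le> L"
        using \<omega> j unfolding Bad_def U_def E3_def by (auto simp: not_less)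
      then show ?thesis using L_pos by (simp add: inner_v power_divide row_def[abs_def])
    qed
    then have "(\<Sum>j<N. (inner_on T (\<lambda>t. u \<omega> $$ (j,t)) y)\<^sup>2) = L * (\<Sum>j<N. (inner_on T (v j \<omega>) y)\<^sup>2)"
      by (simp add: sum_distrib_left)
    also have "\<dots> \<le> L * (b * inner_on T y y)" using vb L_pos by simp
    finally show ?thesis by (simp add: mult.assoc)
  qed
  show ?thesis by (rule that[OF Bad _ op]) (use mB in \<open>simp_all add: E1_def E2_def\<close>)
qed

end

subsection \<open>Consistency of the estimator\<close>

lemma subalgebra_matrix_sigma:
  assumes "random_matrix P N T X"
  shows "subalgebra P (matrix_sigma P N T X)"
proof -
  have "(\<lambda>\<omega>. \<lambda>i\<in>{..<N} \<times> {..<T}. X \<omega> $$ i) \<in> P \<rightarrow>\<^sub>M (\<Pi>\<^sub>M i\<in>{..<N} \<times> {..<T}. borel)"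
    using assms by (intro measurable_restrict) (auto simp: random_matrix_def)
  then show ?thesis
    unfolding subalgebra_def matrix_sigma_def
    by (auto simp: space_vimage_algebra intro: sets_image_in_sets[THEN subsetD])
qed

text \<open>\<open>c\<close> adjusts the truncation level and \<open>k\<close> the power. Both
  remain free here: \<open>c\<close> is fixed later by the allowed probability, while
  \<open>k\<close> grows with the sample.\<close>

lemma sample_error_bound:
  fixes P :: "'a measure" and M u Mhat :: "'a \<Rightarrow> real mat" and N T :: nat
  defines "F \<equiv> matrix_sigma P N T M"
  assumes prob: "prob_space P"
    and M_rm: "random_matrix P N T M" and u_rm: "random_matrix P N T u"
    and model: "AE \<omega> in P. Y \<omega> = M \<omega> + u \<omega>"
    and M_bound: "AE \<omega> in P. nuclear_norm (M \<omega>) \<le> K"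
    and argmin: "AE \<omega> in P. nuclear_ls_estimate N T K (Y \<omega>) (Mhat \<omega>)"
    and ci: "cond_indep_vars P F (\<lambda>_. \<Pi>\<^sub>M t\<in>{..<T}. borel) (matrix_row T u) {..<N}"
    and spec: "(\<lambda>\<omega>. ennreal (spectral_norm (avg_cond_second_moment P F N T u \<omega>))) \<in> borel_measurable P"
    and N: "0 < N" and T: "0 < T" and \<kappa>: "1 < \<kappa>" and C1: "0 \<le> C1" and C2: "0 \<le> C2" and c: "0 < c"
  obtains Bad where "Bad \<in> sets P"
    "measure P Bad \<le> measure P {\<omega> \<in> space P. max_cond_moment P F N T (2 * \<kappa>) u \<omega> > ennreal C1}
      + measure P {\<omega> \<in> space P. ennreal (spectral_norm (avg_cond_second_moment P F N T u \<omega>)) > ennreal C2}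
      + C1 * (2 / c) powr \<kappa> + exp 1 * real N * exp (- 2 * real (Suc k))"
    "\<And>\<omega>. \<omega> \<in> space P - Bad \<Longrightarrow> (\<Sum>t<T. \<Sum>j<N. (Mhat \<omega> $$ (j,t) - M \<omega> $$ (j,t))\<^sup>2)
      \<le> 4 * sqrt (exp 2 * (exp 1 * real N * C2 + real (Suc k) * (c * real T * real N powr (1 / \<kappa>)))) * K"
proof -
  \<comment> \<open>The power \<open>N powr (1 / \<kappa>)\<close> makes the probability of one long
    row of order \<open>1 / N\<close>, so the union bound over \<open>N\<close> rows leaves
    \<open>C1 * (2 / c) powr \<kappa>\<close>.\<close>
  define L where "L = c * real T * real N powr (1 / \<kappa>)"
  have L: "0 < L" using c T N by (simp add: L_def)
  interpret prob_space P by (rule prob)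
  interpret finite_measure_subalgebra P F
    by unfold_locales (unfold F_def, rule subalgebra_matrix_sigma[OF M_rm])
  interpret row_truncation P F u N T \<kappa> L C1
    by unfold_locales (use u_rm ci N T \<kappa> L C1 in auto)
  define p where "p = real (Suc k)"
  define a where "a = exp 1 * (real N * C2 / L) + p"
  have a: "0 < a" using C2 L by (simp add: a_def p_def add_nonneg_pos)
  \<comment> \<open>The threshold is \<open>exp 2\<close> times the numerator \<open>a\<close> of
    the Chernoff bound, so the tail becomes \<open>exp (- 2 * Suc k)\<close>. This outweighs the
    remaining factor \<open>N\<close> once \<open>Suc k\<close> exceeds \<open>ln N\<close>.\<close>
  have b: "0 < exp 2 * a" using a by simp
  have Lb: "L * (exp 2 * a) = exp 2 * (exp 1 * real N * C2 + p * L)"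
    using L by (simp add: a_def field_simps)
  obtain Bo where Bo: "Bo \<in> sets P"
    "measure P Bo \<le> measure P {\<omega> \<in> space P. moment \<omega> > ennreal C1}
      + measure P {\<omega> \<in> space P. ennreal (spectral_norm (avg \<omega>)) > ennreal C2}
      + real N * (C1 * (2 * real T / L) powr \<kappa>)
      + exp 1 * real N * (a / (exp 2 * a)) ^ Suc k"
    "\<And>\<omega> y. \<omega> \<in> space P - Bo \<Longrightarrow> (\<Sum>j<N. (inner_on T (\<lambda>t. u \<omega> $$ (j,t)) y)\<^sup>2) \<le> L * (exp 2 * a) * inner_on T y y"
    unfolding a_def p_def
    by (rule operator_norm_bound[OF C2 b[unfolded a_def p_def] spec[folded avg_def], where k = k], rule that[unfolded a_def p_def])
  have e1: "real N * (C1 * (2 * real T / L) powr \<kappa>) = C1 * (2 / c) powr \<kappa>"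
  proof -
    have "2 * real T / L = (2 / c) / real N powr (1 / \<kappa>)" using T c by (simp add: L_def)
    then have "(2 * real T / L) powr \<kappa> = (2 / c) powr \<kappa> / (real N powr (1 / \<kappa>)) powr \<kappa>"
      using c by (simp only:) (rule powr_divide; simp)
    moreover have "(real N powr (1 / \<kappa>)) powr \<kappa> = real N" using \<kappa> N by (simp add: powr_powr)
    ultimately have "(2 * real T / L) powr \<kappa> = (2 / c) powr \<kappa> / real N" by (simp only:)
    then have "real N * (C1 * (2 * real T / L) powr \<kappa>) = real N * (C1 * ((2 / c) powr \<kappa> / real N))" by (simp only:)
    then show ?thesis using N by simp
  qed
  have e2: "(a / (exp 2 * a)) ^ Suc k = exp (- 2 * real (Suc k))"
  proof -
    have "a / (exp 2 * a) = exp (- 2)" using a by (simp add: exp_minus field_simps)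
    then have "(a / (exp 2 * a)) ^ Suc k = exp (real (Suc k) * (- 2))" by (simp only: exp_of_nat_mult)
    then show ?thesis by (simp only: mult.commute)
  qed
  have "AE \<omega> in P. Y \<omega> = M \<omega> + u \<omega> \<and> nuclear_norm (M \<omega>) \<le> K \<and> nuclear_ls_estimate N T K (Y \<omega>) (Mhat \<omega>)"
    using model M_bound argmin by eventually_elim simp
  then obtain Z where Z: "Z \<in> null_sets P"
    and AEs: "\<And>\<omega>. \<omega> \<in> space P - Z \<Longrightarrow>
      Y \<omega> = M \<omega> + u \<omega> \<and> nuclear_norm (M \<omega>) \<le> K \<and> nuclear_ls_estimate N T K (Y \<omega>) (Mhat \<omega>)"
    by (rule AE_E3) (rule that)
  have mZ: "measure P Z = 0" and Zs: "Z \<in> sets P" using Z by (auto simp: measure_def null_sets_def)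
  have "Bo \<union> Z \<in> sets P" using Bo(1) Zs by auto
  moreover have "measure P (Bo \<union> Z) \<le> measure P {\<omega> \<in> space P. max_cond_moment P F N T (2 * \<kappa>) u \<omega> > ennreal C1}
      + measure P {\<omega> \<in> space P. ennreal (spectral_norm (avg_cond_second_moment P F N T u \<omega>)) > ennreal C2}
      + C1 * (2 / c) powr \<kappa> + exp 1 * real N * exp (- 2 * real (Suc k))"
    using measure_Un_le[OF Bo(1) Zs] Bo(2) mZ unfolding e1 e2 moment_def avg_def by linarith
  moreover have "(\<Sum>t<T. \<Sum>j<N. (Mhat \<omega> $$ (j,t) - M \<omega> $$ (j,t))\<^sup>2)
      \<le> 4 * sqrt (exp 2 * (exp 1 * real N * C2 + real (Suc k) * (c * real T * real N powr (1 / \<kappa>)))) * K"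
    if \<omega>: "\<omega> \<in> space P - (Bo \<union> Z)" for \<omega>
  proof -
    have "M \<omega> \<in> carrier_mat N T" "u \<omega> \<in> carrier_mat N T"
      using \<omega> M_rm u_rm by (auto simp: random_matrix_def)
    moreover have "(sqrt (L * (exp 2 * a)))\<^sup>2 = L * (exp 2 * a)" using L b by simp
    moreover have "nuclear_norm (M \<omega>) \<le> K" "nuclear_ls_estimate N T K (M \<omega> + u \<omega>) (Mhat \<omega>)"
      using AEs[of \<omega>] \<omega> by auto
    ultimately have "(\<Sum>t<T. \<Sum>j<N. (Mhat \<omega> $$ (j,t) - M \<omega> $$ (j,t))\<^sup>2) \<le> 4 * sqrt (L * (exp 2 * a)) * K"
      using Bo(3)[of \<omega>] \<omega> L b by (intro nuclear_ls_error_bound) auto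
    then show ?thesis unfolding Lb unfolding p_def L_def .
  qed
  ultimately show ?thesis by (rule that)
qed

section \<open>Stochastic order symbols through exceptional sets\<close>

lemma ennreal_max_0: "ennreal (max 0 C) = ennreal C"
  by (cases "0 \<le> C") (auto simp: max_def ennreal_neg)

text \<open>A negative bound is read as 0 by \<open>ennreal\<close>, so the bound may be taken
  nonnegative.\<close>

lemma bigO_P_1_bound:
  assumes "bigO_P_1 P X" "0 < \<epsilon>"
  obtains C where "0 \<le> C" "\<forall>\<^sub>F n in sequentially. measure (P n) {\<omega> \<in> space (P n). X n \<omega> > ennreal C} \<le> \<epsilon>"
proof -
  obtain C where "\<forall>\<^sub>F n in sequentially. measure (P n) {\<omega> \<in> space (P n). X n \<omega> > ennreal C} \<le> \<epsilon>"
    using assms unfolding bigO_P_1_def by blast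
  then have "\<forall>\<^sub>F n in sequentially. measure (P n) {\<omega> \<in> space (P n). X n \<omega> > ennreal (max 0 C)} \<le> \<epsilon>"
    by (simp only: ennreal_max_0)
  then show ?thesis by (rule that[rotated]) simp
qed

text \<open>The deviation event is covered by a measurable set of small probability; several sources
  of failure can then simply be united.\<close>

lemma smallo_P_1I:
  assumes prob: "\<And>n. prob_space (P n)" and meas: "\<And>n. X n \<in> borel_measurable (P n)"
    and small: "\<And>\<delta> \<epsilon>. 0 < \<delta> \<Longrightarrow> 0 < \<epsilon> \<Longrightarrow> \<forall>\<^sub>F n in sequentially. \<exists>Bad\<in>sets (P n). measure (P n) Bad \<le> \<epsilon> \<and>
      (\<forall>\<omega>\<in>space (P n) - Bad. \<bar>X n \<omega>\<bar> \<le> \<delta>)"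
  shows "smallo_P_1 P X"
  unfolding smallo_P_1_def
proof (intro conjI allI impI meas)
  fix \<delta> :: real assume \<delta>: "0 < \<delta>"
  show "(\<lambda>n. measure (P n) {\<omega> \<in> space (P n). \<bar>X n \<omega>\<bar> > \<delta>}) \<longlonglongrightarrow> 0"
  proof (rule tendstoI)
    fix \<epsilon> :: real assume "0 < \<epsilon>"
    then have "\<forall>\<^sub>F n in sequentially. \<exists>Bad\<in>sets (P n). measure (P n) Bad \<le> \<epsilon> / 2 \<and>
      (\<forall>\<omega>\<in>space (P n) - Bad. \<bar>X n \<omega>\<bar> \<le> \<delta>)" using small[OF \<delta>, of "\<epsilon> / 2"] by simp
    then show "\<forall>\<^sub>F n in sequentially. dist (measure (P n) {\<omega> \<in> space (P n). \<bar>X n \<omega>\<bar> > \<delta>}) 0 < \<epsilon>"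
    proof eventually_elim
      case (elim n)
      interpret prob_space "P n" by (rule prob)
      from elim obtain Bad where Bad: "Bad \<in> sets (P n)" "measure (P n) Bad \<le> \<epsilon> / 2"
        "\<forall>\<omega>\<in>space (P n) - Bad. \<bar>X n \<omega>\<bar> \<le> \<delta>" by blast
      have "measure (P n) {\<omega> \<in> space (P n). \<bar>X n \<omega>\<bar> > \<delta>} \<le> measure (P n) Bad"
        by (rule finite_measure_mono) (use Bad in \<open>force simp: not_less\<close>, rule Bad(1))
      then show ?case using Bad(2) \<open>0 < \<epsilon>\<close> by simp
    qed
  qed
qed

theorem lemma4:
  fixes P :: "nat \<Rightarrow> 'a measure"
    and J T0 Tstar N T :: "nat \<Rightarrow> nat"
    and Y M u Mhat :: "nat \<Rightarrow> 'a \<Rightarrow> real mat"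
    and K :: "nat \<Rightarrow> nat \<Rightarrow> real"
    and \<kappa> :: real
    and ell :: "nat \<Rightarrow> real"
  assumes prob: "\<And>n. prob_space (P n)"
    and N_eq: "\<And>n. N n = J n + 1"
    and T_eq: "\<And>n. T n = T0 n + Tstar n"
    and J_lim: "filterlim J at_top sequentially"
    and T0_lim: "filterlim T0 at_top sequentially"
    and K_pos: "\<And>m s. K m s > 0"
    and Y_rm: "\<And>n. random_matrix (P n) (N n) (T n) (Y n)"
    and M_rm: "\<And>n. random_matrix (P n) (N n) (T n) (M n)"
    and u_rm: "\<And>n. random_matrix (P n) (N n) (T n) (u n)"
    and Mhat_rm: "\<And>n. random_matrix (P n) (N n) (T n) (Mhat n)"
    and model: "\<And>n. AE \<omega> in P n. Y n \<omega> = M n \<omega> + u n \<omega>"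
    and M_bound: "\<And>n. AE \<omega> in P n. nuclear_norm (M n \<omega>) \<le> K (N n) (T n)"
    and u_mean: "\<And>n j t. j < N n \<Longrightarrow> t < T n \<Longrightarrow>
          cond_mean_zero (P n) (matrix_sigma (P n) (N n) (T n) (M n)) (\<lambda>\<omega>. u n \<omega> $$ (j, t))"
    and Mhat_argmin: "\<And>n. AE \<omega> in P n.
          nuclear_ls_estimate (N n) (T n) (K (N n) (T n)) (Y n \<omega>) (Mhat n \<omega>)"
    and cond_indep: "\<And>n. cond_indep_vars (P n) (matrix_sigma (P n) (N n) (T n) (M n))
          (\<lambda>j. \<Pi>\<^sub>M t\<in>{..<T n}. borel) (matrix_row (T n) (u n)) {..<N n}"
    and kappa: "\<kappa> > 1"
    and moment: "bigO_P_1 P (\<lambda>n.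
          max_cond_moment (P n) (matrix_sigma (P n) (N n) (T n) (M n)) (N n) (T n) (2 * \<kappa>) (u n))"
    and second_moment: "bigO_P_1 P (\<lambda>n \<omega>. ennreal (spectral_norm
          (avg_cond_second_moment (P n) (matrix_sigma (P n) (N n) (T n) (M n)) (N n) (T n) (u n) \<omega>)))"
    and ell_pos: "\<And>s. ell s > 0"
    and ell_rate: "(\<lambda>n. ell (T n) / (real (N n) * real (T n)) * K (N n) (T n)
          * sqrt (max (real (N n)) (real (N n) powr (1 / \<kappa>) * real (T n) * ln (real (N n)))))
          \<longlonglongrightarrow> 0"
    and ell_event: "(\<lambda>n. measure (P n) {\<omega> \<in> space (P n).
          (\<Sum>t<T n. (Mhat n \<omega> $$ (0, t) - M n \<omega> $$ (0, t))\<^sup>2) / real (T n)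
            \<le> ell (T n) / (real (N n) * real (T n))
                * (\<Sum>t<T n. \<Sum>j<N n. (Mhat n \<omega> $$ (j, t) - M n \<omega> $$ (j, t))\<^sup>2)
          \<and> (\<forall>t. T0 n \<le> t \<and> t < T n \<longrightarrow>
              (Mhat n \<omega> $$ (0, t) - M n \<omega> $$ (0, t))\<^sup>2
                \<le> ell (T n) / (real (N n) * real (T n))
                    * (\<Sum>s<T n. \<Sum>j<N n. (Mhat n \<omega> $$ (j, s) - M n \<omega> $$ (j, s))\<^sup>2))})
          \<longlonglongrightarrow> 1"
  shows "(\<forall>t. (\<forall>n. T0 n \<le> t n \<and> t n < T n) \<longrightarrow>
            smallo_P_1 P (\<lambda>n \<omega>. Mhat n \<omega> $$ (0, t n) - M n \<omega> $$ (0, t n)))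
       \<and> smallo_P_1 P (\<lambda>n \<omega>. (\<Sum>t<T n. (Mhat n \<omega> $$ (0, t) - M n \<omega> $$ (0, t))\<^sup>2) / real (T n))"
proof -
  let ?w = "\<lambda>n. ell (T n) / (real (N n) * real (T n))"
  let ?err = "\<lambda>n \<omega>. \<Sum>t<T n. \<Sum>j<N n. (Mhat n \<omega> $$ (j, t) - M n \<omega> $$ (j, t))\<^sup>2"
  let ?mx = "\<lambda>n. max (real (N n)) (real (N n) powr (1 / \<kappa>) * real (T n) * ln (real (N n)))"
  define A where "A n = {\<omega> \<in> space (P n).
          (\<Sum>t<T n. (Mhat n \<omega> $$ (0, t) - M n \<omega> $$ (0, t))\<^sup>2) / real (T n) \<le> ?w n * ?err n \<omega>
          \<and> (\<forall>t. T0 n \<le> t \<and> t < T n \<longrightarrow> (Mhat n \<omega> $$ (0, t) - M n \<omega> $$ (0, t))\<^sup>2 \<le> ?w n * ?err n \<omega>)}" for n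
  have A_lim: "(\<lambda>n. measure (P n) (A n)) \<longlonglongrightarrow> 1" using ell_event unfolding A_def .
  have N_lim: "filterlim (\<lambda>n. real (N n)) at_top sequentially"
    by (rule filterlim_compose[OF filterlim_real_sequentially], rule filterlim_at_top_mono[OF J_lim]) (simp add: N_eq)
  have T_pos: "\<forall>\<^sub>F n in sequentially. 0 < T n"
    using T0_lim[unfolded filterlim_at_top, rule_format, of 1] by eventually_elim (simp add: T_eq)
  \<comment> \<open>Both claims have the same right-hand side on \<open>A n\<close>, namely the
    weighted total squared error, so one estimate serves both.\<close>
  have key: "\<forall>\<^sub>F n in sequentially. \<exists>Bad\<in>sets (P n). measure (P n) Bad \<le> \<epsilon> \<and>
      (\<forall>\<omega>\<in>space (P n) - Bad. \<omega> \<in> A n \<and> ?w n * ?err n \<omega> \<le> \<delta>)" if \<delta>: "0 < \<delta>" and \<epsilon>: "0 < \<epsilon>" for \<delta> \<epsilon> :: real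
  proof -
    \<comment> \<open>Five contributions share \<epsilon>: a large moment, a large spectral norm, a
      long row, the Chernoff tail, and the complement of \<open>A n\<close>.\<close>
    define e where "e = \<epsilon> / 5"
    have e: "0 < e" using \<epsilon> by (simp add: e_def)
    obtain C1 where C1: "0 \<le> C1" "\<forall>\<^sub>F n in sequentially. measure (P n) {\<omega> \<in> space (P n).
        max_cond_moment (P n) (matrix_sigma (P n) (N n) (T n) (M n)) (N n) (T n) (2 * \<kappa>) (u n) \<omega> > ennreal C1} \<le> e"
      by (rule bigO_P_1_bound[OF moment e]) (rule that)
    obtain C2 where C2: "0 \<le> C2" "\<forall>\<^sub>F n in sequentially. measure (P n) {\<omega> \<in> space (P n). ennreal (spectral_norm
        (avg_cond_second_moment (P n) (matrix_sigma (P n) (N n) (T n) (M n)) (N n) (T n) (u n) \<omega>)) > ennreal C2} \<le> e"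
      by (rule bigO_P_1_bound[OF second_moment e]) (rule that)
    \<comment> \<open>Chosen so that \<open>(2 / c) powr \<kappa>\<close> equals
      \<open>e / (C1 + 1)\<close>; the summand 1 covers the case \<open>C1 = 0\<close>.\<close>
    define c where "c = 2 * ((C1 + 1) / e) powr (1 / \<kappa>)"
    have c: "0 < c" using C1 e by (simp add: c_def)
    have ce: "C1 * (2 / c) powr \<kappa> \<le> e"
    proof -
      have "2 / c = 1 / ((C1 + 1) / e) powr (1 / \<kappa>)" by (simp add: c_def)
      then have "(2 / c) powr \<kappa> = 1 / (((C1 + 1) / e) powr (1 / \<kappa>)) powr \<kappa>" by (simp add: powr_divide)
      also have "(((C1 + 1) / e) powr (1 / \<kappa>)) powr \<kappa> = (C1 + 1) / e"
        using kappa C1 e by (simp add: powr_powr)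
      finally have "C1 * (2 / c) powr \<kappa> = C1 / (C1 + 1) * e" by simp
      also have "\<dots> \<le> 1 * e" using C1 e by (intro mult_right_mono) auto
      finally show ?thesis by simp
    qed
    \<comment> \<open>The summand \<open>exp 1 * C2\<close> belongs to the entry \<open>N\<close> of
      the maximum, and \<open>3 * c\<close> to the other entry, with \<open>Suc k\<close> at most
      three times \<open>ln N\<close>.\<close>
    define C3 where "C3 = exp 1 * C2 + 3 * c"
    have C3: "0 < C3" using C2 c by (simp add: C3_def add_nonneg_pos)
    \<comment> \<open>The bound \<open>exp 1\<close> gives \<open>ln N\<close> at least 1, as needed
      for the choice of \<open>k\<close>; the bound \<open>exp 1 / e\<close> makes the Chernoff tail
      small.\<close>
    have N_big: "\<forall>\<^sub>F n in sequentially. max (exp 1) (exp 1 / e) \<le> real (N n)"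
      using N_lim unfolding filterlim_at_top by blast
    have rate: "\<forall>\<^sub>F n in sequentially. 4 * sqrt (exp 2 * C3) * (?w n * K (N n) (T n) * sqrt (?mx n)) < \<delta>"
    proof -
      have "(\<lambda>n. 4 * sqrt (exp 2 * C3) * (?w n * K (N n) (T n) * sqrt (?mx n))) \<longlonglongrightarrow> 4 * sqrt (exp 2 * C3) * 0"
        by (rule tendsto_mult_left[OF ell_rate])
      then show ?thesis using \<delta> by (auto dest: order_tendstoD(2)[of _ _ _ \<delta>])
    qed
    \<comment> \<open>Positivity is included because \<open>measure\<close> is 0 on non-measurable
      sets: a positive value shows that \<open>A n\<close> is measurable.\<close>
    have A_big: "\<forall>\<^sub>F n in sequentially. max 0 (1 - e) < measure (P n) (A n)"
      by (rule order_tendstoD(1)[OF A_lim]) (use e in simp)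
    show ?thesis
      using C1(2) C2(2) N_big rate A_big T_pos
    proof eventually_elim
      case (elim n)
      interpret prob_space "P n" by (rule prob)
      have Npos: "0 < N n" by (simp add: N_eq)
      define k where "k = nat \<lceil>ln (real (N n))\<rceil>"
      have lnN: "1 \<le> ln (real (N n))" using elim(3) Npos by (simp add: ln_ge_iff)
      have k1: "ln (real (N n)) \<le> real (Suc k)" and k2: "real (Suc k) \<le> 3 * ln (real (N n))"
        unfolding k_def using lnN by linarith+
      obtain Bo where Bo: "Bo \<in> sets (P n)"
        "measure (P n) Bo \<le> measure (P n) {\<omega> \<in> space (P n).
          max_cond_moment (P n) (matrix_sigma (P n) (N n) (T n) (M n)) (N n) (T n) (2 * \<kappa>) (u n) \<omega> > ennreal C1}
        + measure (P n) {\<omega> \<in> space (P n). ennreal (spectral_norm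
          (avg_cond_second_moment (P n) (matrix_sigma (P n) (N n) (T n) (M n)) (N n) (T n) (u n) \<omega>)) > ennreal C2}
        + C1 * (2 / c) powr \<kappa> + exp 1 * real (N n) * exp (- 2 * real (Suc k))"
        "\<And>\<omega>. \<omega> \<in> space (P n) - Bo \<Longrightarrow> ?err n \<omega> \<le> 4 * sqrt (exp 2 * (exp 1 * real (N n) * C2
          + real (Suc k) * (c * real (T n) * real (N n) powr (1 / \<kappa>)))) * K (N n) (T n)"
      proof (rule sample_error_bound[OF prob M_rm u_rm model M_bound Mhat_argmin cond_indep _ Npos elim(6) kappa C1(1) C2(1) c, where k = k])
        show "(\<lambda>\<omega>. ennreal (spectral_norm (avg_cond_second_moment (P n) (matrix_sigma (P n) (N n) (T n) (M n)) (N n) (T n) (u n) \<omega>)))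
            \<in> borel_measurable (P n)"
          using second_moment by (simp add: bigO_P_1_def)
      qed (rule that)
      have tail: "exp 1 * real (N n) * exp (- 2 * real (Suc k)) \<le> e"
      proof -
        \<comment> \<open>The factor 2 in the exponent yields \<open>1 / N^2\<close>, one power of
          \<open>N\<close> more than the prefactor consumes.\<close>
        have "exp (- 2 * real (Suc k)) \<le> exp (- (ln (real (N n)) + ln (real (N n))))" using k1 by simp
        also have "\<dots> = 1 / (real (N n) * real (N n))"
          unfolding exp_minus exp_add using Npos by (simp add: inverse_eq_divide)
        finally have "exp 1 * real (N n) * exp (- 2 * real (Suc k)) \<le> exp 1 * real (N n) * (1 / (real (N n) * real (N n)))"
          by (intro mult_left_mono) auto
        also have "\<dots> = exp 1 / real (N n)" using Npos by simp
        also have "\<dots> \<le> e" using elim(3) e Npos by (simp add: field_simps)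
        finally show ?thesis .
      qed
      have A_sets: "A n \<in> sets (P n)" using elim(5) measure_notin_sets[of "A n" "P n"] by fastforce
      have mA: "measure (P n) (space (P n) - A n) \<le> e" using prob_compl[OF A_sets] elim(5) by simp
      define Bad where "Bad = Bo \<union> (space (P n) - A n)"
      have "Bad \<in> sets (P n)" unfolding Bad_def using Bo(1) A_sets by auto
      moreover have "measure (P n) Bad \<le> \<epsilon>"
      proof -
        have "measure (P n) Bad \<le> measure (P n) Bo + measure (P n) (space (P n) - A n)"
          unfolding Bad_def by (rule measure_Un_le) (use Bo(1) A_sets in auto)
        then have "measure (P n) Bad \<le> 5 * e" using Bo(2) elim(1,2) ce tail mA by linarith
        then show ?thesis by (simp add: e_def)
      qed
      moreover have "\<omega> \<in> A n \<and> ?w n * ?err n \<omega> \<le> \<delta>" if \<omega>: "\<omega> \<in> space (P n) - Bad" for \<omega>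
      proof
        show "\<omega> \<in> A n" using \<omega> by (auto simp: Bad_def)
        have w0: "0 \<le> ?w n" using ell_pos[of "T n"] by simp
        have mx: "exp 1 * real (N n) * C2 + real (Suc k) * (c * real (T n) * real (N n) powr (1 / \<kappa>)) \<le> C3 * ?mx n"
        proof -
          have "exp 1 * C2 * real (N n) \<le> exp 1 * C2 * ?mx n"
            using C2(1) by (intro mult_left_mono) auto
          then have "exp 1 * real (N n) * C2 \<le> exp 1 * C2 * ?mx n" by (simp only: mult_ac)
          moreover have "real (Suc k) * (c * real (T n) * real (N n) powr (1 / \<kappa>))
              \<le> 3 * ln (real (N n)) * (c * real (T n) * real (N n) powr (1 / \<kappa>))"
            using k2 c by (intro mult_right_mono) auto
          moreover have "3 * ln (real (N n)) * (c * real (T n) * real (N n) powr (1 / \<kappa>))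
              = 3 * c * (real (N n) powr (1 / \<kappa>) * real (T n) * ln (real (N n)))" by simp
          moreover have "\<dots> \<le> 3 * c * ?mx n" using c by (intro mult_left_mono) auto
          ultimately show ?thesis unfolding C3_def distrib_right by linarith
        qed
        have "?err n \<omega> \<le> 4 * sqrt (exp 2 * (exp 1 * real (N n) * C2
          + real (Suc k) * (c * real (T n) * real (N n) powr (1 / \<kappa>)))) * K (N n) (T n)"
          using Bo(3) \<omega> by (auto simp: Bad_def)
        also have "\<dots> \<le> 4 * sqrt (exp 2 * (C3 * ?mx n)) * K (N n) (T n)"
          using mx K_pos[of "N n" "T n"]
          by (intro mult_right_mono mult_left_mono real_sqrt_le_mono) auto
        also have "\<dots> = 4 * sqrt (exp 2 * C3) * (K (N n) (T n) * sqrt (?mx n))"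
          by (simp add: real_sqrt_mult mult_ac)
        finally have "?w n * ?err n \<omega> \<le> ?w n * (4 * sqrt (exp 2 * C3) * (K (N n) (T n) * sqrt (?mx n)))"
          by (rule mult_left_mono[OF _ w0])
        also have "\<dots> = 4 * sqrt (exp 2 * C3) * (?w n * K (N n) (T n) * sqrt (?mx n))" by (simp only: mult_ac)
        also have "\<dots> \<le> \<delta>" using elim(4) by (rule less_imp_le)
        finally show "?w n * ?err n \<omega> \<le> \<delta>" .
      qed
      ultimately show ?case by blast
    qed
  qed
  have entry_meas: "(\<lambda>\<omega>. Mhat n \<omega> $$ (0, t) - M n \<omega> $$ (0, t)) \<in> borel_measurable (P n)" if "t < T n" for n t
  proof -
    have "0 < N n" by (simp add: N_eq)
    then have "(\<lambda>\<omega>. Mhat n \<omega> $$ (0, t)) \<in> borel_measurable (P n)" "(\<lambda>\<omega>. M n \<omega> $$ (0, t)) \<in> borel_measurable (P n)"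
      using Mhat_rm[of n] M_rm[of n] that unfolding random_matrix_def by blast+
    then show ?thesis by (rule borel_measurable_diff)
  qed
  have 1: "smallo_P_1 P (\<lambda>n \<omega>. Mhat n \<omega> $$ (0, t n) - M n \<omega> $$ (0, t n))" if t: "\<forall>n. T0 n \<le> t n \<and> t n < T n" for t
  proof (rule smallo_P_1I[OF prob])
    show "(\<lambda>\<omega>. Mhat n \<omega> $$ (0, t n) - M n \<omega> $$ (0, t n)) \<in> borel_measurable (P n)" for n
      using t by (intro entry_meas) simp
    fix \<delta> \<epsilon> :: real assume \<delta>: "0 < \<delta>" and \<epsilon>: "0 < \<epsilon>"
    \<comment> \<open>The event controls the squared error of a single entry, so the estimate is
      invoked with the square of \<delta>.\<close>
    have "0 < \<delta>\<^sup>2" using \<delta> by simp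
    from key[OF this \<epsilon>] show "\<forall>\<^sub>F n in sequentially. \<exists>Bad\<in>sets (P n). measure (P n) Bad \<le> \<epsilon> \<and>
        (\<forall>\<omega>\<in>space (P n) - Bad. \<bar>Mhat n \<omega> $$ (0, t n) - M n \<omega> $$ (0, t n)\<bar> \<le> \<delta>)"
    proof eventually_elim
      case (elim n)
      then obtain Bad where Bad: "Bad \<in> sets (P n)" "measure (P n) Bad \<le> \<epsilon>"
        "\<And>\<omega>. \<omega> \<in> space (P n) - Bad \<Longrightarrow> \<omega> \<in> A n \<and> ?w n * ?err n \<omega> \<le> \<delta>\<^sup>2" by blast
      have "\<bar>Mhat n \<omega> $$ (0, t n) - M n \<omega> $$ (0, t n)\<bar> \<le> \<delta>" if "\<omega> \<in> space (P n) - Bad" for \<omega>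
      proof -
        have "(Mhat n \<omega> $$ (0, t n) - M n \<omega> $$ (0, t n))\<^sup>2 \<le> ?w n * ?err n \<omega>"
          using Bad(3)[OF that] t unfolding A_def by blast
        then have "(Mhat n \<omega> $$ (0, t n) - M n \<omega> $$ (0, t n))\<^sup>2 \<le> \<delta>\<^sup>2"
          using Bad(3)[OF that] by linarith
        then show ?thesis using \<delta> by (simp add: abs_le_square_iff[symmetric])
      qed
      then show ?case using Bad(1,2) by blast
    qed
  qed
  have 2: "smallo_P_1 P (\<lambda>n \<omega>. (\<Sum>t<T n. (Mhat n \<omega> $$ (0, t) - M n \<omega> $$ (0, t))\<^sup>2) / real (T n))"
  proof (rule smallo_P_1I[OF prob])
    show "(\<lambda>\<omega>. (\<Sum>t<T n. (Mhat n \<omega> $$ (0, t) - M n \<omega> $$ (0, t))\<^sup>2) / real (T n)) \<in> borel_measurable (P n)" for n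
      by (intro borel_measurable_divide borel_measurable_sum borel_measurable_power entry_meas) auto
    fix \<delta> \<epsilon> :: real assume \<delta>: "0 < \<delta>" and \<epsilon>: "0 < \<epsilon>"
    from key[OF this] show "\<forall>\<^sub>F n in sequentially. \<exists>Bad\<in>sets (P n). measure (P n) Bad \<le> \<epsilon> \<and>
        (\<forall>\<omega>\<in>space (P n) - Bad. \<bar>(\<Sum>t<T n. (Mhat n \<omega> $$ (0, t) - M n \<omega> $$ (0, t))\<^sup>2) / real (T n)\<bar> \<le> \<delta>)"
    proof eventually_elim
      case (elim n)
      then obtain Bad where Bad: "Bad \<in> sets (P n)" "measure (P n) Bad \<le> \<epsilon>"
        "\<And>\<omega>. \<omega> \<in> space (P n) - Bad \<Longrightarrow> \<omega> \<in> A n \<and> ?w n * ?err n \<omega> \<le> \<delta>" by blast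
      have "\<bar>(\<Sum>t<T n. (Mhat n \<omega> $$ (0, t) - M n \<omega> $$ (0, t))\<^sup>2) / real (T n)\<bar> \<le> \<delta>"
        if "\<omega> \<in> space (P n) - Bad" for \<omega>
      proof -
        have "(\<Sum>t<T n. (Mhat n \<omega> $$ (0, t) - M n \<omega> $$ (0, t))\<^sup>2) / real (T n) \<le> ?w n * ?err n \<omega>"
          using Bad(3)[OF that] unfolding A_def by blast
        moreover have "0 \<le> (\<Sum>t<T n. (Mhat n \<omega> $$ (0, t) - M n \<omega> $$ (0, t))\<^sup>2) / real (T n)"
          by (intro divide_nonneg_nonneg sum_nonneg) auto
        ultimately show ?thesis using Bad(3)[OF that] by linarith
      qed
      then show ?case using Bad(1,2) by blast
    qed
  qed
  show ?thesis using 1 2 by blast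
qed

end
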